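(* Let $n\ge 2$, $\lambda=\frac{n-1}{2}$, and let $\{g_a:\ a\in\mathbb R_+\}$ be a spherical wavelet on $\mathcal S^n$ whose Gegenbauer coefficients are of the form $$\widehat{g_a}(l)=\frac{l+\lambda}{\lambda}\,\gamma\bigl(a\,\tau(l)\bigr),\qquad l\in\mathbb N_0,\ a\in\mathbb R_+,$$ for some function $\tau$ and a function $\gamma$ such that $\int_0^\infty\bigl|\,(|\gamma|^2)'(t)\,\bigr|\,dt<\infty$. Then for any $\epsilon>0$ and $\delta>0$ there exists a constant $\rho>0$ such that for any sequence $\mathcal B=(b_j)_{j\in\mathbb N_0}$ of positive numbers with $b_0\geq-\log\rho$ and $1<b_j/b_{j+1}<1+\rho\,\delta$ for all $j$, the family $\{g_{b_j,x}:\ b_j\in\mathcal B,\ x\in\mathcal S^n\}$ is a semi-continuous frame for $\mathcal L^2(\mathcal S^n)$ satisfying the frame condition with the prescribed $\epsilon$; that is, for suitable weights $\nu_j>0$, $$(1-\epsilon)\,\|f\|^2\leq\sum_{j=0}^\infty\nu_j\int_{\mathcal S^n}\bigl|\langle g_{b_j,x},f\rangle\bigr|^2\,d\sigma(x)\leq(1+\epsilon)\,\|f\|^2\qquad\text{for all } f\in\mathcal L^2(\mathcal S^n).$$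
   Context: $\mathcal S^n\subset\mathbb R^{n+1}$ is the unit sphere with rotation-invariant surface measure $\sigma$ of total mass $\Sigma_n=\frac{2\pi^{\lambda+1}}{\Gamma(\lambda+1)}$. The scalar product on $\mathcal L^2(\mathcal S^n)$ is $\langle f,g\rangle=\frac1{\Sigma_n}\int_{\mathcal S^n}\overline{f}\,g\,d\sigma$, with induced norm $\|\cdot\|$. A zonal function is one depending only on $\hat e\cdot x$, where $\hat e=(1,0,\dots,0)$; it is identified with a function on $[-1,1]$. The Gegenbauer polynomials $C_l^\lambda$ are defined by $\sum_{l\ge0}C_l^\lambda(t)r^l=(1-2tr+r^2)^{-\lambda}$, and the Gegenbauer coefficients $\widehat f(l)$ of a zonal $f$ are the coefficients in the expansion $f(t)=\sum_{l=0}^\infty\widehat f(l)\,C_l^\lambda(t)$. The convolution of $f$ with a zonal $g$ is $(f\ast g)(x)=\frac1{\Sigma_n}\int_{\mathcal S^n}f(y)\,g(x\cdot y)\,d\sigma(y)$. A family $\{\Psi_a\}_{a\in\mathbb R_+}$ of zonal integrable functions is called a spherical wavelet if (1) $\int_0^\infty|\widehat{\Psi_a}(l)|^2\frac{da}{a}=\left(\frac{l+\lambda}{\lambda}\right)^2$ for every $l\in\mathbb N_0$, and (2) there is $M$ such that for all $R\in\mathbb R_+$, $\int_{-1}^1\bigl|\int_R^\infty(\overline{\Psi_a}\ast\Psi_a)(t)\frac{da}{a}\bigr|(1-t^2)^{\lambda-1/2}dt\le M$. For $x\in\mathcal S^n$ put $\Psi_{a,x}(y)=\Psi_a(x\cdot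 y)$; the wavelet transform is $\mathcal W_\Psi f(a,x)=\langle\Psi_{a,x},f\rangle=(f\ast\overline{\Psi_a})(x)$. "Semi-continuous" means that only the scale parameter is discretized.
   Formalization: The formal theorem also assumes b_j → 0 and, in wavelet condition (2), that the scale integral over a > R converges absolutely jointly in (a,t); the claim fails without the first (b_j → β > 0) and under a purely pointwise reading of the second (τ(l) = 1/(l+1)). *)

theory Defs
  imports "HOL-Analysis.Analysis"
begin

text \<open>
  The unit sphere \<open>S\<^sup>n\<close> is \<^term>\<open>sphere 0 1\<close> in a Euclidean space of dimension \<open>n + 1\<close>.
  The surface measure is introduced as the cone measure, that is
  \<open>\<sigma>(A) = (n + 1) vol {r x | 0 < r < 1, x \<in> A}\<close>. The lemmas below show that it is the
  rotation-invariant measure of total mass \<open>\<Sigma>\<^sub>n\<close>.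
\<close>

definition sphere_measure :: "'a::euclidean_space measure" where
  "sphere_measure =
     scale_measure (of_nat DIM('a))
       (distr (restrict_space lborel (ball 0 1 - {0})) (restrict_space borel (sphere 0 1)) sgn)"

definition gegenbauer_index :: "'a::euclidean_space itself \<Rightarrow> real" where
  \<comment> \<open>\<open>\<lambda> = (n - 1) / 2\<close> with \<open>n + 1 = DIM('a)\<close>\<close>
  "gegenbauer_index _ = (real DIM('a) - 2) / 2"

definition sphere_area :: "'a::euclidean_space itself \<Rightarrow> real" where
  "sphere_area T = 2 * pi powr (gegenbauer_index T + 1) / Gamma (gegenbauer_index T + 1)"

lemma space_sphere_measure [simp]: "space sphere_measure = sphere (0::'a::euclidean_space) 1"
  by (auto simp: sphere_measure_def space_scale_measure space_restrict_space)

lemma sets_sphere_measure [simp]: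
  "sets (sphere_measure :: 'a::euclidean_space measure) = sets (restrict_space borel (sphere 0 1))"
  by (simp add: sphere_measure_def)

lemma sgn_measurable_sphere:
  "sgn \<in> measurable (restrict_space (borel :: 'a::euclidean_space measure) (ball 0 1 - {0}))
           (restrict_space borel (sphere 0 1))"
proof (rule measurable_restrict_space3)
  show "sgn \<in> borel_measurable (borel :: 'a measure)"
    unfolding sgn_div_norm by measurable
  show "sgn \<in> ball 0 1 - {0} \<rightarrow> sphere (0::'a) 1"
    by (auto simp: norm_sgn)
qed

lemma sgn_measurable_sphere_lborel:
  "sgn \<in> measurable (restrict_space (lborel :: 'a::euclidean_space measure) (ball 0 1 - {0}))
           (restrict_space borel (sphere 0 1))"
  using sgn_measurable_sphere
  by (subst measurable_cong_sets[OF sets_restrict_space_cong[OF sets_lborel] refl])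

lemma emeasure_sphere_measure:
  assumes "A \<in> sets (restrict_space borel (sphere (0::'a::euclidean_space) 1))"
  shows "emeasure sphere_measure A =
           of_nat DIM('a) * emeasure lborel {x \<in> ball 0 1 - {0}. sgn x \<in> A}"
proof -
  have [simp]: "ball (0::'a) 1 - {0} \<in> sets borel"
    by measurable
  have "emeasure sphere_measure A = of_nat DIM('a) *
      emeasure (restrict_space lborel (ball (0::'a) 1 - {0}))
        (sgn -` A \<inter> space (restrict_space lborel (ball (0::'a) 1 - {0})))"
    using assms unfolding sphere_measure_def
    by (simp only: emeasure_scale_measure emeasure_distr[OF sgn_measurable_sphere_lborel])
  also have "sgn -` A \<inter> space (restrict_space lborel (ball (0::'a) 1 - {0})) =
      {x \<in> ball 0 1 - {0}. sgn x \<in> A}"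
    by (auto simp: space_restrict_space)
  also have "emeasure (restrict_space lborel (ball (0::'a) 1 - {0})) \<dots> =
      emeasure lborel {x \<in> ball 0 1 - {0}. sgn x \<in> A}"
    by (rule emeasure_restrict_space) auto
  finally show ?thesis .
qed

lemma emeasure_sphere_measure_total:
  "emeasure sphere_measure (sphere (0::'a) 1) = ennreal (sphere_area TYPE('a::euclidean_space))"
proof -
  have eq: "{x \<in> ball (0::'a) 1 - {0}. sgn x \<in> sphere 0 1} = ball 0 1 - {0}"
    by (auto simp: norm_sgn)
  have "emeasure lborel (ball (0::'a) 1 - {0}) = emeasure lborel (ball (0::'a) 1)"
    by (intro emeasure_Diff_null_set) auto
  also have "\<dots> = ennreal (unit_ball_vol (real DIM('a)))"
    by (simp add: emeasure_ball)
  finally have "emeasure (sphere_measure :: 'a measure) (sphere 0 1) =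
      ennreal (real DIM('a) * unit_ball_vol (real DIM('a)))"
    by (subst emeasure_sphere_measure)
       (simp_all only: eq, auto simp: ennreal_mult ennreal_of_nat_eq_real_of_nat sets_restrict_space_iff)
  also have "real DIM('a) * unit_ball_vol (real DIM('a)) = sphere_area TYPE('a)"
  proof -
    define d where "d = real DIM('a)"
    have d: "d > 0" by (simp add: d_def)
    have Gamma: "Gamma (d / 2 + 1) = d / 2 * Gamma (d / 2)"
      using d by (intro Gamma_plus1) (auto elim: nonpos_Ints_cases)
    have half: "(d - 2) / 2 + 1 = d / 2" by (simp add: field_simps)
    have "Gamma (d / 2) > 0"
      using d by (intro Gamma_real_pos) auto
    then show ?thesis
      using d unfolding sphere_area_def gegenbauer_index_def unit_ball_vol_def d_def[symmetric]
        half Gamma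
      by simp
  qed
  finally show ?thesis .
qed

lemma lborel_orthogonal_invariant:
  fixes T :: "'a::euclidean_space \<Rightarrow> 'a"
  assumes T: "orthogonal_transformation T"
  shows "distr lborel borel T = lborel"
proof (rule measure_eqI)
  show "sets (distr lborel borel T) = sets lborel" by simp
next
  fix A assume "A \<in> sets (distr lborel borel T)"
  then have A [measurable]: "A \<in> sets borel" by simp
  have lin: "linear T" using T by (rule orthogonal_transformation_linear)
  have Tm [measurable]: "T \<in> borel_measurable borel"
    using lin by (intro borel_measurable_continuous_onI linear_continuous_on)
      (simp add: linear_conv_bounded_linear)
  define N where "N = distr lborel borel T"
  define B where "B = ball (0::'a) 1"
  have B [measurable]: "B \<in> sets borel" by (simp add: B_def)
  have [measurable_cong]: "sets N = sets borel" by (simp add: N_def)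
  interpret N: sigma_finite_measure N
  proof -
    have *: "emeasure N (ball 0 r) = emeasure lborel (ball (0::'a) r)" for r
    proof -
      have "emeasure N (ball 0 r) = emeasure lborel (T -` ball 0 r)"
        by (simp add: N_def emeasure_distr)
      also have "T -` ball 0 r = ball 0 r"
        using T by (auto simp: orthogonal_transformation_norm)
      finally show ?thesis .
    qed
    show "sigma_finite_measure N"
    proof
      show "\<exists>F. countable F \<and> F \<subseteq> sets N \<and> \<Union> F = space N \<and> (\<forall>a\<in>F. emeasure N a \<noteq> \<infinity>)"
      proof (intro exI conjI)
        show "countable (range (\<lambda>n::nat. ball (0::'a) (real n)))" by simp
        show "range (\<lambda>n::nat. ball (0::'a) (real n)) \<subseteq> sets N" by (auto simp: N_def)
        show "\<Union> (range (\<lambda>n::nat. ball (0::'a) (real n))) = space N"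
          by (auto simp: N_def reals_Archimedean2)
        show "\<forall>a\<in>range (\<lambda>n::nat. ball (0::'a) (real n)). emeasure N a \<noteq> \<infinity>"
          by (auto simp: * emeasure_ball)
      qed
    qed
  qed
  interpret P: pair_sigma_finite N lborel
    by standard
  have NB: "emeasure N B = emeasure lborel B"
  proof -
    have "T -` B = B"
      using T by (auto simp: B_def orthogonal_transformation_norm)
    then show ?thesis by (simp add: N_def emeasure_distr)
  qed
  have transl: "(\<integral>\<^sup>+x. h (x + y) \<partial>lborel) = (\<integral>\<^sup>+x. h x \<partial>lborel)"
    if [measurable]: "h \<in> borel_measurable borel" for h and y :: 'a
  proof -
    have "(\<integral>\<^sup>+x. h x \<partial>lborel) = (\<integral>\<^sup>+x. h x \<partial>distr lborel borel ((+) y))"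
      by (simp add: lborel_distr_plus)
    also have "\<dots> = (\<integral>\<^sup>+x. h (x + y) \<partial>lborel)"
      by (subst nn_integral_distr) (auto simp: add.commute)
    finally show ?thesis by simp
  qed
  have translN: "(\<integral>\<^sup>+x. h (x + y) \<partial>N) = (\<integral>\<^sup>+x. h x \<partial>N)"
    if [measurable]: "h \<in> borel_measurable borel" for h and y :: 'a
  proof -
    obtain z where z: "T z = y"
      using orthogonal_transformation_surj[OF T] by (metis surjD)
    have "(\<integral>\<^sup>+x. h (x + y) \<partial>N) = (\<integral>\<^sup>+x. h (T (x + z)) \<partial>lborel)"
      using lin by (simp add: N_def nn_integral_distr linear_add z)
    also have "\<dots> = (\<integral>\<^sup>+x. h (T x) \<partial>lborel)"
      by (rule transl) measurable
    also have "\<dots> = (\<integral>\<^sup>+x. h x \<partial>N)"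
      by (simp add: N_def nn_integral_distr)
    finally show ?thesis .
  qed
  have sym: "x - y \<in> B \<longleftrightarrow> y - x \<in> B" for x y
    by (simp add: B_def norm_minus_commute)
  have "emeasure N A * emeasure lborel B =
      (\<integral>\<^sup>+x. indicator A x * (\<integral>\<^sup>+y. indicator B (y - x) \<partial>lborel) \<partial>N)"
  proof -
    have "(\<integral>\<^sup>+y. indicator B (y - x) \<partial>lborel) = emeasure lborel B" for x
      using transl[of "indicator B" "- x"] by simp
    then show ?thesis by (simp add: nn_integral_multc)
  qed
  also have "\<dots> = (\<integral>\<^sup>+x. (\<integral>\<^sup>+y. indicator A x * indicator B (x - y) \<partial>lborel) \<partial>N)"
    by (intro nn_integral_cong) (simp add: nn_integral_cmult[symmetric] indicator_def sym)
  also have "\<dots> = (\<integral>\<^sup>+y. (\<integral>\<^sup>+x. indicator A x * indicator B (x - y) \<partial>N) \<partial>lborel)"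
    by (rule P.Fubini'[symmetric]) measurable
  also have "\<dots> = (\<integral>\<^sup>+y. (\<integral>\<^sup>+x. indicator A (x + y) * indicator B x \<partial>N) \<partial>lborel)"
  proof (rule nn_integral_cong)
    fix y
    show "(\<integral>\<^sup>+x. indicator A x * indicator B (x - y) \<partial>N) =
        (\<integral>\<^sup>+x. indicator A (x + y) * indicator B x \<partial>N)"
      using translN[of "\<lambda>x. indicator A x * indicator B (x - y)" y] by simp
  qed
  also have "\<dots> = (\<integral>\<^sup>+x. (\<integral>\<^sup>+y. indicator A (x + y) * indicator B x \<partial>lborel) \<partial>N)"
    by (rule P.Fubini') measurable
  also have "\<dots> = (\<integral>\<^sup>+x. emeasure lborel A * indicator B x \<partial>N)"
    using transl[of "indicator A" x for x]
    by (intro nn_integral_cong) (simp add: nn_integral_multc add.commute)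
  also have "\<dots> = emeasure lborel A * emeasure lborel B"
    by (simp add: nn_integral_cmult NB)
  finally have "emeasure N A * emeasure lborel B = emeasure lborel A * emeasure lborel B" .
  moreover have "emeasure lborel B \<noteq> 0" "emeasure lborel B \<noteq> \<infinity>"
    by (simp_all add: B_def emeasure_ball unit_ball_vol_pos[THEN less_imp_neq, symmetric] ennreal_eq_0_iff not_le)
  ultimately show "emeasure (distr lborel borel T) A = emeasure lborel A"
    unfolding N_def[symmetric] by (metis ennreal_mult_divide_eq infinity_ennreal_def)
qed

lemma sphere_measure_rotation_invariant:
  fixes T :: "'a::euclidean_space \<Rightarrow> 'a"
  assumes T: "orthogonal_transformation T"
  assumes A: "A \<in> sets sphere_measure"
  shows "emeasure sphere_measure {x \<in> sphere 0 1. T x \<in> A} = emeasure sphere_measure A"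
proof -
  have lin: "linear T" using T by (rule orthogonal_transformation_linear)
  have Tm [measurable]: "T \<in> borel_measurable borel"
    using lin by (intro borel_measurable_continuous_onI linear_continuous_on)
      (simp add: linear_conv_bounded_linear)
  have A': "A \<in> sets borel" "A \<subseteq> sphere 0 1"
    using A by (auto simp: sets_restrict_space_iff)
  note [measurable] = A'(1)
  have [measurable]: "sgn \<in> borel_measurable (borel :: 'a measure)"
    unfolding sgn_div_norm by measurable
  have T0: "T x = 0 \<longleftrightarrow> x = 0" for x
    using orthogonal_transformation_norm[OF T, of x] by (metis norm_eq_zero)
  have sgnT: "sgn (T x) = T (sgn x)" for x
    using T lin by (simp add: sgn_div_norm orthogonal_transformation_norm linear_scale)
  have S: "{x \<in> sphere 0 1. T x \<in> A} = T -` A"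
    using A'(2) T by (auto simp: orthogonal_transformation_norm)
  have "T -` A \<in> sets borel"
    using measurable_sets[OF Tm A'(1)] by simp
  then have m: "T -` A \<in> sets (restrict_space borel (sphere 0 1))"
    using S by (auto simp: sets_restrict_space_iff)
  have "emeasure lborel {x \<in> ball 0 1 - {0}. sgn x \<in> T -` A}
      = emeasure lborel (T -` {x \<in> ball 0 1 - {0}. sgn x \<in> A})"
    using T by (intro arg_cong[of _ _ "emeasure lborel"])
      (auto simp: orthogonal_transformation_norm sgnT T0)
  also have "\<dots> = emeasure (distr lborel borel T) {x \<in> ball 0 1 - {0}. sgn x \<in> A}"
    by (subst emeasure_distr) auto
  also have "\<dots> = emeasure lborel {x \<in> ball 0 1 - {0}. sgn x \<in> A}"
    by (simp add: lborel_orthogonal_invariant[OF T])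
  finally show ?thesis
    using A m unfolding S by (simp add: emeasure_sphere_measure)
qed


definition L2_sphere :: "('a::euclidean_space \<Rightarrow> complex) set" where
  "L2_sphere = {f. f \<in> borel_measurable sphere_measure \<and>
                   integrable sphere_measure (\<lambda>x. (cmod (f x))\<^sup>2)}"

definition sphere_inner :: "('a::euclidean_space \<Rightarrow> complex) \<Rightarrow> ('a \<Rightarrow> complex) \<Rightarrow> complex" where
  "sphere_inner f g =
     (\<integral>y. cnj (f y) * g y \<partial>sphere_measure) / of_real (sphere_area TYPE('a))"

definition sphere_norm :: "('a::euclidean_space \<Rightarrow> complex) \<Rightarrow> real" where
  "sphere_norm f = sqrt (Re (sphere_inner f f))"

definition sphere_conv :: "('a::euclidean_space \<Rightarrow> complex) \<Rightarrow> (real \<Rightarrow> complex) \<Rightarrow> 'a \<Rightarrow> complex" where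
  "sphere_conv f h x =
     (\<integral>y. f y * h (x \<bullet> y) \<partial>sphere_measure) / of_real (sphere_area TYPE('a))"

text \<open>
  A zonal function is represented by its profile on \<open>[-1, 1]\<close>: \<open>zonal e h\<close> is the function on
  the sphere with profile \<open>h\<close> and pole \<open>e\<close>, and \<open>profile e F\<close> recovers the
  profile of a function \<open>F\<close> that is zonal about \<open>e\<close> (the choice of the point is then
  irrelevant).
\<close>

definition zonal :: "'a::euclidean_space \<Rightarrow> (real \<Rightarrow> complex) \<Rightarrow> 'a \<Rightarrow> complex" where
  "zonal e h x = h (e \<bullet> x)"

definition profile :: "'a::euclidean_space \<Rightarrow> ('a \<Rightarrow> complex) \<Rightarrow> real \<Rightarrow> complex" where
  "profile e F t = F (SOME x. x \<in> sphere 0 1 \<and> e \<bullet> x = t)"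

definition gegenbauer :: "real \<Rightarrow> nat \<Rightarrow> real \<Rightarrow> real" where
  \<comment> \<open>coefficient of \<open>r\<^sup>l\<close> in \<open>(1 + (r\<^sup>2 - 2 t r)) powr (-\<lambda>)\<close>\<close>
  "gegenbauer lam l t =
     fps_nth (fps_compose (fps_binomial (- lam)) (fps_X ^ 2 - fps_const (2 * t) * fps_X)) l"

definition gegenbauer_weight :: "real \<Rightarrow> real \<Rightarrow> real" where
  "gegenbauer_weight lam t = (1 - t\<^sup>2) powr (lam - 1 / 2)"

text \<open>
  The coefficient of \<open>C\<^sub>l\<close> in the Gegenbauer series of an integrable zonal function. Since the
  \<open>C\<^sub>l\<close> are orthogonal with respect to the weight, it is given by the usual Fourier formula; for a
  merely integrable function the series need not converge pointwise.
\<close>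

definition gegenbauer_coeff :: "real \<Rightarrow> (real \<Rightarrow> complex) \<Rightarrow> nat \<Rightarrow> complex" where
  "gegenbauer_coeff lam h l =
     (LBINT t:{-1..1}. h t * of_real (gegenbauer lam l t * gegenbauer_weight lam t)) /
     of_real (LBINT t:{-1..1}. (gegenbauer lam l t)\<^sup>2 * gegenbauer_weight lam t)"

text \<open>
  Spherical wavelets with pole \<open>e\<close>. The scale integral in the second condition is the
  Bochner integral of a family of integrable functions: it is required to exist as an
  absolutely convergent double integral. Mere convergence for each fixed \<open>t\<close> would not do,
  since the resulting function is then not tied to the Gegenbauer coefficients of the family
  (one may lose a point mass at \<open>t = 1\<close>).
\<close>

definition spherical_wavelet :: "'a::euclidean_space \<Rightarrow> (real \<Rightarrow> real \<Rightarrow> complex) \<Rightarrow> bool" where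
  "spherical_wavelet e \<Psi> \<longleftrightarrow>
     (let lam = gegenbauer_index TYPE('a);
          w = gegenbauer_weight lam;
          K = (\<lambda>a. profile e (sphere_conv (zonal e (\<lambda>t. cnj (\<Psi> a t))) (\<Psi> a)))
      in (\<forall>a>0. integrable sphere_measure (zonal e (\<Psi> a))) \<and>
         (\<forall>l. set_integrable lborel {0<..} (\<lambda>a. (cmod (gegenbauer_coeff lam (\<Psi> a) l))\<^sup>2 / a) \<and>
              (LBINT a:{0<..}. (cmod (gegenbauer_coeff lam (\<Psi> a) l))\<^sup>2 / a)
                = ((real l + lam) / lam)\<^sup>2) \<and>
         (\<forall>R>0. set_integrable (lborel \<Otimes>\<^sub>M lborel) ({R<..} \<times> {-1..1})
                   (\<lambda>(a, t). K a t / of_real a * of_real (w t))) \<and>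
         (\<exists>M. \<forall>R>0. (LBINT t:{-1..1}. cmod (LBINT a:{R<..}. K a t / of_real a) * w t) \<le> M))"

definition wavelet_transform ::
    "(real \<Rightarrow> real \<Rightarrow> complex) \<Rightarrow> ('a::euclidean_space \<Rightarrow> complex) \<Rightarrow> real \<Rightarrow> 'a \<Rightarrow> complex" where
  \<comment> \<open>\<open>zonal x (\<Psi> a)\<close> is \<open>y \<mapsto> \<Psi>\<^sub>a(x \<cdot> y)\<close>\<close>
  "wavelet_transform \<Psi> f a x = sphere_inner (zonal x (\<Psi> a)) f"

end

theory Submission
  imports Defs "HOL-Probability.Probability"
begin

text \<open>
  On the \<open>l\<close>-th spherical harmonics the transform at scale \<open>a\<close> acts as multiplication by
  \<open>cnj (\<gamma> (a \<tau>\<^sub>l))\<close>, so by Parseval the frame sum is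
  \<open>\<Sum>\<^sub>l E\<^sub>l(f) \<Sum>\<^sub>j ln (b\<^sub>j / b\<^sub>j\<^sub>+\<^sub>1) |\<gamma> (b\<^sub>j \<tau>\<^sub>l)|\<^sup>2\<close>, where
  \<open>E\<^sub>l(f)\<close> is the energy of the \<open>l\<close>-th harmonic component and the weights are
  \<open>ln (b\<^sub>j / b\<^sub>j\<^sub>+\<^sub>1) / \<Sigma>\<^sub>n\<close>. The inner sum is a Riemann sum for
  \<open>\<integral> |\<gamma> (t)|\<^sup>2 dt / t = 1\<close>; on each interval the error is at most \<open>\<rho> \<delta>\<close> times the variation
  of \<open>|\<gamma>|\<^sup>2\<close>, and the missing tail beyond \<open>b\<^sub>0 \<tau>\<^sub>l\<close> is small uniformly in \<open>l\<close> once
  \<open>\<tau>\<close> is bounded away from \<open>0\<close>. This last fact is where the second wavelet condition enters: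
  \<open>\<integral>\<^sub>1\<^sup>\<infinity> |\<gamma> (a \<tau>\<^sub>l)|\<^sup>2 da / a\<close> is the \<open>l\<close>-th multiplier of an integrable zonal
  function, so it vanishes as \<open>l\<close> grows, whereas it would tend to \<open>1\<close> along \<open>\<tau>\<^sub>l\<close> tending to \<open>0\<close>.

  Spherical harmonics enter only through the zonal projection kernels. Convolution with a zonal
  function is self-adjoint and does not raise the degree of zonal polynomials, hence it is diagonal in
  the Gegenbauer polynomials.
\<close>

section \<open>The uniform probability measure on the sphere\<close>

text \<open>
  The normalised surface measure is taken as a Borel measure on the whole space, where measurability
  can be proved automatically.
\<close>

definition usm :: "'a::euclidean_space measure" where
  "usm = density (distr sphere_measure borel (\<lambda>x. x)) (\<lambda>_. ennreal (1 / sphere_area TYPE('a)))"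

lemma sphere_area_pos: "sphere_area TYPE('a::euclidean_space) > 0"
proof -
  have "real DIM('a) > 0" by simp
  then have "gegenbauer_index TYPE('a) + 1 > 0"
    unfolding gegenbauer_index_def by (simp add: field_simps)
  then show ?thesis by (simp add: sphere_area_def Gamma_real_pos)
qed

lemma measurable_sphere_measureI:
  "f \<in> borel_measurable borel \<Longrightarrow> f \<in> borel_measurable (sphere_measure :: 'a::euclidean_space measure)"
  by (subst measurable_cong_sets[OF sets_sphere_measure refl]) (rule measurable_restrict_space1)

lemma id_measurable_sphere:
  "(\<lambda>x. x) \<in> measurable (sphere_measure :: 'a::euclidean_space measure) borel"
  by (rule measurable_sphere_measureI) simp

lemma sets_usm [simp, measurable_cong]: "sets usm = sets borel"
  and space_usm [simp]: "space usm = UNIV"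
  by (simp_all add: usm_def)

lemma integrable_scaleR_iff:
  fixes f :: "'x \<Rightarrow> 'b::{banach, second_countable_topology}"
  assumes "c \<noteq> 0"
  shows "integrable M (\<lambda>x. c *\<^sub>R f x) \<longleftrightarrow> integrable M f"
proof
  assume "integrable M (\<lambda>x. c *\<^sub>R f x)"
  then have "integrable M (\<lambda>x. inverse c *\<^sub>R (c *\<^sub>R f x))" by (rule integrable_scaleR_right)
  then show "integrable M f" using assms by simp
qed simp

lemma
  fixes f :: "'a::euclidean_space \<Rightarrow> ennreal"
  assumes [measurable]: "f \<in> borel_measurable borel"
  shows nn_integral_usm: "(\<integral>\<^sup>+x. f x \<partial>usm) = ennreal (1 / sphere_area TYPE('a)) * (\<integral>\<^sup>+x. f x \<partial>sphere_measure)"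
    and nn_integral_sphere: "(\<integral>\<^sup>+x. f x \<partial>sphere_measure) = ennreal (sphere_area TYPE('a)) * (\<integral>\<^sup>+x. f x \<partial>usm)"
proof -
  have m: "f \<in> borel_measurable sphere_measure" by (rule measurable_sphere_measureI) simp
  show 1: "(\<integral>\<^sup>+x. f x \<partial>usm) = ennreal (1 / sphere_area TYPE('a)) * (\<integral>\<^sup>+x. f x \<partial>sphere_measure)"
    using m unfolding usm_def by (simp add: id_measurable_sphere nn_integral_density nn_integral_distr nn_integral_cmult)
  have "ennreal (sphere_area TYPE('a)) * ennreal (1 / sphere_area TYPE('a)) = 1"
    using sphere_area_pos[where 'a='a] by (simp flip: ennreal_mult)
  then show "(\<integral>\<^sup>+x. f x \<partial>sphere_measure) = ennreal (sphere_area TYPE('a)) * (\<integral>\<^sup>+x. f x \<partial>usm)"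
    by (simp add: 1 flip: mult.assoc)
qed

lemma
  fixes f :: "'a::euclidean_space \<Rightarrow> 'b::{banach, second_countable_topology}"
  assumes [measurable]: "f \<in> borel_measurable borel"
  shows integral_sphere: "(\<integral>x. f x \<partial>sphere_measure) = sphere_area TYPE('a) *\<^sub>R (\<integral>x. f x \<partial>usm)"
    and integrable_sphere: "integrable sphere_measure f \<longleftrightarrow> integrable usm f"
proof -
  have m: "f \<in> borel_measurable sphere_measure" by (rule measurable_sphere_measureI) simp
  have p: "sphere_area TYPE('a) > 0" by (rule sphere_area_pos)
  show "(\<integral>x. f x \<partial>sphere_measure) = sphere_area TYPE('a) *\<^sub>R (\<integral>x. f x \<partial>usm)"
    using p m unfolding usm_def by (subst integral_density) (auto simp: id_measurable_sphere integral_distr)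
  show "integrable sphere_measure f \<longleftrightarrow> integrable usm f"
    using p m unfolding usm_def
    by (subst integrable_density) (auto simp: id_measurable_sphere integrable_distr_eq integrable_scaleR_iff)
qed

lemma prob_space_usm: "prob_space (usm :: 'a::euclidean_space measure)"
proof
  have "emeasure (usm :: 'a measure) (space usm) = (\<integral>\<^sup>+x. 1 \<partial>(usm :: 'a measure))" by simp
  also have "\<dots> = ennreal (1 / sphere_area TYPE('a)) * emeasure (sphere_measure :: 'a measure) (sphere 0 1)"
    by (subst nn_integral_usm) simp_all
  also have "\<dots> = 1"
    using sphere_area_pos[where 'a='a]
    by (simp add: emeasure_sphere_measure_total flip: ennreal_mult)
  finally show "emeasure (usm :: 'a measure) (space usm) = 1" .
qed

interpretation usm: prob_space usm by (rule prob_space_usm)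
interpretation usm2: pair_prob_space usm usm ..

lemma AE_usm: "AE x in (usm :: 'a::euclidean_space measure). norm x = 1"
proof (rule AE_I)
  have "emeasure (usm :: 'a measure) {x. norm x \<noteq> 1} = (\<integral>\<^sup>+x. indicator {x. norm x \<noteq> 1} x \<partial>(usm :: 'a measure))"
    by (subst nn_integral_indicator) auto
  also have "\<dots> = ennreal (1 / sphere_area TYPE('a)) * (\<integral>\<^sup>+x. 0 \<partial>(sphere_measure :: 'a measure))"
    by (subst nn_integral_usm, simp, intro arg_cong2[where f="(*)"] refl nn_integral_cong) auto
  finally show "emeasure (usm :: 'a measure) {x. norm x \<noteq> 1} = 0" by simp
qed auto

lemma orthogonal_transformation_measurable:
  fixes T :: "'a::euclidean_space \<Rightarrow> 'a"
  shows "orthogonal_transformation T \<Longrightarrow> T \<in> borel_measurable borel"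
  using orthogonal_transformation_linear[of T]
  by (intro borel_measurable_continuous_onI linear_continuous_on) (simp add: linear_conv_bounded_linear)

lemma distr_usm:
  fixes T :: "'a::euclidean_space \<Rightarrow> 'a"
  assumes T: "orthogonal_transformation T"
  shows "distr usm borel T = usm"
proof (rule measure_eqI)
  fix A assume "A \<in> sets (distr usm borel T)"
  then have A [measurable]: "A \<in> sets borel" by simp
  note [measurable] = orthogonal_transformation_measurable[OF T]
  have e: "emeasure usm B = ennreal (1 / sphere_area TYPE('a)) * emeasure sphere_measure (B \<inter> sphere 0 1)"
    if [measurable]: "B \<in> sets borel" for B :: "'a set"
  proof -
    have B: "B \<inter> sphere 0 1 \<in> sets sphere_measure"
      by (auto simp: sets_restrict_space)
    have "emeasure usm B = (\<integral>\<^sup>+x. indicator B x \<partial>usm)" by simp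
    also have "\<dots> = ennreal (1 / sphere_area TYPE('a)) * (\<integral>\<^sup>+x. indicator B x \<partial>sphere_measure)"
      by (subst nn_integral_usm) auto
    also have "(\<integral>\<^sup>+x. indicator B x \<partial>sphere_measure) = (\<integral>\<^sup>+x. indicator (B \<inter> sphere 0 1) x \<partial>sphere_measure)"
      by (rule nn_integral_cong) (auto simp: indicator_def)
    also have "\<dots> = emeasure sphere_measure (B \<inter> sphere 0 1)"
      using B by (rule nn_integral_indicator)
    finally show ?thesis .
  qed
  have m: "A \<inter> sphere 0 1 \<in> sets sphere_measure"
    by (auto simp: sets_restrict_space)
  have TA: "T -` A \<in> sets borel" using measurable_sets[OF orthogonal_transformation_measurable[OF T] A] by simp
  have "T -` A \<inter> sphere 0 1 = {x \<in> sphere 0 1. T x \<in> A \<inter> sphere 0 1}"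
    using T by (auto simp: orthogonal_transformation_norm)
  then have "emeasure usm (T -` A) = emeasure usm A"
    by (simp only: e[OF TA] e[OF A] sphere_measure_rotation_invariant[OF T m])
  moreover have "emeasure (distr usm borel T) A = emeasure usm (T -` A \<inter> space usm)"
    using orthogonal_transformation_measurable[OF T] A
    by (intro emeasure_distr) (auto cong: measurable_cong_sets)
  ultimately show "emeasure (distr usm borel T) A = emeasure usm A"
    by (simp only: space_usm Int_UNIV_right)
qed simp

lemma
  fixes T :: "'a::euclidean_space \<Rightarrow> 'a" and h :: "'a \<Rightarrow> 'b::{banach, second_countable_topology}"
  assumes T: "orthogonal_transformation T"
  shows nn_integral_usm_rot: "f \<in> borel_measurable borel \<Longrightarrow> (\<integral>\<^sup>+x. f (T x) \<partial>usm) = (\<integral>\<^sup>+x. f x \<partial>usm)"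
    and integral_usm_rot: "h \<in> borel_measurable borel \<Longrightarrow> (\<integral>x. h (T x) \<partial>usm) = (\<integral>x. h x \<partial>usm)"
    and integrable_usm_rot: "h \<in> borel_measurable borel \<Longrightarrow> integrable usm (\<lambda>x. h (T x)) \<longleftrightarrow> integrable usm h"
proof -
  note [measurable] = orthogonal_transformation_measurable[OF T]
  have m: "T \<in> measurable usm borel"
    using orthogonal_transformation_measurable[OF T] by (simp cong: measurable_cong_sets)
  show "(\<integral>\<^sup>+x. f (T x) \<partial>usm) = (\<integral>\<^sup>+x. f x \<partial>usm)" if "f \<in> borel_measurable borel"
    using nn_integral_distr[OF m, of f] that by (simp add: distr_usm[OF T] measurable_cong_sets[OF sets_usm refl])
  show "(\<integral>x. h (T x) \<partial>usm) = (\<integral>x. h x \<partial>usm)" if "h \<in> borel_measurable borel"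
    using integral_distr[OF m that] unfolding distr_usm[OF T] by (rule sym)
  show "integrable usm (\<lambda>x. h (T x)) \<longleftrightarrow> integrable usm h" if "h \<in> borel_measurable borel"
    using integrable_distr_eq[OF m that] unfolding distr_usm[OF T] by (rule sym)
qed

definition reflection :: "'a::real_inner \<Rightarrow> 'a \<Rightarrow> 'a" where
  "reflection v x = x - (2 * (x \<bullet> v) / (v \<bullet> v)) *\<^sub>R v"

lemma reflection_orthogonal: "orthogonal_transformation (reflection v)"
proof -
  have "linear (reflection v)"
    by (rule linearI) (simp_all add: reflection_def algebra_simps add_divide_distrib)
  moreover have "reflection v x \<bullet> reflection v y = x \<bullet> y" for x y
    by (cases "v = 0") (simp_all add: reflection_def inner_diff_left inner_diff_right inner_commute)
  ultimately show ?thesis unfolding orthogonal_transformation_def by blast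
qed

lemma reflection_fixes: "z \<bullet> v = 0 \<Longrightarrow> reflection v z = z"
  by (simp add: reflection_def)

lemma reflection_swaps:
  assumes "norm x = norm y"
  shows "reflection (x - y) x = y" "reflection (x - y) y = x"
proof -
  have n: "x \<bullet> x = y \<bullet> y" using assms by (simp add: norm_eq)
  show "reflection (x - y) x = y"
  proof (cases "x = y")
    case False
    then have "(x - y) \<bullet> (x - y) \<noteq> 0" by simp
    moreover have "2 * (x \<bullet> (x - y)) = (x - y) \<bullet> (x - y)"
      using n by (simp add: inner_diff_left inner_diff_right inner_commute)
    ultimately show ?thesis by (simp add: reflection_def)
  qed (simp add: reflection_def)
  show "reflection (x - y) y = x"
  proof (cases "x = y")
    case False
    then have "(x - y) \<bullet> (x - y) \<noteq> 0" by simp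
    moreover have "2 * (y \<bullet> (x - y)) = - ((x - y) \<bullet> (x - y))"
      using n by (simp add: inner_diff_left inner_diff_right inner_commute)
    ultimately show ?thesis by (simp add: reflection_def)
  qed (simp add: reflection_def)
qed

lemma reflection_inner: "reflection v x \<bullet> y = x \<bullet> reflection v y"
  by (simp add: reflection_def inner_diff_left inner_diff_right inner_commute)

lemma zonal_conv_commute:
  fixes H :: "real \<Rightarrow> real \<Rightarrow> 'b::{banach, second_countable_topology}"
  fixes x z :: "'a::euclidean_space"
  assumes n: "norm x = norm z"
  assumes m: "(\<lambda>y. H (x \<bullet> y) (y \<bullet> z)) \<in> borel_measurable borel"
  shows "(\<integral>y. H (x \<bullet> y) (y \<bullet> z) \<partial>usm) = (\<integral>y. H (z \<bullet> y) (y \<bullet> x) \<partial>usm)"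
proof -
  let ?T = "reflection (x - z)"
  have "x \<bullet> ?T y = z \<bullet> y" "?T y \<bullet> z = y \<bullet> x" for y
    using reflection_inner[of "x - z" x y] reflection_inner[of "x - z" y z]
    by (simp_all only: reflection_swaps[OF n])
  then show ?thesis
    using integral_usm_rot[OF reflection_orthogonal m, of "x - z"] by simp
qed

lemma borel_measurable_sphere_ext:
  fixes f :: "'a::euclidean_space \<Rightarrow> 'b::real_normed_vector"
  assumes "f \<in> borel_measurable sphere_measure"
  shows "(\<lambda>x. indicator (sphere 0 1) x *\<^sub>R f x) \<in> borel_measurable borel"
  using assms by (subst (asm) measurable_cong_sets[OF sets_sphere_measure refl])
    (simp add: borel_measurable_restrict_space_iff)

section \<open>Zonal moments\<close>

lemma integrable_usm_bounded:
  fixes f :: "'a::euclidean_space \<Rightarrow> 'b::{banach, second_countable_topology}"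
  assumes "f \<in> borel_measurable borel" "\<And>x. norm x = 1 \<Longrightarrow> norm (f x) \<le> B"
  shows "integrable usm f"
proof (rule usm.integrable_const_bound)
  show "AE x in usm. norm (f x) \<le> B" using AE_usm by eventually_elim (rule assms)
qed (use assms(1) in \<open>simp cong: measurable_cong_sets\<close>)

lemma integrable_usm_continuous:
  fixes f :: "'a::euclidean_space \<Rightarrow> 'b::{banach, second_countable_topology}"
  assumes c: "continuous_on UNIV f"
  shows "integrable usm f"
proof -
  have "compact (f ` sphere 0 1)"
    by (intro compact_continuous_image continuous_on_subset[OF c]) auto
  then obtain B where "\<forall>y\<in>f ` sphere 0 1. norm y \<le> B"
    using compact_imp_bounded bounded_iff by blast
  then show ?thesis
    using c by (intro integrable_usm_bounded[where B=B] borel_measurable_continuous_onI) auto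
qed

lemma integral_usm_zonal_cong:
  fixes F :: "real \<Rightarrow> 'b::{banach, second_countable_topology}" and x y :: "'a::euclidean_space"
  assumes n: "norm x = norm y" and F: "F \<in> borel_measurable borel"
  shows "(\<integral>z. F (x \<bullet> z) \<partial>usm) = (\<integral>z. F (y \<bullet> z) \<partial>usm)"
proof -
  have "(\<integral>z. F (x \<bullet> z) \<partial>usm) = (\<integral>z. F (x \<bullet> reflection (x - y) z) \<partial>usm)"
    by (rule integral_usm_rot[OF reflection_orthogonal, symmetric]) (use F in measurable)
  also have "\<dots> = (\<integral>z. F (y \<bullet> z) \<partial>usm)"
    by (simp only: reflection_inner[symmetric] reflection_swaps[OF n])
  finally show ?thesis .
qed

definition zmean :: "'a::euclidean_space \<Rightarrow> real poly \<Rightarrow> real" where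
  "zmean e p = (\<integral>x. poly p (e \<bullet> x) \<partial>usm)"

lemma integrable_zpoly: "integrable usm (\<lambda>x. poly p (e \<bullet> x) :: real)"
  by (intro integrable_usm_continuous continuous_intros)

lemma zmean_add: "zmean e (p + q) = zmean e p + zmean e q"
  and zmean_smult: "zmean e (smult c p) = c * zmean e p"
  and zmean_0 [simp]: "zmean e 0 = 0"
  and zmean_1 [simp]: "zmean e 1 = 1"
  by (simp_all add: zmean_def integrable_zpoly usm.prob_space[simplified])

lemma zmean_sum: "zmean e (\<Sum>i\<in>A. p i) = (\<Sum>i\<in>A. zmean e (p i))"
  by (induction A rule: infinite_finite_induct) (auto simp: zmean_add)

lemma zmean_odd:
  assumes "\<And>t. poly p (- t) = - poly p t"
  shows "zmean (e::'a::euclidean_space) p = 0"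
proof -
  have "orthogonal_transformation (\<lambda>x::'a. - x)"
    using orthogonal_transformation_neg[of "\<lambda>x::'a. x"] orthogonal_transformation_id by simp
  then have "(\<integral>x. poly p (e \<bullet> - x) \<partial>usm) = (\<integral>x. poly p (e \<bullet> x) \<partial>usm)"
    by (rule integral_usm_rot) (intro borel_measurable_continuous_onI continuous_intros)
  then show ?thesis by (simp add: zmean_def assms)
qed

lemma real_poly_ext: "(\<And>x. poly p x = poly q x) \<Longrightarrow> p = (q :: real poly)"
  using poly_eq_poly_eq_iff[of p q] by auto

lemma coeff_one_plus_square_power:
  "coeff ([:1, 0, 1:] ^ q :: real poly) 0 = 1 \<and> coeff ([:1, 0, 1:] ^ q :: real poly) 1 = 0 \<and>
   coeff ([:1, 0, 1:] ^ q :: real poly) 2 = real q"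
  by (induction q) (auto simp: coeff_pCons numeral_2_eq_2 split: nat.splits)

text \<open>
  By rotation invariance \<open>\<integral> (e\<cdot>x + b u\<cdot>x)\<^sup>2\<^sup>q = (1 + b\<^sup>2)\<^sup>q \<integral> (e\<cdot>x)\<^sup>2\<^sup>q\<close> for all \<open>b\<close>; compare
  the coefficients of \<open>b\<^sup>2\<close>.
\<close>

lemma moment_orthogonal:
  fixes e u :: "'a::euclidean_space"
  assumes e: "norm e = 1" and u: "norm u = 1" and eu: "e \<bullet> u = 0" and q: "q > 0"
  shows "(2 * real q - 1) * (\<integral>x. (e \<bullet> x) ^ (2 * q - 2) * (u \<bullet> x)\<^sup>2 \<partial>usm) = (\<integral>x. (e \<bullet> x) ^ (2 * q) \<partial>usm)"
proof -
  define m where "m = 2 * q"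
  define I where "I j = (\<integral>x. (u \<bullet> x) ^ j * (e \<bullet> x) ^ (m - j) \<partial>usm)" for j
  define P where "P = (\<Sum>j\<le>m. monom (real (m choose j) * I j) j)"
  define Q where "Q = smult (I 0) ([:1, 0, 1:] ^ q)"
  have "poly P b = poly Q b" for b
  proof -
    have nb: "norm (b *\<^sub>R u + e) ^ 2 = 1 + b\<^sup>2"
      using e u eu unfolding power2_norm_eq_inner
      by (simp add: inner_add_left inner_add_right inner_commute norm_eq_1 power2_eq_square)
    have "poly P b = (\<Sum>j\<le>m. real (m choose j) * I j * b ^ j)"
      by (simp add: P_def poly_sum poly_monom)
    also have "\<dots> = (\<Sum>j\<le>m. (\<integral>x. real (m choose j) * b ^ j * ((u \<bullet> x) ^ j * (e \<bullet> x) ^ (m - j)) \<partial>usm))"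
      by (simp add: I_def mult_ac)
    also have "\<dots> = (\<integral>x. (\<Sum>j\<le>m. real (m choose j) * b ^ j * ((u \<bullet> x) ^ j * (e \<bullet> x) ^ (m - j))) \<partial>usm)"
      by (rule Bochner_Integration.integral_sum[symmetric], rule integrable_usm_continuous, intro continuous_intros)
    also have "\<dots> = (\<integral>x. ((b *\<^sub>R u + e) \<bullet> x) ^ m \<partial>usm)"
      by (simp add: inner_add_left binomial_ring power_mult_distrib mult_ac)
    also have "\<dots> = (\<integral>x. ((norm (b *\<^sub>R u + e) *\<^sub>R e) \<bullet> x) ^ m \<partial>usm)"
      using e by (intro integral_usm_zonal_cong) auto
    also have "\<dots> = (\<integral>x. norm (b *\<^sub>R u + e) ^ m * (e \<bullet> x) ^ m \<partial>usm)"
      by (simp add: power_mult_distrib)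
    also have "\<dots> = (1 + b\<^sup>2) ^ q * I 0"
      by (simp add: m_def power_mult nb I_def)
    also have "\<dots> = poly Q b"
      by (simp add: Q_def poly_power power2_eq_square mult_ac)
    finally show ?thesis .
  qed
  then have "P = Q"
    using poly_eq_poly_eq_iff[of P Q] by auto
  then have "coeff P 2 = coeff Q 2" by simp
  moreover have "coeff P 2 = real (m choose 2) * I 2"
    using q by (simp add: P_def coeff_sum m_def if_distrib cong: if_cong)
  moreover have "coeff Q 2 = real q * I 0"
    using coeff_one_plus_square_power[of q] by (simp add: Q_def)
  moreover have "real (m choose 2) = real q * (2 * real q - 1)"
  proof -
    have "m choose 2 = q * (2 * q - 1)"
      by (simp add: choose_two m_def)
    then show ?thesis using q by (simp add: of_nat_diff)
  qed
  ultimately have "(2 * real q - 1) * I 2 = I 0" using q by simp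
  then show ?thesis by (simp add: I_def m_def mult.commute)
qed

lemma moment_recursion:
  fixes e :: "'a::euclidean_space"
  assumes e: "norm e = 1"
  shows "(real k + real DIM('a)) * zmean e (monom 1 (k + 2)) = (real k + 1) * zmean e (monom 1 k)"
proof (cases "even k")
  case True
  then obtain q' where q': "k = 2 * q'" by blast
  define q where "q = Suc q'"
  have q: "k = 2 * q - 2" "q > 0" "2 * q - 2 + 2 = 2 * q" "k + 2 = 2 * q" by (auto simp: q_def q')
  obtain e0 :: 'a where e0: "e0 \<in> Basis" using nonempty_Basis by blast
  have ne0: "norm e0 = 1" using e0 by simp
  have z: "zmean e (monom 1 j) = (\<integral>x. (e0 \<bullet> x) ^ j \<partial>usm)" for j
    using integral_usm_zonal_cong[of e e0 "\<lambda>t. t ^ j"] e ne0 by (simp add: zmean_def poly_monom)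
  have i: "integrable usm (\<lambda>x. (e0 \<bullet> x) ^ i * (u \<bullet> x)\<^sup>2)" for i and u :: 'a
    by (intro integrable_usm_continuous continuous_intros)
  have i': "integrable usm (\<lambda>x. (e0 \<bullet> x) ^ i)" for i
    by (intro integrable_usm_continuous continuous_intros)
  have "(real DIM('a) - 1) * zmean e (monom 1 (k + 2)) = (\<Sum>u\<in>Basis - {e0}. (\<integral>x. (e0 \<bullet> x) ^ (2 * q) \<partial>usm))"
    unfolding q(4) z using e0 by (simp add: card_Diff_singleton of_nat_diff)
  also have "\<dots> = (\<Sum>u\<in>Basis - {e0}. (2 * real q - 1) * (\<integral>x. (e0 \<bullet> x) ^ (2 * q - 2) * (u \<bullet> x)\<^sup>2 \<partial>usm))"
    using e0 q(2) by (intro sum.cong moment_orthogonal[symmetric]) (auto simp: inner_Basis)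
  also have "\<dots> = (2 * real q - 1) * (\<integral>x. (\<Sum>u\<in>Basis - {e0}. (e0 \<bullet> x) ^ (2 * q - 2) * (u \<bullet> x)\<^sup>2) \<partial>usm)"
    by (subst Bochner_Integration.integral_sum) (auto simp: i sum_distrib_left)
  also have "(\<integral>x. (\<Sum>u\<in>Basis - {e0}. (e0 \<bullet> x) ^ (2 * q - 2) * (u \<bullet> x)\<^sup>2) \<partial>usm) =
     (\<integral>x. (e0 \<bullet> x) ^ (2 * q - 2) - (e0 \<bullet> x) ^ (2 * q) \<partial>usm)"
  proof (rule integral_cong_AE)
    show "AE x in usm. (\<Sum>u\<in>Basis - {e0}. (e0 \<bullet> x) ^ (2 * q - 2) * (u \<bullet> x)\<^sup>2) =
        (e0 \<bullet> x) ^ (2 * q - 2) - (e0 \<bullet> x) ^ (2 * q)"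
      using AE_usm
    proof eventually_elim
      case (elim x)
      have "(\<Sum>u\<in>Basis. (u \<bullet> x)\<^sup>2) = 1"
        using elim euclidean_inner[of x x] by (simp add: norm_eq_1 power2_eq_square inner_commute)
      then have "(\<Sum>u\<in>Basis - {e0}. (u \<bullet> x)\<^sup>2) = 1 - (e0 \<bullet> x)\<^sup>2"
        using e0 by (simp add: sum_diff1)
      moreover have "(e0 \<bullet> x) ^ (2 * q) = (e0 \<bullet> x) ^ (2 * q - 2) * (e0 \<bullet> x)\<^sup>2"
        using q(3) by (metis power_add)
      ultimately show ?case
        by (simp add: right_diff_distrib flip: sum_distrib_left)
    qed
  qed auto
  also have "\<dots> = zmean e (monom 1 k) - zmean e (monom 1 (k + 2))"
    using q(3) by (subst Bochner_Integration.integral_diff) (auto simp: i' z q(1))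
  finally show ?thesis
    using q(2) by (simp add: q(1) of_nat_diff algebra_simps)
next
  case False
  then have "zmean e (monom 1 k) = 0" "zmean e (monom 1 (k + 2)) = 0"
    by (auto intro!: zmean_odd simp: poly_monom)
  then show ?thesis by simp
qed


lemma gegenbauer_weight_nonneg [simp]: "0 \<le> gegenbauer_weight lam t"
  by (simp add: gegenbauer_weight_def)

lemma gegenbauer_weight_measurable [measurable]: "gegenbauer_weight lam \<in> borel_measurable borel"
  unfolding gegenbauer_weight_def by measurable

lemma gegenbauer_weight_le_1:
  assumes "lam \<ge> 1 / 2" "t \<in> {-1..1}"
  shows "gegenbauer_weight lam t \<le> 1"
proof -
  have "t\<^sup>2 \<le> 1" using assms(2) by (auto simp: abs_square_le_1)
  then show ?thesis
    using assms(1) by (auto simp: gegenbauer_weight_def intro!: powr_le1)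
qed

definition wmean :: "real \<Rightarrow> real poly \<Rightarrow> real" where
  "wmean lam p = (LBINT t:{-1..1}. poly p t * gegenbauer_weight lam t)"

lemma wpoly_integrable:
  assumes "lam \<ge> 1 / 2"
  shows "set_integrable lborel {-1..1} (\<lambda>t. poly p t * gegenbauer_weight lam t)"
proof -
  have "set_integrable lborel {-1..1} (poly p)"
    by (rule borel_integrable_compact[folded set_integrable_def, simplified]) (auto intro!: continuous_intros)
  then show ?thesis
    unfolding set_integrable_def
  proof (rule Bochner_Integration.integrable_bound)
    show "AE t in lborel. norm (indicator {- 1..1} t *\<^sub>R (poly p t * gegenbauer_weight lam t))
        \<le> norm (indicator {- 1..1} t *\<^sub>R poly p t)"
      using gegenbauer_weight_le_1[OF assms]
      by (auto simp: abs_mult indicator_def intro!: mult_left_le)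
  qed (measurable, auto intro!: borel_measurable_continuous_onI continuous_intros)
qed

lemma wmean_add: "lam \<ge> 1 / 2 \<Longrightarrow> wmean lam (p + q) = wmean lam p + wmean lam q"
  and wmean_diff: "lam \<ge> 1 / 2 \<Longrightarrow> wmean lam (p - q) = wmean lam p - wmean lam q"
  and wmean_smult: "wmean lam (smult c p) = c * wmean lam p"
  using wpoly_integrable[of lam p] wpoly_integrable[of lam q]
  by (simp_all add: wmean_def algebra_simps set_integral_add set_integral_diff)

lemma wmean_ibp:
  assumes lam: "lam \<ge> 1 / 2"
  shows "wmean lam (pderiv p * [:1, 0, -1:] - smult (2 * lam + 1) (monom 1 1 * p)) = 0"
proof -
  define a where "a = lam - 1 / 2"
  have a: "a \<ge> 0" using lam by (simp add: a_def)
  let ?f = "\<lambda>t. poly p t * (1 - t\<^sup>2) powr (a + 1)"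
  let ?g = "\<lambda>t. poly (pderiv p * [:1, 0, -1:] - smult (2 * lam + 1) (monom 1 1 * p)) t * gegenbauer_weight lam t"
  have "(?g has_integral (?f 1 - ?f (- 1))) {-1..1}"
  proof (rule fundamental_theorem_of_calculus_interior)
    show "continuous_on {- 1..1} ?f"
      using a by (intro continuous_intros continuous_on_powr') (auto simp: abs_square_le_1)
    fix t :: real assume t: "t \<in> {-1<..<1}"
    then have t2: "1 - t\<^sup>2 > 0" by (auto simp: abs_square_less_1)
    have "(?f has_real_derivative (poly (pderiv p) t * (1 - t\<^sup>2) powr (a + 1)
        + poly p t * ((a + 1) * (1 - t\<^sup>2) powr (a + 1 - 1) * (- 2 * t)))) (at t)"
      using t2 by (auto intro!: derivative_eq_intros poly_DERIV)
    moreover have "poly (pderiv p) t * (1 - t\<^sup>2) powr (a + 1)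
        + poly p t * ((a + 1) * (1 - t\<^sup>2) powr (a + 1 - 1) * (- 2 * t)) = ?g t"
    proof -
      define Y where "Y = (1 - t\<^sup>2) powr a"
      have eqs: "gegenbauer_weight lam t = Y" "2 * lam + 1 = 2 * (a + 1)"
          "(1 - t\<^sup>2) powr (a + 1 - 1) = Y" "(1 - t\<^sup>2) powr (a + 1) = Y * (1 - t\<^sup>2)"
        using t2 powr_add[of "1 - t\<^sup>2" a 1] by (simp_all add: gegenbauer_weight_def a_def Y_def)
      show ?thesis
        unfolding eqs by (simp add: poly_monom algebra_simps power2_eq_square)
    qed
    ultimately have "(?f has_real_derivative ?g t) (at t)" by simp
    then show "(?f has_vector_derivative ?g t) (at t)"
      by (simp add: has_real_derivative_iff_has_vector_derivative)
  qed simp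
  then have "integral {-1..1} ?g = 0"
    by (simp add: integral_unique)
  then show ?thesis
    unfolding wmean_def using set_borel_integral_eq_integral(2)[OF wpoly_integrable[OF lam]] by metis
qed

lemma wmean_recursion:
  assumes lam: "lam \<ge> 1 / 2"
  shows "(real k + 2 * lam + 2) * wmean lam (monom 1 (k + 2)) = (real k + 1) * wmean lam (monom 1 k)"
proof -
  have "pderiv (monom 1 (k + 1)) * [:1, 0, -1:] - smult (2 * lam + 1) (monom 1 1 * monom 1 (k + 1))
      = smult (real k + 1) (monom 1 k - monom 1 (k + 2)) - smult (2 * lam + 1) (monom (1::real) (k + 2))"
    by (intro real_poly_ext) (simp add: pderiv_monom poly_monom algebra_simps power2_eq_square)
  then have "wmean lam (smult (real k + 1) (monom 1 k - monom 1 (k + 2)) - smult (2 * lam + 1) (monom 1 (k + 2))) = 0"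
    using wmean_ibp[OF lam, of "monom 1 (k + 1)"] by metis
  then show ?thesis
    by (simp only: wmean_diff[OF lam] wmean_smult) (simp add: algebra_simps)
qed

lemma wmean_1: assumes lam: "lam \<ge> 1 / 2" shows "wmean lam (monom 1 1) = 0"
proof -
  have "pderiv 1 * [:1, 0, -1:] - smult (2 * lam + 1) (monom 1 1 * 1) = smult (- (2 * lam + 1)) (monom (1::real) 1)"
    by (simp only: pderiv_1 mult_zero_left diff_0 mult_1_right smult_minus_left)
  then have "- (2 * lam + 1) * wmean lam (monom 1 1) = 0"
    using wmean_ibp[OF lam, of 1] wmean_smult by metis
  then show ?thesis using lam by simp
qed

lemma wmean_pos:
  assumes lam: "lam \<ge> 1 / 2"
  shows "wmean lam 1 > 0"
proof -
  let ?f = "\<lambda>t. indicator {-1..1} t * gegenbauer_weight lam t"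
  have i: "integrable lborel ?f"
    using wpoly_integrable[OF lam, of 1] by (simp add: set_integrable_def)
  have e: "wmean lam 1 = (\<integral>t. ?f t \<partial>lborel)"
    by (simp add: wmean_def set_lebesgue_integral_def)
  have "(\<integral>t. ?f t \<partial>lborel) \<noteq> 0"
  proof
    assume "(\<integral>t. ?f t \<partial>lborel) = 0"
    then have "AE t in lborel. ?f t = 0"
      by (subst (asm) integral_nonneg_eq_0_iff_AE[OF i]) auto
    then have "AE t in lborel. t \<notin> {-1<..<1::real}"
    proof eventually_elim
      case (elim t)
      show ?case
      proof
        assume t: "t \<in> {-1<..<1}"
        then have "t\<^sup>2 < 1" by (auto simp: abs_square_less_1)
        then show False using elim t by (auto simp: gegenbauer_weight_def indicator_def)
      qed
    qed
    moreover have "{t \<in> space lborel. \<not> t \<notin> {-1<..<1::real}} = {-1<..<1}" by auto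
    ultimately have "emeasure lborel {-1<..<1::real} = 0"
      by (subst (asm) AE_iff_measurable[where N="{-1<..<1}"]) auto
    then show False by simp
  qed
  moreover have "(\<integral>t. ?f t \<partial>lborel) \<ge> 0" by (intro Bochner_Integration.integral_nonneg) auto
  ultimately show ?thesis unfolding e by linarith
qed


lemma zmean_eq_wmean:
  fixes e :: "'a::euclidean_space"
  assumes e: "norm e = 1" and d: "DIM('a) \<ge> 3"
  defines "lam \<equiv> gegenbauer_index TYPE('a)"
  shows "zmean e p = wmean lam p / wmean lam 1"
proof -
  have lam: "lam \<ge> 1 / 2" and dim: "real DIM('a) = 2 * lam + 2"
    using d by (simp_all add: lam_def gegenbauer_index_def diff_divide_distrib)
  have pos: "wmean lam 1 > 0" by (rule wmean_pos[OF lam])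
  have mon: "zmean e (monom 1 k) = wmean lam (monom 1 k) / wmean lam 1" for k
  proof (induction k rule: less_induct)
    case (less k)
    consider "k = 0" | "k = 1" | k' where "k = k' + 2"
      by (metis One_nat_def add_2_eq_Suc' not0_implies_Suc)
    then show ?case
    proof cases
      case 1
      then show ?thesis using pos by (simp add: monom_0 one_pCons[symmetric])
    next
      case 2
      then show ?thesis using wmean_1[OF lam] by (auto intro!: zmean_odd simp: poly_monom)
    next
      case 3
      have "(real k' + 2 * lam + 2) * zmean e (monom 1 k) = (real k' + 1) * (wmean lam (monom 1 k') / wmean lam 1)"
        using moment_recursion[OF e, of k'] less[of k'] 3 by (simp add: dim add.assoc)
      also have "\<dots> = (real k' + 2 * lam + 2) * (wmean lam (monom 1 k) / wmean lam 1)"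
        using wmean_recursion[OF lam, of k'] 3 by simp
      finally show ?thesis using lam by (subst (asm) mult_left_cancel) auto
    qed
  qed
  have ws: "wmean lam (\<Sum>i\<in>A. q i) = (\<Sum>i\<in>A. wmean lam (q i))" for q and A :: "nat set"
    by (induction A rule: infinite_finite_induct) (auto simp: wmean_add[OF lam], auto simp: wmean_def)
  have "p = (\<Sum>i\<le>degree p. smult (coeff p i) (monom 1 i))"
    by (simp add: smult_monom poly_as_sum_of_monoms)
  then have "zmean e p = (\<Sum>i\<le>degree p. coeff p i * zmean e (monom 1 i))"
    and "wmean lam p = (\<Sum>i\<le>degree p. coeff p i * wmean lam (monom 1 i))"
    by (metis (no_types, lifting) zmean_sum zmean_smult sum.cong)
      (metis (no_types, lifting) \<open>p = _\<close> ws wmean_smult sum.cong)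
  then show ?thesis by (simp add: mon sum_divide_distrib)
qed

lemma finite_measure_eqI_moments:
  fixes M N :: "real measure"
  assumes sets: "sets M = sets borel" "sets N = sets borel"
  assumes fin: "finite_measure M" "finite_measure N"
  assumes supp: "AE t in M. t \<in> {-1..1}" "AE t in N. t \<in> {-1..1}"
  assumes moments: "\<And>p :: real poly. (\<integral>t. poly p t \<partial>M) = (\<integral>t. poly p t \<partial>N)"
  shows "M = N"
proof -
  interpret M: finite_measure M by fact
  interpret N: finite_measure N by fact
  have [measurable_cong]: "sets M = sets borel" "sets N = sets borel" by fact+
  have int: "integrable L f" if L: "L = M \<or> L = N" and f: "continuous_on UNIV f" for L and f :: "real \<Rightarrow> real"
  proof -
    interpret L: finite_measure L using L fin by auto
    have "compact (f ` {-1..1})"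
      by (intro compact_continuous_image continuous_on_subset[OF f]) auto
    then obtain B where B: "\<forall>y\<in>f ` {-1..1}. norm y \<le> B"
      using compact_imp_bounded bounded_iff by blast
    have "AE t in L. norm (f t) \<le> B"
    proof -
      have "AE t in L. t \<in> {-1..1}" using L supp by auto
      then show ?thesis by eventually_elim (use B in auto)
    qed
    moreover have "f \<in> borel_measurable L"
      using borel_measurable_continuous_onI[OF f] L sets by (auto cong: measurable_cong_sets)
    ultimately show ?thesis by (rule L.integrable_const_bound)
  qed
  have cont: "(\<integral>t. f t \<partial>M) = (\<integral>t. f t \<partial>N)" if f: "continuous_on UNIV f" for f :: "real \<Rightarrow> real"
  proof -
    define C where "C = measure M (space M) + measure N (space N) + 1"
    have C: "C > 0" by (simp add: C_def add_nonneg_pos)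
    have "\<bar>(\<integral>t. f t \<partial>M) - (\<integral>t. f t \<partial>N)\<bar> \<le> e" if e: "e > 0" for e
    proof -
      have "e / C > 0" using e C by simp
      then obtain g where g: "real_polynomial_function g" "\<And>t. t \<in> {-1..1::real} \<Longrightarrow> \<bar>f t - g t\<bar> < e / C"
        using Stone_Weierstrass_real_polynomial_function[of "{-1..1}" f "e / C"] continuous_on_subset[OF f] by auto
      then obtain a n where "g = (\<lambda>x. \<Sum>i\<le>n. a i * x ^ i)"
        using real_polynomial_function_iff_sum by auto
      then have gp: "g t = poly (\<Sum>i\<le>n. monom (a i) i) t" for t
        by (simp add: poly_sum poly_monom)
      have gc: "continuous_on UNIV g"
        unfolding gp by (intro continuous_intros)
      have b: "\<bar>(\<integral>t. f t \<partial>L) - (\<integral>t. g t \<partial>L)\<bar> \<le> measure L (space L) * (e / C)"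
        if L: "L = M \<or> L = N" for L
      proof -
        interpret L: finite_measure L using L fin by auto
        have i: "integrable L (\<lambda>t. f t - g t)"
          using int[OF L f] int[OF L gc] by simp
        have "\<bar>(\<integral>t. f t \<partial>L) - (\<integral>t. g t \<partial>L)\<bar> = \<bar>\<integral>t. f t - g t \<partial>L\<bar>"
          using int[OF L f] int[OF L gc] by simp
        also have "\<dots> \<le> (\<integral>t. \<bar>f t - g t\<bar> \<partial>L)" by (rule integral_abs_bound)
        also have "\<dots> \<le> (\<integral>t. e / C \<partial>L)"
        proof (rule integral_mono_AE)
          have "AE t in L. t \<in> {-1..1}" using L supp by auto
          then show "AE t in L. \<bar>f t - g t\<bar> \<le> e / C" by eventually_elim (use g(2) in force)
        qed (use i in auto)
        finally show ?thesis by simp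
      qed
      have "(\<integral>t. g t \<partial>M) = (\<integral>t. g t \<partial>N)" using moments by (simp add: gp)
      then have "\<bar>(\<integral>t. f t \<partial>M) - (\<integral>t. f t \<partial>N)\<bar> \<le> (measure M (space M) + measure N (space N)) * (e / C)"
        using b[OF disjI1[OF refl]] b[OF disjI2[OF refl]] unfolding ring_distribs by linarith
      also have "\<dots> \<le> C * (e / C)"
        using e C by (intro mult_right_mono) (auto simp: C_def)
      finally show ?thesis using C by simp
    qed
    then show ?thesis by (meson abs_le_zero_iff dense_le_bounded dense_ge eq_iff_diff_eq_0)
  qed
  show ?thesis
  proof (rule measure_eqI_lessThan[OF sets])
    fix x
    show "emeasure M {x<..} < \<infinity>" by (simp add: M.emeasure_finite less_top[symmetric])
    define f where "f n t = min 1 (real n * max 0 (t - x))" for n t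
    have fc: "continuous_on UNIV (f n)" for n
      unfolding f_def by (intro continuous_intros)
    have lim: "(\<lambda>n. \<integral>t. f n t \<partial>L) \<longlonglongrightarrow> measure L {x<..}" if L: "L = M \<or> L = N" for L
    proof -
      interpret L: finite_measure L using L fin by auto
      have [measurable_cong]: "sets L = sets borel" using L sets by auto
      have "(\<lambda>n. \<integral>t. f n t \<partial>L) \<longlonglongrightarrow> (\<integral>t. indicator {x<..} t \<partial>L)"
      proof (rule integral_dominated_convergence[where w="\<lambda>_. 1"])
        show "f n \<in> borel_measurable L" for n
          using borel_measurable_continuous_onI[OF fc] by (simp cong: measurable_cong_sets)
        show "AE t in L. (\<lambda>n. f n t) \<longlonglongrightarrow> indicator {x<..} t"
        proof (rule AE_I2)
          fix t
          show "(\<lambda>n. f n t) \<longlonglongrightarrow> indicator {x<..} t"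
          proof (cases "t > x")
            case True
            then obtain N where N: "1 < real N * (t - x)"
              using reals_Archimedean3[of "t - x"] by auto
            have "f n t = 1" if "n \<ge> N" for n
            proof -
              have "real N * (t - x) \<le> real n * (t - x)" using that True by (intro mult_right_mono) auto
              then have "1 \<le> real n * (t - x)" using N by linarith
              then have "1 \<le> real n * max 0 (t - x)" using True by (simp add: max_def)
              then show ?thesis by (simp add: f_def)
            qed
            then show ?thesis using True by (auto intro!: tendsto_eventually eventually_sequentiallyI)
          qed (simp add: f_def)
        qed
      qed (auto simp: f_def)
      then show ?thesis by simp
    qed
    have "measure M {x<..} = measure N {x<..}"
      using lim[of M] lim[of N] cont[OF fc] LIMSEQ_unique by auto
    then show "emeasure M {x<..} = emeasure N {x<..}"
      by (simp add: M.emeasure_eq_measure N.emeasure_eq_measure)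
  qed
qed

theorem distr_usm_inner:
  fixes e :: "'a::euclidean_space"
  assumes e: "norm e = 1" and d: "DIM('a) \<ge> 3"
  defines "lam \<equiv> gegenbauer_index TYPE('a)"
  shows "distr usm borel (\<lambda>x. e \<bullet> x) =
    density lborel (\<lambda>t. ennreal (indicator {-1..1} t * gegenbauer_weight lam t / wmean lam 1))"
    (is "_ = density lborel (\<lambda>t. ennreal (?w t))")
proof (rule finite_measure_eqI_moments)
  have lam: "lam \<ge> 1 / 2"
    using d by (simp add: lam_def gegenbauer_index_def)
  have pos: "wmean lam 1 > 0" by (rule wmean_pos[OF lam])
  have w0: "?w t \<ge> 0" for t using pos by simp
  have i: "integrable lborel ?w"
    using wpoly_integrable[OF lam, of 1] by (simp add: set_integrable_def)
  show "finite_measure (distr usm borel ((\<bullet>) e))"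
    by (rule usm.finite_measure_distr) simp
  show "finite_measure (density lborel (\<lambda>t. ennreal (?w t)))"
  proof
    have "emeasure (density lborel (\<lambda>t. ennreal (?w t))) UNIV = (\<integral>\<^sup>+t. ennreal (?w t) \<partial>lborel)"
      by (subst emeasure_density) auto
    also have "\<dots> = ennreal (\<integral>t. ?w t \<partial>lborel)"
      using w0 by (intro nn_integral_eq_integral i) auto
    finally show "emeasure (density lborel (\<lambda>t. ennreal (?w t))) (space (density lborel (\<lambda>t. ennreal (?w t)))) \<noteq> \<infinity>"
      by simp
  qed
  show "AE t in distr usm borel ((\<bullet>) e). t \<in> {- 1..1}"
  proof (subst AE_distr_iff)
    show "AE x in usm. e \<bullet> x \<in> {-1..1}" using AE_usm
    proof eventually_elim
      case (elim x)
      then show ?case using Cauchy_Schwarz_ineq2[of e x] e by auto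
    qed
  qed auto
  show "AE t in density lborel (\<lambda>t. ennreal (?w t)). t \<in> {- 1..1}"
    by (subst AE_density) (auto simp: indicator_def)
  fix p :: "real poly"
  have "(\<integral>t. poly p t \<partial>density lborel (\<lambda>t. ennreal (?w t))) = (\<integral>t. ?w t * poly p t \<partial>lborel)"
    using w0 by (subst integral_density) (auto intro!: borel_measurable_continuous_onI continuous_intros)
  also have "\<dots> = wmean lam p / wmean lam 1"
    by (simp add: wmean_def set_lebesgue_integral_def mult_ac)
  also have "\<dots> = zmean e p"
    using zmean_eq_wmean[OF e d, of p] by (simp add: lam_def)
  also have "\<dots> = (\<integral>t. poly p t \<partial>distr usm borel ((\<bullet>) e))"
    unfolding zmean_def by (subst integral_distr) (auto intro!: borel_measurable_continuous_onI continuous_intros)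
  finally show "(\<integral>t. poly p t \<partial>distr usm borel ((\<bullet>) e)) = (\<integral>t. poly p t \<partial>density lborel (\<lambda>t. ennreal (?w t)))"
    by simp
qed simp_all

section \<open>Gegenbauer polynomials\<close>

definition gfps :: "real \<Rightarrow> real \<Rightarrow> real fps" where
  "gfps lam t = fps_compose (fps_binomial (- lam)) (fps_X ^ 2 - fps_const (2 * t) * fps_X)"

lemma gegenbauer_gfps: "gegenbauer lam l t = fps_nth (gfps lam t) l"
  by (simp add: gegenbauer_def gfps_def)

lemma gfps_ode:
  fixes lam t :: real
  defines "u \<equiv> fps_X ^ 2 - fps_const (2 * t) * fps_X"
  shows "(1 + u) * fps_deriv (gfps lam t) = - fps_const lam * fps_deriv u * gfps lam t"
proof -
  have u0: "fps_nth u 0 = 0" by (simp add: u_def)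
  have b: "(1 + fps_X) * fps_deriv (fps_binomial (- lam)) = fps_const (- lam) * fps_binomial (- lam)"
  proof (rule fps_ext)
    fix n
    show "fps_nth ((1 + fps_X) * fps_deriv (fps_binomial (- lam))) n = fps_nth (fps_const (- lam) * fps_binomial (- lam)) n"
      using gbinomial_mult_1[of "- lam" n]
      by (cases n) (simp_all add: distrib_right fps_binomial_nth algebra_simps)
  qed
  have "(1 + u) * fps_deriv (gfps lam t) = (((1 + fps_X) * fps_deriv (fps_binomial (- lam))) oo u) * fps_deriv u"
    using u0 by (simp add: gfps_def u_def[symmetric] fps_compose_deriv fps_compose_mult_distrib fps_compose_add_distrib mult.assoc)
  also have "\<dots> = fps_const (- lam) * (fps_binomial (- lam) oo u) * fps_deriv u"
    unfolding b using u0 by (simp only: fps_compose_mult_distrib fps_const_compose)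
  also have "\<dots> = - fps_const lam * fps_deriv u * gfps lam t"
    by (simp only: gfps_def u_def fps_const_neg[symmetric] mult_ac)
  finally show ?thesis .
qed

lemma gegenbauer_0: "gegenbauer lam 0 t = 1"
  by (simp add: gegenbauer_gfps gfps_def)

lemma gegenbauer_recurrence:
  "real (Suc l) * gegenbauer lam (Suc l) t =
     2 * (real l + lam) * t * gegenbauer lam l t - (if l = 0 then 0 else (real l - 1 + 2 * lam) * gegenbauer lam (l - 1) t)"
proof -
  let ?u = "fps_X ^ 2 - fps_const (2 * t) * fps_X :: real fps" and ?F = "gfps lam t"
  have "fps_nth ((1 + ?u) * fps_deriv ?F) l = fps_nth (- fps_const lam * fps_deriv ?u * ?F) l"
    by (simp add: gfps_ode)
  moreover have "(1 + ?u) * fps_deriv ?F = fps_deriv ?F + fps_X * (fps_X * fps_deriv ?F) - fps_const (2 * t) * (fps_X * fps_deriv ?F)"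
    by (simp add: algebra_simps power2_eq_square)
  moreover have "fps_deriv ?u = 2 * fps_X - fps_const (2 * t)"
    by (simp add: fps_deriv_power)
  then have "- fps_const lam * fps_deriv ?u * ?F = fps_const (2 * lam * t) * ?F - fps_const (2 * lam) * (fps_X * ?F)"
    by (simp add: algebra_simps fps_const_mult[symmetric] fps_const_neg[symmetric] numeral_fps_const
        del: fps_const_mult fps_const_neg)
  ultimately have "fps_nth (fps_deriv ?F + fps_X * (fps_X * fps_deriv ?F) - fps_const (2 * t) * (fps_X * fps_deriv ?F)) l
     = fps_nth (fps_const (2 * lam * t) * ?F - fps_const (2 * lam) * (fps_X * ?F)) l"
    by simp
  then show ?thesis
    by (cases l; cases "l - 1") (auto simp: gegenbauer_gfps algebra_simps of_nat_diff)
qed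

fun geg_poly :: "real \<Rightarrow> nat \<Rightarrow> real poly" where
  "geg_poly lam 0 = 1"
| "geg_poly lam (Suc 0) = monom (2 * lam) 1"
| "geg_poly lam (Suc (Suc l)) = smult (2 * (real l + 1 + lam) / (real l + 2)) (monom 1 1 * geg_poly lam (Suc l))
     - smult ((real l + 2 * lam) / (real l + 2)) (geg_poly lam l)"

lemma poly_geg_poly: "poly (geg_poly lam l) t = gegenbauer lam l t"
proof (induction lam l rule: geg_poly.induct)
  case (1 lam)
  then show ?case by (simp add: gegenbauer_0)
next
  case (2 lam)
  then show ?case using gegenbauer_recurrence[of 0 lam t] by (simp add: gegenbauer_0 poly_monom)
next
  case (3 lam l)
  have "(real l + 2) * gegenbauer lam (Suc (Suc l)) t
      = 2 * (real l + 1 + lam) * t * gegenbauer lam (Suc l) t - (real l + 2 * lam) * gegenbauer lam l t"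
    using gegenbauer_recurrence[of "Suc l" lam t] by (simp add: algebra_simps)
  then have "gegenbauer lam (Suc (Suc l)) t
      = (2 * (real l + 1 + lam) * t * gegenbauer lam (Suc l) t - (real l + 2 * lam) * gegenbauer lam l t) / (real l + 2)"
    by (simp add: eq_divide_eq mult.commute)
  then show ?case
    using 3 by (simp add: poly_monom diff_divide_distrib)
qed

lemma geg_poly_recurrence:
  "smult (real l + 2) (geg_poly lam (l + 2)) = smult (2 * (real l + 1 + lam)) (monom 1 1 * geg_poly lam (l + 1))
     - smult (real l + 2 * lam) (geg_poly lam l)"
  by (simp add: smult_diff_right)

lemma degree_geg_poly: "degree (geg_poly lam l) \<le> l"
proof (induction lam l rule: geg_poly.induct)
  case (3 lam l)
  have "degree (monom 1 1 * geg_poly lam (Suc l)) \<le> 1 + Suc l"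
    by (rule order_trans[OF degree_mult_le]) (use 3 in \<open>simp add: degree_monom_eq\<close>)
  then show ?case using 3
    by (auto intro!: degree_diff_le order_trans[OF degree_smult_le])
qed (auto simp: degree_monom_le)

lemma coeff_geg_poly_pos: "lam > 0 \<Longrightarrow> coeff (geg_poly lam l) l > 0"
proof (induction lam l rule: geg_poly.induct)
  case (3 lam l)
  have "coeff (geg_poly lam l) (Suc (Suc l)) = 0"
    using degree_geg_poly[of lam l] by (intro coeff_eq_0) simp
  moreover have "coeff (monom 1 1 * geg_poly lam (Suc l)) (Suc (Suc l)) = coeff (geg_poly lam (Suc l)) (Suc l)"
    by (simp add: coeff_monom_mult)
  ultimately show ?case using 3 by simp
qed auto

lemma geg_poly_deriv_identities:
  "monom 1 1 * pderiv (geg_poly lam (Suc l)) - pderiv (geg_poly lam l) = smult (real l + 1) (geg_poly lam (Suc l)) \<and>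
   pderiv (geg_poly lam (Suc l)) - monom 1 1 * pderiv (geg_poly lam l) = smult (real l + 2 * lam) (geg_poly lam l)"
proof (induction l)
  case 0
  then show ?case by (auto intro!: real_poly_ext simp: pderiv_monom poly_monom pderiv_1)
next
  case (Suc l)
  have i1: "t * poly (pderiv (geg_poly lam (Suc l))) t - poly (pderiv (geg_poly lam l)) t = (real l + 1) * poly (geg_poly lam (Suc l)) t"
    and i2: "poly (pderiv (geg_poly lam (Suc l))) t - t * poly (pderiv (geg_poly lam l)) t = (real l + 2 * lam) * poly (geg_poly lam l) t" for t
    using arg_cong[OF conjunct1[OF Suc], of "\<lambda>p. poly p t"] arg_cong[OF conjunct2[OF Suc], of "\<lambda>p. poly p t"]
    by (simp_all add: poly_monom)
  have r: "(real l + 2) * poly (geg_poly lam (Suc (Suc l))) t = 2 * (real l + 1 + lam) * t * poly (geg_poly lam (Suc l)) t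
     - (real l + 2 * lam) * poly (geg_poly lam l) t" for t
    using arg_cong[OF geg_poly_recurrence[of l lam], of "\<lambda>p. poly p t"] by (simp add: poly_monom)
  have dr: "(real l + 2) * poly (pderiv (geg_poly lam (Suc (Suc l)))) t =
      2 * (real l + 1 + lam) * (poly (geg_poly lam (Suc l)) t + t * poly (pderiv (geg_poly lam (Suc l))) t)
     - (real l + 2 * lam) * poly (pderiv (geg_poly lam l)) t" for t
    using arg_cong[OF geg_poly_recurrence[of l lam], of "\<lambda>p. poly (pderiv p) t"]
    by (simp add: poly_monom pderiv_smult pderiv_diff pderiv_mult pderiv_monom algebra_simps del: geg_poly.simps)
  have ii: "poly (pderiv (geg_poly lam (Suc (Suc l)))) t - t * poly (pderiv (geg_poly lam (Suc l))) t
      = (real l + 1 + 2 * lam) * poly (geg_poly lam (Suc l)) t" for t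
  proof -
    have "(real l + 2) * (poly (pderiv (geg_poly lam (Suc (Suc l)))) t - t * poly (pderiv (geg_poly lam (Suc l))) t)
      = (real l + 2) * ((real l + 1 + 2 * lam) * poly (geg_poly lam (Suc l)) t)"
      using i1[of t] dr[of t] by algebra
    then show ?thesis by simp
  qed
  have i: "t * poly (pderiv (geg_poly lam (Suc (Suc l)))) t - poly (pderiv (geg_poly lam (Suc l))) t
      = (real l + 2) * poly (geg_poly lam (Suc (Suc l))) t" for t
    using ii[of t] i1[of t] i2[of t] r[of t] by algebra
  show ?case
    using i ii by (auto intro!: real_poly_ext simp: poly_monom add_ac simp del: geg_poly.simps)
qed

lemma geg_poly_deriv_weighted:
  "pderiv (geg_poly lam (Suc l)) * [:1, 0, -1:] =
     smult (real l + 2 * lam) (geg_poly lam l) - smult (real l + 1) (monom 1 1 * geg_poly lam (Suc l))"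
proof (rule real_poly_ext)
  fix t
  have i1: "t * poly (pderiv (geg_poly lam (Suc l))) t - poly (pderiv (geg_poly lam l)) t = (real l + 1) * poly (geg_poly lam (Suc l)) t"
    and i2: "poly (pderiv (geg_poly lam (Suc l))) t - t * poly (pderiv (geg_poly lam l)) t = (real l + 2 * lam) * poly (geg_poly lam l) t"
    using arg_cong[OF conjunct1[OF geg_poly_deriv_identities[of lam l]], of "\<lambda>p. poly p t"]
      arg_cong[OF conjunct2[OF geg_poly_deriv_identities[of lam l]], of "\<lambda>p. poly p t"]
    by (simp_all add: poly_monom)
  have "poly (pderiv (geg_poly lam (Suc l))) t - t * (t * poly (pderiv (geg_poly lam (Suc l))) t) =
    (real l + 2 * lam) * poly (geg_poly lam l) t - (real l + 1) * (t * poly (geg_poly lam (Suc l)) t)"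
    using i1 i2 by algebra
  then show "poly (pderiv (geg_poly lam (Suc l)) * [:1, 0, -1:]) t =
     poly (smult (real l + 2 * lam) (geg_poly lam l) - smult (real l + 1) (monom 1 1 * geg_poly lam (Suc l))) t"
    by (simp add: poly_monom)
qed

lemma wmean_sum: "lam \<ge> 1 / 2 \<Longrightarrow> wmean lam (\<Sum>i\<in>A. q i) = (\<Sum>i\<in>A. wmean lam (q i))"
  by (induction A rule: infinite_finite_induct) (auto simp: wmean_add, auto simp: wmean_def)

lemma wmean_geg_poly:
  assumes lam: "lam \<ge> 1 / 2"
  shows "wmean lam (geg_poly lam (Suc l)) = 0"
proof (induction l rule: less_induct)
  case (less l)
  show ?case
  proof (cases l)
    case 0
    then show ?thesis using wmean_1[OF lam] wmean_smult[of lam "2 * lam" "monom 1 1"] by (simp add: smult_monom)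
  next
    case (Suc k)
    let ?L = "wmean lam" and ?G = "geg_poly lam"
    let ?m = "?L (monom 1 1 * ?G (k + 1))"
    have "?L (pderiv (?G (Suc k)) * [:1, 0, -1:] - smult (2 * lam + 1) (monom 1 1 * ?G (Suc k))) = 0"
      by (rule wmean_ibp[OF lam])
    then have 1: "(real k + 2 * lam + 2) * ?m = (real k + 2 * lam) * ?L (?G k)"
      unfolding geg_poly_deriv_weighted by (simp only: wmean_diff[OF lam] wmean_smult) (simp add: algebra_simps)
    have 2: "(real k + 2) * ?L (?G (k + 2)) = 2 * (real k + 1 + lam) * ?m - (real k + 2 * lam) * ?L (?G k)"
      using arg_cong[OF geg_poly_recurrence[of k lam], of ?L] by (simp only: wmean_diff[OF lam] wmean_smult)
    have "real k * ?L (?G k) = 0" using less[of "k - 1"] Suc by (cases k) auto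
    then have "(real k + 2 * lam + 2) * ((real k + 2) * ?L (?G (k + 2))) = 0"
      using 1 2 by algebra
    then show ?thesis using Suc lam by (simp add: add_nonneg_eq_0_iff)
  qed
qed

lemma wmean_monom_geg_poly:
  assumes lam: "lam \<ge> 1 / 2"
  shows "j < l \<Longrightarrow> wmean lam (monom 1 j * geg_poly lam l) = 0"
proof (induction j arbitrary: l)
  case 0
  then show ?case using wmean_geg_poly[OF lam, of "l - 1"] by (cases l) (auto simp: monom_0 one_pCons[symmetric])
next
  case (Suc j)
  then obtain k where l: "l = k + 1" "j < k + 2" "j < k" by (cases l) auto
  let ?L = "wmean lam" and ?G = "geg_poly lam"
  have "monom 1 j * smult (real k + 2) (?G (k + 2)) = monom 1 j * (smult (2 * (real k + 1 + lam)) (monom 1 1 * ?G (k + 1))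
     - smult (real k + 2 * lam) (?G k))"
    by (simp only: geg_poly_recurrence)
  then have "smult (real k + 2) (monom 1 j * ?G (k + 2)) = smult (2 * (real k + 1 + lam)) (monom 1 (Suc j) * ?G (k + 1))
     - smult (real k + 2 * lam) (monom 1 j * ?G k)"
    by (simp only: right_diff_distrib mult_smult_right mult.assoc[symmetric] mult_monom) simp
  from arg_cong[OF this, of ?L] have "2 * (real k + 1 + lam) * ?L (monom 1 (Suc j) * ?G (k + 1)) = 0"
    using Suc.IH[OF l(2)] Suc.IH[OF l(3)] by (simp only: wmean_diff[OF lam] wmean_smult)
  then show ?case using lam by (simp add: l)
qed

lemma wmean_geg_poly_orthogonal:
  assumes lam: "lam \<ge> 1 / 2" and p: "degree p < l"
  shows "wmean lam (p * geg_poly lam l) = 0"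
proof -
  have "p = (\<Sum>i\<le>degree p. smult (coeff p i) (monom 1 i))"
    by (simp add: smult_monom poly_as_sum_of_monoms)
  then have "p * geg_poly lam l = (\<Sum>i\<le>degree p. smult (coeff p i) (monom 1 i * geg_poly lam l))"
    by (metis (no_types, lifting) sum_distrib_right mult_smult_left sum.cong)
  then have "wmean lam (p * geg_poly lam l) = (\<Sum>i\<le>degree p. coeff p i * wmean lam (monom 1 i * geg_poly lam l))"
    by (simp add: wmean_sum[OF lam] wmean_smult)
  also have "\<dots> = 0"
    using p by (intro sum.neutral) (auto simp: wmean_monom_geg_poly[OF lam])
  finally show ?thesis .
qed

lemma wmean_geg_poly_orthogonal':
  assumes lam: "lam \<ge> 1 / 2" and "j \<noteq> l"
  shows "wmean lam (geg_poly lam j * geg_poly lam l) = 0"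
proof (cases "j < l")
  case True
  then show ?thesis using degree_geg_poly[of lam j] by (intro wmean_geg_poly_orthogonal[OF lam]) auto
next
  case False
  then show ?thesis using degree_geg_poly[of lam l] assms(2)
    by (subst mult.commute, intro wmean_geg_poly_orthogonal[OF lam]) auto
qed

lemma geg_poly_at_1: "(real l + 1) * poly (geg_poly lam (Suc l)) 1 = (real l + 2 * lam) * poly (geg_poly lam l) 1"
proof (induction l)
  case (Suc l)
  have "(real l + 2) * poly (geg_poly lam (Suc (Suc l))) 1 = 2 * (real l + 1 + lam) * poly (geg_poly lam (Suc l)) 1
     - (real l + 2 * lam) * poly (geg_poly lam l) 1"
    using arg_cong[OF geg_poly_recurrence[of l lam], of "\<lambda>p. poly p 1"] by (simp add: poly_monom)
  then show ?case using Suc by (simp add: algebra_simps del: geg_poly.simps)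
qed (simp add: poly_monom)

lemma geg_poly_at_1_ge_1:
  assumes lam: "lam \<ge> 1 / 2"
  shows "poly (geg_poly lam l) 1 \<ge> 1"
proof (induction l)
  case (Suc l)
  have "(real l + 1) * 1 \<le> (real l + 2 * lam) * poly (geg_poly lam l) 1"
    using lam Suc by (intro mult_mono) auto
  then have "(real l + 1) * 1 \<le> (real l + 1) * poly (geg_poly lam (Suc l)) 1"
    unfolding geg_poly_at_1 .
  then show ?case by (subst (asm) mult_le_cancel_left_pos) auto
qed simp

lemma wmean_geg_poly_square:
  assumes lam: "lam \<ge> 1 / 2"
  shows "(real l + lam) * wmean lam (geg_poly lam l * geg_poly lam l) = lam * poly (geg_poly lam l) 1 * wmean lam 1"
proof (induction l)
  case (Suc l)
  let ?L = "wmean lam" and ?G = "geg_poly lam"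
  let ?m = "?L (monom 1 1 * ?G l * ?G (Suc l))"
  have 1: "(real l + 1) * ?L (?G (Suc l) * ?G (Suc l)) = 2 * (real l + lam) * ?m"
  proof (cases l)
    case 0
    have "geg_poly lam (Suc l) = smult (2 * lam) (monom 1 1)" by (simp add: 0 smult_monom)
    then show ?thesis using 0 by (simp add: wmean_smult mult.assoc)
  next
    case (Suc k)
    have "smult (real k + 2) (?G (k + 2)) * ?G (k + 2) = smult (2 * (real k + 1 + lam)) (monom 1 1 * ?G (k + 1) * ?G (k + 2))
      - smult (real k + 2 * lam) (?G k * ?G (k + 2))"
      unfolding geg_poly_recurrence by (simp only: left_diff_distrib mult_smult_left)
    from arg_cong[OF this, of ?L] show ?thesis
      using wmean_geg_poly_orthogonal'[OF lam, of k "k + 2"]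
      by (simp add: Suc wmean_diff[OF lam] wmean_smult add_ac del: geg_poly.simps)
  qed
  have 2: "2 * (real l + 1 + lam) * ?m = (real l + 2 * lam) * ?L (?G l * ?G l)"
  proof -
    have "smult (real l + 2) (?G (l + 2)) * ?G l = smult (2 * (real l + 1 + lam)) (monom 1 1 * ?G l * ?G (l + 1))
      - smult (real l + 2 * lam) (?G l * ?G l)"
      unfolding geg_poly_recurrence
      by (simp only: left_diff_distrib right_diff_distrib mult_smult_left mult_smult_right mult_ac)
    from arg_cong[OF this, of ?L] show ?thesis
      using wmean_geg_poly_orthogonal'[OF lam, of "l + 2" l]
      by (simp add: wmean_diff[OF lam] wmean_smult del: geg_poly.simps)
  qed
  have "(real l + 1) * ((real (Suc l) + lam) * ?L (?G (Suc l) * ?G (Suc l))) = (real l + 1 + lam) * (2 * (real l + lam) * ?m)"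
    using 1 by (simp add: algebra_simps del: geg_poly.simps)
  also have "\<dots> = (real l + lam) * ((real l + 2 * lam) * ?L (?G l * ?G l))"
    using 2 by (simp add: algebra_simps del: geg_poly.simps)
  also have "\<dots> = (real l + 2 * lam) * (lam * poly (?G l) 1 * ?L 1)"
    using Suc by (simp add: algebra_simps del: geg_poly.simps)
  also have "\<dots> = lam * ?L 1 * ((real l + 1) * poly (?G (Suc l)) 1)"
    unfolding geg_poly_at_1 by (simp add: algebra_simps)
  finally have "(real l + 1) * ((real (Suc l) + lam) * ?L (?G (Suc l) * ?G (Suc l)))
    = (real l + 1) * (lam * poly (?G (Suc l)) 1 * ?L 1)"
    by (simp only: mult_ac)
  then show ?case by (subst (asm) mult_left_cancel) auto
qed simp

lemma wmean_geg_poly_square_pos: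
  assumes lam: "lam \<ge> 1 / 2"
  shows "wmean lam (geg_poly lam l * geg_poly lam l) > 0"
proof -
  have "lam * poly (geg_poly lam l) 1 * wmean lam 1 > 0"
    using lam geg_poly_at_1_ge_1[OF lam, of l] wmean_pos[OF lam] by (intro mult_pos_pos) auto
  then have "(real l + lam) * wmean lam (geg_poly lam l * geg_poly lam l) > 0"
    using wmean_geg_poly_square[OF lam] by simp
  then show ?thesis using lam by (subst (asm) zero_less_mult_iff) auto
qed

lemma geg_poly_expansion:
  assumes lam: "lam \<ge> 1 / 2" and p: "degree p \<le> N"
  shows "p = (\<Sum>l\<le>N. smult (wmean lam (p * geg_poly lam l) / wmean lam (geg_poly lam l * geg_poly lam l)) (geg_poly lam l))"
proof -
  have "\<exists>a. p = (\<Sum>l\<le>N. smult (a l) (geg_poly lam l))"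
    using p
  proof (induction N arbitrary: p)
    case 0
    then have "degree p = 0" by simp
    then obtain c where "p = [:c:]" by (rule degree_eq_zeroE)
    then show ?case by (intro exI[of _ "\<lambda>_. c"]) simp
  next
    case (Suc N)
    define c where "c = coeff p (Suc N) / coeff (geg_poly lam (Suc N)) (Suc N)"
    have pos: "coeff (geg_poly lam (Suc N)) (Suc N) > 0"
      using lam by (intro coeff_geg_poly_pos) auto
    define q where "q = p - smult c (geg_poly lam (Suc N))"
    have "coeff q i = 0" if "i > N" for i
    proof (cases "i = Suc N")
      case True
      then show ?thesis using pos by (simp add: q_def c_def del: geg_poly.simps)
    next
      case False
      then have "i > Suc N" using that by simp
      then show ?thesis
        using Suc.prems degree_geg_poly[of lam "Suc N"] by (simp add: q_def coeff_eq_0 del: geg_poly.simps)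
    qed
    then have "degree q \<le> N" by (intro degree_le) auto
    then obtain a where "q = (\<Sum>l\<le>N. smult (a l) (geg_poly lam l))" using Suc.IH by blast
    then have "p = (\<Sum>l\<le>N. smult (a l) (geg_poly lam l)) + smult c (geg_poly lam (Suc N))"
      by (simp add: q_def algebra_simps)
    also have "\<dots> = (\<Sum>l\<le>Suc N. smult ((a(Suc N := c)) l) (geg_poly lam l))"
      by (simp del: geg_poly.simps)
    finally show ?case by blast
  qed
  then obtain a where a: "p = (\<Sum>l\<le>N. smult (a l) (geg_poly lam l))" by blast
  have "wmean lam (p * geg_poly lam l) / wmean lam (geg_poly lam l * geg_poly lam l) = a l" if "l \<le> N" for l
  proof -
    have "wmean lam (p * geg_poly lam l) = (\<Sum>j\<le>N. a j * wmean lam (geg_poly lam j * geg_poly lam l))"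
      by (simp add: a sum_distrib_right wmean_sum[OF lam] wmean_smult)
    also have "\<dots> = (\<Sum>j\<le>N. if j = l then a l * wmean lam (geg_poly lam l * geg_poly lam l) else 0)"
      by (intro sum.cong) (auto simp: wmean_geg_poly_orthogonal'[OF lam])
    also have "\<dots> = a l * wmean lam (geg_poly lam l * geg_poly lam l)" using that by simp
    finally show ?thesis using wmean_geg_poly_square_pos[OF lam, of l] by simp
  qed
  then show ?thesis using a by simp
qed

section \<open>The Funk--Hecke formula\<close>

lemma integrable_usm_bounded_scaleR:
  fixes f :: "'a::euclidean_space \<Rightarrow> real" and g :: "'a \<Rightarrow> 'b::{banach, second_countable_topology}"
  assumes [measurable]: "f \<in> borel_measurable borel"
    and B: "\<And>x. norm x = 1 \<Longrightarrow> \<bar>f x\<bar> \<le> B" and g: "integrable usm g"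
  shows "integrable usm (\<lambda>x. f x *\<^sub>R g x)"
proof (rule Bochner_Integration.integrable_bound[where f="\<lambda>x. B *\<^sub>R g x"])
  show "(\<lambda>x. f x *\<^sub>R g x) \<in> borel_measurable usm"
    using borel_measurable_integrable[OF g] by measurable
  show "AE x in usm. norm (f x *\<^sub>R g x) \<le> norm (B *\<^sub>R g x)"
    using AE_usm
  proof eventually_elim
    case (elim x)
    then show ?case using B[OF elim] by (auto intro!: mult_right_mono)
  qed
qed (use g in simp)

lemma poly_measurable [measurable]: "poly (p :: real poly) \<in> borel_measurable borel"
  by (intro borel_measurable_continuous_onI continuous_intros)

lemma integrable_usm_continuous_scaleR:
  fixes f :: "'a::euclidean_space \<Rightarrow> real" and g :: "'a \<Rightarrow> 'b::{banach, second_countable_topology}"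
  assumes c: "continuous_on UNIV f" and g: "integrable usm g"
  shows "integrable usm (\<lambda>x. f x *\<^sub>R g x)"
proof -
  have "compact (f ` sphere 0 1)"
    by (intro compact_continuous_image continuous_on_subset[OF c]) auto
  then obtain B where "\<forall>y\<in>f ` sphere 0 1. norm y \<le> B"
    using compact_imp_bounded bounded_iff by blast
  then show ?thesis
    using c g by (intro integrable_usm_bounded_scaleR[where B=B] borel_measurable_continuous_onI) auto
qed

lemma integral_kernel_norm:
  fixes k :: "real \<Rightarrow> real" and e y :: "'a::euclidean_space"
  assumes "norm e = norm y" and [measurable]: "k \<in> borel_measurable borel"
  shows "integrable usm (\<lambda>x. k (x \<bullet> y)) \<longleftrightarrow> integrable usm (\<lambda>x. k (e \<bullet> x))"
    and "(\<integral>x. k (x \<bullet> y) \<partial>usm) = (\<integral>x. k (e \<bullet> x) \<partial>usm)"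
proof -
  have "(\<lambda>x. k (x \<bullet> y)) = (\<lambda>x. k (e \<bullet> reflection (e - y) x))"
    by (simp only: reflection_inner[symmetric] reflection_swaps[OF assms(1)] inner_commute)
  then show "integrable usm (\<lambda>x. k (x \<bullet> y)) \<longleftrightarrow> integrable usm (\<lambda>x. k (e \<bullet> x))"
    using integrable_usm_rot[OF reflection_orthogonal, of "\<lambda>x. k (e \<bullet> x)" "e - y"] by simp
  show "(\<integral>x. k (x \<bullet> y) \<partial>usm) = (\<integral>x. k (e \<bullet> x) \<partial>usm)"
    using integral_usm_zonal_cong[OF assms(1), of k] by (simp add: inner_commute)
qed

lemma integrable_kernel:
  fixes F :: "'a::euclidean_space \<times> 'a \<Rightarrow> 'b::{banach, second_countable_topology}"
    and k :: "real \<Rightarrow> real" and g :: "'a \<Rightarrow> real" and e :: 'a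
  assumes F: "F \<in> borel_measurable (borel \<Otimes>\<^sub>M borel)"
    and b: "\<And>x y. norm x = 1 \<Longrightarrow> norm y = 1 \<Longrightarrow> norm (F (y, x)) \<le> k (x \<bullet> y) * g y"
    and [measurable]: "k \<in> borel_measurable borel" and k: "integrable usm (\<lambda>x. k (e \<bullet> x))" and e: "norm e = 1"
    and g: "integrable usm g"
  shows "integrable (usm \<Otimes>\<^sub>M usm) F" and "integrable (usm \<Otimes>\<^sub>M usm) (\<lambda>(x, y). F (y, x))"
proof -
  have Fm [measurable]: "F \<in> borel_measurable (usm \<Otimes>\<^sub>M usm)"
    using F by (simp cong: measurable_cong_sets sets_pair_measure_cong)
  have i: "integrable usm (\<lambda>x. F (y, x))" and
    le: "(\<integral>x. norm (F (y, x)) \<partial>usm) \<le> (\<integral>x. k (e \<bullet> x) \<partial>usm) * g y" if y: "norm y = 1" for y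
  proof -
    have kk: "integrable usm (\<lambda>x. k (x \<bullet> y) * g y)"
      using k integral_kernel_norm(1)[of e y k] e y by simp
    have ae: "AE x in usm. norm (F (y, x)) \<le> norm (k (x \<bullet> y) * g y)"
      using AE_usm by eventually_elim (use b y in force)
    show i: "integrable usm (\<lambda>x. F (y, x))"
      by (rule Bochner_Integration.integrable_bound[OF kk _ ae]) measurable
    have "(\<integral>x. norm (F (y, x)) \<partial>usm) \<le> (\<integral>x. k (x \<bullet> y) * g y \<partial>usm)"
    proof (rule integral_mono_AE)
      show "AE x in usm. norm (F (y, x)) \<le> k (x \<bullet> y) * g y"
        using AE_usm by eventually_elim (use b y in force)
    qed (use i kk in auto)
    also have "\<dots> = (\<integral>x. k (e \<bullet> x) \<partial>usm) * g y"
      using integral_kernel_norm(2)[of e y k] e y by simp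
    finally show "(\<integral>x. norm (F (y, x)) \<partial>usm) \<le> (\<integral>x. k (e \<bullet> x) \<partial>usm) * g y" .
  qed
  show "integrable (usm \<Otimes>\<^sub>M usm) F"
  proof (rule usm2.Fubini_integrable)
    show "AE y in usm. integrable usm (\<lambda>x. F (y, x))"
      using AE_usm by eventually_elim (rule i)
    show "integrable usm (\<lambda>y. \<integral>x. norm (F (y, x)) \<partial>usm)"
    proof (rule Bochner_Integration.integrable_bound)
      show "integrable usm (\<lambda>y. (\<integral>x. k (e \<bullet> x) \<partial>usm) * g y)" using g by simp
      show "AE y in usm. norm (\<integral>x. norm (F (y, x)) \<partial>usm) \<le> norm ((\<integral>x. k (e \<bullet> x) \<partial>usm) * g y)"
        using AE_usm
      proof eventually_elim
        case (elim y)
        have "norm (\<integral>x. norm (F (y, x)) \<partial>usm) = (\<integral>x. norm (F (y, x)) \<partial>usm)" by simp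
        then show ?case using le[OF elim] by simp
      qed
    qed measurable
  qed measurable
  then show "integrable (usm \<Otimes>\<^sub>M usm) (\<lambda>(x, y). F (y, x))"
    by (rule usm2.integrable_product_swap)
qed

lemma poly_bounded_interval:
  obtains B where "B \<ge> 0" "\<And>t. t \<in> {-1..1} \<Longrightarrow> \<bar>poly (p :: real poly) t\<bar> \<le> B"
proof -
  have "compact (poly p ` {-1..1})"
    by (intro compact_continuous_image continuous_intros) auto
  then obtain B where B: "\<forall>y\<in>poly p ` {-1..1}. norm y \<le> B"
    using compact_imp_bounded bounded_iff by blast
  show thesis
    by (rule that[of "max B 0"]) (use B in \<open>auto intro: order_trans[OF _ max.cobounded1]\<close>)
qed

lemma inner_unit: "norm x = 1 \<Longrightarrow> norm y = 1 \<Longrightarrow> (x :: 'a::euclidean_space) \<bullet> y \<in> {-1..1}"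
  using Cauchy_Schwarz_ineq2[of x y] by auto

lemma obtain_orthogonal_unit:
  fixes e :: "'a::euclidean_space"
  assumes "DIM('a) \<ge> 2"
  obtains u :: 'a where "norm u = 1" "e \<bullet> u = 0"
proof -
  obtain u' :: 'a where u': "u' \<noteq> 0" "orthogonal e u'"
    using orthogonal_to_vector_exists[of e] assms by auto
  show thesis
    by (rule that[of "u' /\<^sub>R norm u'"]) (use u' in \<open>simp_all add: orthogonal_def\<close>)
qed

lemma unit_vector_with_inner:
  fixes e u :: "'a::euclidean_space"
  assumes "norm e = 1" "norm u = 1" "e \<bullet> u = 0" "t \<in> {-1..1}"
  shows "norm (t *\<^sub>R e + sqrt (1 - t\<^sup>2) *\<^sub>R u) = 1" and "e \<bullet> (t *\<^sub>R e + sqrt (1 - t\<^sup>2) *\<^sub>R u) = t"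
proof -
  have "t\<^sup>2 \<le> 1" using assms(4) by (auto simp: abs_square_le_1)
  then show "norm (t *\<^sub>R e + sqrt (1 - t\<^sup>2) *\<^sub>R u) = 1"
    using assms by (simp add: norm_eq_1 inner_add_left inner_add_right inner_commute power2_eq_square)
  show "e \<bullet> (t *\<^sub>R e + sqrt (1 - t\<^sup>2) *\<^sub>R u) = t"
    using assms by (simp add: norm_eq_1 inner_add_right)
qed

lemma zonal_poly_conv_monom:
  fixes h :: "real \<Rightarrow> real" and e :: "'a::euclidean_space"
  assumes d: "DIM('a) \<ge> 2" and e: "norm e = 1"
    and [measurable]: "h \<in> borel_measurable borel" and h: "integrable usm (\<lambda>y. h (e \<bullet> y))"
  shows "\<exists>q. degree q \<le> N \<and> (\<forall>x. norm x = 1 \<longrightarrow> (\<integral>y. (x \<bullet> y) ^ N * h (e \<bullet> y) \<partial>usm) = poly q (x \<bullet> e))"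
proof -
  obtain u :: 'a where u: "norm u = 1" "e \<bullet> u = 0" using obtain_orthogonal_unit[OF d] by blast
  define I where "I j = (\<integral>y. (u \<bullet> y) ^ j * ((e \<bullet> y) ^ (N - j) * h (e \<bullet> y)) \<partial>usm)" for j
  have i: "integrable usm (\<lambda>y. (v \<bullet> y) ^ j * ((e \<bullet> y) ^ i * h (e \<bullet> y)))" for v :: 'a and i j
    using integrable_usm_continuous_scaleR[OF _ h, of "\<lambda>y. (v \<bullet> y) ^ j * (e \<bullet> y) ^ i"]
    by (simp add: mult.assoc continuous_intros)
  have v: "(\<integral>y. (v \<bullet> y) ^ j * ((e \<bullet> y) ^ (N - j) * h (e \<bullet> y)) \<partial>usm) = norm v ^ j * I j"
    if "v \<bullet> e = 0" for v j
  proof -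
    let ?u = "norm v *\<^sub>R u"
    have n: "norm v = norm ?u" using u by simp
    let ?T = "reflection (v - ?u)"
    have T: "v \<bullet> ?T y = ?u \<bullet> y" "e \<bullet> ?T y = e \<bullet> y" for y
    proof -
      have "e \<bullet> (v - ?u) = 0" using that u by (simp add: inner_diff_right inner_commute)
      then have "?T e = e" by (rule reflection_fixes)
      then show "v \<bullet> ?T y = ?u \<bullet> y" "e \<bullet> ?T y = e \<bullet> y"
        using reflection_swaps(1)[OF n] reflection_inner[of "v - ?u" v y] reflection_inner[of "v - ?u" e y]
        by simp_all
    qed
    have "(\<integral>y. (v \<bullet> y) ^ j * ((e \<bullet> y) ^ (N - j) * h (e \<bullet> y)) \<partial>usm) =
        (\<integral>y. (v \<bullet> ?T y) ^ j * ((e \<bullet> ?T y) ^ (N - j) * h (e \<bullet> ?T y)) \<partial>usm)"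
      by (rule integral_usm_rot[OF reflection_orthogonal, symmetric]) measurable
    also have "\<dots> = norm v ^ j * I j"
      by (simp add: T I_def power_mult_distrib mult.assoc)
    finally show ?thesis .
  qed
  have odd: "I j = 0" if "odd j" for j
    using v[of "- u" j] v[of u j] that u by (simp add: I_def inner_commute)
  define q where "q = (\<Sum>j\<le>N. smult (real (N choose j) * I j) (monom 1 (N - j) * [:1, 0, -1:] ^ (j div 2)))"
  have "degree q \<le> N"
    unfolding q_def
  proof (rule degree_sum_le)
    fix j assume j: "j \<in> {..N}"
    show "degree (smult (real (N choose j) * I j) (monom 1 (N - j) * [:1, 0, -1:] ^ (j div 2))) \<le> N"
    proof (cases "odd j")
      case False
      have "degree (monom (1::real) (N - j) * [:1, 0, -1:] ^ (j div 2)) \<le> (N - j) + 2 * (j div 2)"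
        by (rule order_trans[OF degree_mult_le] add_mono degree_monom_le order_trans[OF degree_power_le])+ simp
      then show ?thesis using j by (intro order_trans[OF degree_smult_le]) auto
    qed (simp add: odd)
  qed auto
  moreover have "(\<integral>y. (x \<bullet> y) ^ N * h (e \<bullet> y) \<partial>usm) = poly q (x \<bullet> e)" if x: "norm x = 1" for x
  proof -
    define s where "s = x \<bullet> e"
    define v' where "v' = x - s *\<^sub>R e"
    have ve: "v' \<bullet> e = 0"
      using e by (simp add: v'_def inner_diff_left s_def norm_eq_1)
    have nv: "(norm v')\<^sup>2 = 1 - s\<^sup>2"
      unfolding power2_norm_eq_inner using e x
      by (simp add: v'_def inner_diff_left inner_diff_right s_def norm_eq_1 inner_commute power2_eq_square)
    have xy: "x \<bullet> y = v' \<bullet> y + s * (e \<bullet> y)" for y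
      by (simp add: v'_def inner_diff_left)
    have "(\<integral>y. (x \<bullet> y) ^ N * h (e \<bullet> y) \<partial>usm) =
      (\<integral>y. (\<Sum>j\<le>N. (real (N choose j) * s ^ (N - j)) * ((v' \<bullet> y) ^ j * ((e \<bullet> y) ^ (N - j) * h (e \<bullet> y)))) \<partial>usm)"
      unfolding xy binomial_ring by (simp add: sum_distrib_right sum_distrib_left power_mult_distrib mult_ac)
    also have "\<dots> = (\<Sum>j\<le>N. (real (N choose j) * s ^ (N - j)) * (norm v' ^ j * I j))"
      by (subst Bochner_Integration.integral_sum) (auto simp: i v[OF ve])
    also have "\<dots> = poly q s"
      unfolding q_def poly_sum
    proof (rule sum.cong)
      fix j
      show "(real (N choose j) * s ^ (N - j)) * (norm v' ^ j * I j) =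
        poly (smult (real (N choose j) * I j) (monom 1 (N - j) * [:1, 0, - 1:] ^ (j div 2))) s"
      proof (cases "odd j")
        case False
        then have "norm v' ^ j = (1 - s * s) ^ (j div 2)"
          using nv by (metis dvd_mult_div_cancel power_mult power2_eq_square)
        then show ?thesis by (simp add: poly_monom poly_power mult_ac)
      qed (simp add: odd)
    qed simp
    finally show ?thesis by (simp add: s_def)
  qed
  ultimately show ?thesis by blast
qed

lemma zonal_poly_conv:
  fixes h :: "real \<Rightarrow> real" and e :: "'a::euclidean_space"
  assumes d: "DIM('a) \<ge> 2" and e: "norm e = 1"
    and [measurable]: "h \<in> borel_measurable borel" and h: "integrable usm (\<lambda>y. h (e \<bullet> y))"
  shows "\<exists>q. degree q \<le> degree p \<and> (\<forall>x. norm x = 1 \<longrightarrow> (\<integral>y. poly p (x \<bullet> y) * h (e \<bullet> y) \<partial>usm) = poly q (x \<bullet> e))"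
proof -
  obtain q where q: "\<And>N. degree (q N) \<le> N"
    "\<And>N x. norm x = 1 \<Longrightarrow> (\<integral>y. (x \<bullet> y) ^ N * h (e \<bullet> y) \<partial>usm) = poly (q N) (x \<bullet> e)"
    using zonal_poly_conv_monom[OF d e assms(3,4)] by metis
  have i: "integrable usm (\<lambda>y. (x \<bullet> y) ^ N * h (e \<bullet> y))" for x N
    using integrable_usm_continuous_scaleR[OF _ h, of "\<lambda>y. (x \<bullet> y) ^ N"] by (simp add: continuous_intros)
  define Q where "Q = (\<Sum>j\<le>degree p. smult (coeff p j) (q j))"
  have "degree Q \<le> degree p"
    unfolding Q_def using q(1)
    by (intro degree_sum_le order_trans[OF degree_smult_le]) (auto intro: order_trans)
  moreover have "(\<integral>y. poly p (x \<bullet> y) * h (e \<bullet> y) \<partial>usm) = poly Q (x \<bullet> e)" if "norm x = 1" for x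
  proof -
    have "(\<integral>y. poly p (x \<bullet> y) * h (e \<bullet> y) \<partial>usm) =
      (\<integral>y. (\<Sum>j\<le>degree p. coeff p j * ((x \<bullet> y) ^ j * h (e \<bullet> y))) \<partial>usm)"
      by (simp add: poly_altdef sum_distrib_right sum_distrib_left mult_ac)
    also have "\<dots> = poly Q (x \<bullet> e)"
      by (subst Bochner_Integration.integral_sum) (auto simp: i Q_def poly_sum q(2)[OF that])
    finally show ?thesis .
  qed
  ultimately show ?thesis by blast
qed

lemma zonal_conv_symmetric:
  fixes h :: "real \<Rightarrow> real" and e :: "'a::euclidean_space"
  assumes e: "norm e = 1"
    and [measurable]: "h \<in> borel_measurable borel" and h: "integrable usm (\<lambda>y. h (e \<bullet> y))"
  shows "(\<integral>x. (\<integral>y. poly p (x \<bullet> y) * h (e \<bullet> y) \<partial>usm) * poly q (x \<bullet> e) \<partial>usm)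
       = (\<integral>x. (\<integral>y. poly q (x \<bullet> y) * h (e \<bullet> y) \<partial>usm) * poly p (x \<bullet> e) \<partial>usm)"
proof -
  have *: "(\<integral>x. (\<integral>y. poly p (x \<bullet> y) * h (e \<bullet> y) \<partial>usm) * poly q (x \<bullet> e) \<partial>usm)
      = (\<integral>y. h (e \<bullet> y) * (\<integral>x. poly p (y \<bullet> x) * poly q (x \<bullet> e) \<partial>usm) \<partial>usm)" for p q
  proof -
    obtain B where B: "B \<ge> 0" "\<And>t. t \<in> {-1..1} \<Longrightarrow> \<bar>poly p t\<bar> \<le> B" using poly_bounded_interval by blast
    obtain C where C: "C \<ge> 0" "\<And>t. t \<in> {-1..1} \<Longrightarrow> \<bar>poly q t\<bar> \<le> C" using poly_bounded_interval by blast
    have "integrable (usm \<Otimes>\<^sub>M usm) (\<lambda>(x, y). (\<lambda>(y, x). poly p (x \<bullet> y) * h (e \<bullet> y) * poly q (x \<bullet> e)) (y, x))"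
    proof (rule integrable_kernel(2)[where k="\<lambda>_. B * C" and g="\<lambda>y. \<bar>h (e \<bullet> y)\<bar>" and e=e])
      fix x y :: 'a assume xy: "norm x = 1" "norm y = 1"
      have "\<bar>poly p (x \<bullet> y)\<bar> * \<bar>poly q (x \<bullet> e)\<bar> * \<bar>h (e \<bullet> y)\<bar> \<le> B * C * \<bar>h (e \<bullet> y)\<bar>"
        using B C inner_unit xy e by (intro mult_right_mono mult_mono) auto
      then show "norm (case (y, x) of (y, x) \<Rightarrow> poly p (x \<bullet> y) * h (e \<bullet> y) * poly q (x \<bullet> e)) \<le> B * C * \<bar>h (e \<bullet> y)\<bar>"
        by (simp add: abs_mult mult_ac)
    qed (use h e in auto)
    then have "integrable (usm \<Otimes>\<^sub>M usm) (\<lambda>(x, y). poly p (x \<bullet> y) * h (e \<bullet> y) * poly q (x \<bullet> e))"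
      by simp
    from usm2.Fubini_integral[OF this]
    have "(\<integral>x. (\<integral>y. poly p (x \<bullet> y) * h (e \<bullet> y) * poly q (x \<bullet> e) \<partial>usm) \<partial>usm)
      = (\<integral>y. (\<integral>x. h (e \<bullet> y) * (poly p (y \<bullet> x) * poly q (x \<bullet> e)) \<partial>usm) \<partial>usm)"
      by (simp add: mult_ac inner_commute)
    then show ?thesis
      by (simp only: integral_mult_right_zero integral_mult_left_zero)
  qed
  have "(\<integral>y. h (e \<bullet> y) * (\<integral>x. poly p (y \<bullet> x) * poly q (x \<bullet> e) \<partial>usm) \<partial>usm)
      = (\<integral>y. h (e \<bullet> y) * (\<integral>x. poly q (y \<bullet> x) * poly p (x \<bullet> e) \<partial>usm) \<partial>usm)"
  proof (rule integral_cong_AE)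
    show "AE y in usm. h (e \<bullet> y) * (\<integral>x. poly p (y \<bullet> x) * poly q (x \<bullet> e) \<partial>usm)
        = h (e \<bullet> y) * (\<integral>x. poly q (y \<bullet> x) * poly p (x \<bullet> e) \<partial>usm)"
      using AE_usm
    proof eventually_elim
      case (elim y)
      then show ?case
        using zonal_conv_commute[of y e "\<lambda>s t. poly p s * poly q t"] e
        by (simp add: inner_commute mult.commute)
    qed
  qed measurable
  then show ?thesis by (simp only: *)
qed

lemma gegenbauer_index_ge: "DIM('a::euclidean_space) \<ge> 3 \<Longrightarrow> gegenbauer_index TYPE('a) \<ge> 1 / 2"
  by (simp add: gegenbauer_index_def)

abbreviation sgeg :: "'a::euclidean_space itself \<Rightarrow> nat \<Rightarrow> real poly" where
  "sgeg T \<equiv> geg_poly (gegenbauer_index T)"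

definition zmult :: "'a::euclidean_space \<Rightarrow> (real \<Rightarrow> 'b::{banach, second_countable_topology}) \<Rightarrow> nat \<Rightarrow> 'b" where
  "zmult e h l = (\<integral>y. poly (sgeg TYPE('a) l) (e \<bullet> y) *\<^sub>R h (e \<bullet> y) \<partial>usm) /\<^sub>R poly (sgeg TYPE('a) l) 1"

text \<open>
  Convolution with \<open>h\<close> maps a zonal polynomial to one of no larger degree and is symmetric, so the image
  of the \<open>l\<close>-th Gegenbauer polynomial is orthogonal to all lower ones and hence a multiple of it.
\<close>

lemma funk_hecke_real:
  fixes h :: "real \<Rightarrow> real" and e :: "'a::euclidean_space"
  assumes d: "DIM('a) \<ge> 3" and e: "norm e = 1" and x: "norm x = 1"
    and h': "h \<in> borel_measurable borel" and h: "integrable usm (\<lambda>y. h (e \<bullet> y))"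
  shows "(\<integral>y. poly (sgeg TYPE('a) l) (x \<bullet> y) * h (e \<bullet> y) \<partial>usm) = poly (sgeg TYPE('a) l) (x \<bullet> e) * zmult e h l"
proof -
  define lam where "lam = gegenbauer_index TYPE('a)"
  have lam: "lam \<ge> 1 / 2" using gegenbauer_index_ge[OF d] by (simp add: lam_def)
  let ?G = "geg_poly lam"
  have d2: "DIM('a) \<ge> 2" using d by simp
  obtain q where qd: "\<And>p. degree (q p) \<le> degree p"
    and q: "\<And>p x. norm x = 1 \<Longrightarrow> (\<integral>y. poly p (x \<bullet> y) * h (e \<bullet> y) \<partial>usm) = poly (q p) (x \<bullet> e)"
    using zonal_poly_conv[OF d2 e h' h] by metis
  have z: "zmean e p = wmean lam p / wmean lam 1" for p
    using zmean_eq_wmean[OF e d] by (simp add: lam_def)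
  have zq: "zmean e (q p * r) = (\<integral>x. (\<integral>y. poly p (x \<bullet> y) * h (e \<bullet> y) \<partial>usm) * poly r (x \<bullet> e) \<partial>usm)" for p r
    unfolding zmean_def
  proof (rule integral_cong_AE)
    show "AE x in usm. poly (q p * r) (e \<bullet> x) = (\<integral>y. poly p (x \<bullet> y) * h (e \<bullet> y) \<partial>usm) * poly r (x \<bullet> e)"
      using AE_usm
    proof eventually_elim
      case (elim x)
      then show ?case using q[OF elim, of p] by (simp add: inner_commute[of e x])
    qed
  qed (use h' in measurable)
  have sym: "wmean lam (q p * r) = wmean lam (q r * p)" for p r
    using zonal_conv_symmetric[OF e h' h, of p r] wmean_pos[OF lam] z[of "q p * r"] z[of "q r * p"]
    by (simp add: zq)
  have "wmean lam (q (?G l) * ?G k) = 0" if "k < l" for k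
  proof -
    have "wmean lam (q (?G l) * ?G k) = wmean lam (q (?G k) * ?G l)" by (rule sym)
    also have "\<dots> = 0"
      using qd[of "?G k"] degree_geg_poly[of lam k] that by (intro wmean_geg_poly_orthogonal[OF lam]) simp
    finally show ?thesis .
  qed
  note lower = this
  have "q (?G l) = (\<Sum>k\<le>l. smult (wmean lam (q (?G l) * ?G k) / wmean lam (?G k * ?G k)) (?G k))"
    using qd[of "?G l"] degree_geg_poly[of lam l] by (intro geg_poly_expansion[OF lam]) simp
  also have "\<dots> = (\<Sum>k\<in>{l}. smult (wmean lam (q (?G l) * ?G k) / wmean lam (?G k * ?G k)) (?G k))"
    by (rule sum.mono_neutral_right) (auto simp: lower)
  finally have "q (?G l) = smult (wmean lam (q (?G l) * ?G l) / wmean lam (?G l * ?G l)) (?G l)" by simp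
  then obtain c where c: "q (?G l) = smult c (?G l)" by blast
  have G1: "poly (?G l) 1 \<noteq> 0" using geg_poly_at_1_ge_1[OF lam, of l] by linarith
  have "c * poly (?G l) 1 = (\<integral>y. poly (?G l) (e \<bullet> y) * h (e \<bullet> y) \<partial>usm)"
    using q[OF e, of "?G l"] e by (simp add: c norm_eq_1)
  then have "c = zmult e h l"
    using G1 by (simp add: zmult_def lam_def[symmetric] field_simps)
  then show ?thesis
    using q[OF x, of "?G l"] by (simp add: c lam_def[symmetric])
qed

theorem funk_hecke:
  fixes h :: "real \<Rightarrow> complex" and e :: "'a::euclidean_space"
  assumes d: "DIM('a) \<ge> 3" and e: "norm e = 1" and x: "norm x = 1"
    and [measurable]: "h \<in> borel_measurable borel" and h: "integrable usm (\<lambda>y. h (e \<bullet> y))"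
  shows "(\<integral>y. poly (sgeg TYPE('a) l) (x \<bullet> y) *\<^sub>R h (e \<bullet> y) \<partial>usm) = poly (sgeg TYPE('a) l) (x \<bullet> e) *\<^sub>R zmult e h l"
proof -
  let ?G = "sgeg TYPE('a) l"
  have i: "integrable usm (\<lambda>y. poly ?G (z \<bullet> y) *\<^sub>R h (e \<bullet> y))" for z
    by (intro integrable_usm_continuous_scaleR h continuous_intros)
  have r: "Re (zmult e h l) = zmult e (\<lambda>t. Re (h t)) l" and im: "Im (zmult e h l) = zmult e (\<lambda>t. Im (h t)) l"
    using integral_Re[OF i[of e]] integral_Im[OF i[of e]] by (simp_all add: zmult_def)
  have hr: "integrable usm (\<lambda>y. Re (h (e \<bullet> y)))" and hi: "integrable usm (\<lambda>y. Im (h (e \<bullet> y)))"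
    using h by auto
  show ?thesis
    using integral_Re[OF i[of x]] integral_Im[OF i[of x]]
      funk_hecke_real[OF d e x _ hr, of l] funk_hecke_real[OF d e x _ hi, of l]
    by (intro complex_eqI) (simp_all add: r im)
qed

section \<open>Zonal convolution and harmonic projections\<close>

definition zconv :: "(real \<Rightarrow> complex) \<Rightarrow> ('a::euclidean_space \<Rightarrow> complex) \<Rightarrow> 'a \<Rightarrow> complex" where
  "zconv h f x = (\<integral>y. h (x \<bullet> y) * f y \<partial>usm)"

definition zpoly :: "'a::euclidean_space itself \<Rightarrow> nat \<Rightarrow> real poly" where
  "zpoly T l = smult ((real l + gegenbauer_index T) / gegenbauer_index T) (sgeg T l)"

abbreviation cpoly :: "real poly \<Rightarrow> real \<Rightarrow> complex" where
  "cpoly p t \<equiv> complex_of_real (poly p t)"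

definition harm_proj :: "nat \<Rightarrow> ('a::euclidean_space \<Rightarrow> complex) \<Rightarrow> 'a \<Rightarrow> complex" where
  "harm_proj l f = zconv (cpoly (zpoly TYPE('a) l)) f"

definition harm_energy :: "nat \<Rightarrow> ('a::euclidean_space \<Rightarrow> complex) \<Rightarrow> real" where
  "harm_energy l f = (\<integral>x. (norm (harm_proj l f x))\<^sup>2 \<partial>usm)"

definition sq_integrable :: "('a::euclidean_space \<Rightarrow> complex) \<Rightarrow> bool" where
  "sq_integrable f \<longleftrightarrow> f \<in> borel_measurable borel \<and> integrable usm (\<lambda>x. (norm (f x))\<^sup>2)"

lemma sq_integrable_measurable: "sq_integrable f \<Longrightarrow> f \<in> borel_measurable borel"
  and sq_integrable_norm_sq: "sq_integrable f \<Longrightarrow> integrable usm (\<lambda>x. (norm (f x))\<^sup>2)"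
  by (simp_all add: sq_integrable_def)

lemma sq_integrable_integrable:
  assumes "sq_integrable f"
  shows "integrable usm f"
proof (rule Bochner_Integration.integrable_bound)
  note [measurable] = sq_integrable_measurable[OF assms]
  show "integrable usm (\<lambda>x. 1 + (norm (f x))\<^sup>2)"
    using sq_integrable_norm_sq[OF assms] by simp
  show "f \<in> borel_measurable usm" by measurable
  have "norm z \<le> 1 + (norm z)\<^sup>2" for z :: complex
    using zero_le_power2[of "norm z - 1 / 2"] by (simp add: power2_eq_square algebra_simps)
  then show "AE x in usm. norm (f x) \<le> norm (1 + (norm (f x))\<^sup>2)" by simp
qed

lemma norm_add_sq_le: "(norm (a + b :: complex))\<^sup>2 \<le> 2 * (norm a)\<^sup>2 + 2 * (norm b)\<^sup>2"
proof -
  have "(norm (a + b))\<^sup>2 + (norm (a - b))\<^sup>2 = 2 * (norm a)\<^sup>2 + 2 * (norm b)\<^sup>2"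
    unfolding power2_norm_eq_inner by (simp add: inner_add_left inner_add_right inner_diff_left inner_diff_right)
  then show ?thesis using zero_le_power2[of "norm (a - b)"] by linarith
qed

lemma sq_integrable_add:
  assumes f: "sq_integrable f" and g: "sq_integrable g"
  shows "sq_integrable (\<lambda>x. f x + g x)"
  unfolding sq_integrable_def
proof
  note [measurable] = sq_integrable_measurable[OF f] sq_integrable_measurable[OF g]
  show "(\<lambda>x. f x + g x) \<in> borel_measurable borel" by measurable
  show "integrable usm (\<lambda>x. (norm (f x + g x))\<^sup>2)"
  proof (rule Bochner_Integration.integrable_bound)
    show "integrable usm (\<lambda>x. 2 * (norm (f x))\<^sup>2 + 2 * (norm (g x))\<^sup>2)"
      using f g by (simp add: sq_integrable_def)
  qed (auto simp: norm_add_sq_le)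
qed

lemma sq_integrable_scale: "sq_integrable f \<Longrightarrow> sq_integrable (\<lambda>x. c * f x)"
  by (auto simp: sq_integrable_def norm_mult power_mult_distrib)

lemma sq_integrable_diff: "sq_integrable f \<Longrightarrow> sq_integrable g \<Longrightarrow> sq_integrable (\<lambda>x. f x - g x)"
  using sq_integrable_add[of f "\<lambda>x. - 1 * g x"] sq_integrable_scale[of g "- 1"] by simp

lemma sq_integrable_bounded:
  assumes [measurable]: "f \<in> borel_measurable borel" and "\<And>x. norm x = 1 \<Longrightarrow> norm (f x) \<le> B"
  shows "sq_integrable f"
  unfolding sq_integrable_def
proof
  show "integrable usm (\<lambda>x. (norm (f x))\<^sup>2)"
    by (rule integrable_usm_bounded[where B="B\<^sup>2"]) (auto intro!: power_mono assms(2))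
qed fact

lemma zconv_smult: "zconv (cpoly (smult c p)) f x = complex_of_real c * zconv (cpoly p) f x"
  by (simp add: zconv_def mult.assoc)

lemma zconv_measurable [measurable]:
  assumes [measurable]: "h \<in> borel_measurable borel" "f \<in> borel_measurable borel"
  shows "zconv h f \<in> borel_measurable borel"
proof -
  have "(\<lambda>x. \<integral>y. h (x \<bullet> y) * f y \<partial>usm) \<in> borel_measurable borel" by measurable
  then show ?thesis by (simp add: zconv_def[abs_def])
qed

lemma harm_measurable [measurable]: "f \<in> borel_measurable borel \<Longrightarrow> harm_proj l f \<in> borel_measurable borel"
  unfolding harm_proj_def by measurable

lemma zconv_poly_bounded:
  fixes f :: "'a::euclidean_space \<Rightarrow> complex"
  assumes f: "integrable usm f"
  obtains B where "\<And>x. norm x = 1 \<Longrightarrow> norm (zconv (cpoly p) f x) \<le> B"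
proof -
  obtain B where B: "B \<ge> 0" "\<And>t. t \<in> {-1..1} \<Longrightarrow> \<bar>poly p t\<bar> \<le> B" using poly_bounded_interval by blast
  have "norm (zconv (cpoly p) f x) \<le> (\<integral>y. B * norm (f y) \<partial>usm)" if x: "norm x = 1" for x
  proof -
    have i: "integrable usm (\<lambda>y. cpoly p (x \<bullet> y) * f y)"
      using integrable_usm_continuous_scaleR[OF _ f, of "\<lambda>y. poly p (x \<bullet> y)"]
      by (simp add: scaleR_conv_of_real continuous_intros)
    have "norm (zconv (cpoly p) f x) \<le> (\<integral>y. norm (cpoly p (x \<bullet> y) * f y) \<partial>usm)"
      unfolding zconv_def by (rule integral_norm_bound)
    also have "\<dots> \<le> (\<integral>y. B * norm (f y) \<partial>usm)"
    proof (rule integral_mono_AE)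
      show "AE y in usm. norm (cpoly p (x \<bullet> y) * f y) \<le> B * norm (f y)"
        using AE_usm
      proof eventually_elim
        case (elim y)
        then show ?case using B inner_unit[OF x elim] by (auto simp: norm_mult intro!: mult_right_mono)
      qed
    qed (use i f in auto)
    finally show ?thesis .
  qed
  then show thesis by (rule that)
qed

lemma sq_integrable_zconv_poly:
  assumes f: "integrable usm f" "f \<in> borel_measurable borel"
  shows "sq_integrable (zconv (cpoly p) f)"
proof -
  obtain B where "\<And>x. norm x = 1 \<Longrightarrow> norm (zconv (cpoly p) f x) \<le> B"
    using zconv_poly_bounded[OF f(1)] by blast
  then show ?thesis using f by (intro sq_integrable_bounded) (auto intro!: zconv_measurable)
qed

lemma integrable_zconv_kernel:
  fixes f :: "'a::euclidean_space \<Rightarrow> complex"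
    and e :: 'a and u :: "'a \<Rightarrow> complex"
  assumes e: "norm e = 1" and [measurable]: "h \<in> borel_measurable borel"
    and h: "integrable usm (\<lambda>y. h (e \<bullet> y))"
    and f: "integrable usm f" and [measurable]: "f \<in> borel_measurable borel"
    and u [measurable]: "u \<in> borel_measurable borel" and ub: "\<And>y. norm y = 1 \<Longrightarrow> norm (u y) \<le> B"
  shows "integrable (usm \<Otimes>\<^sub>M usm) (\<lambda>(y, z). u y * (h (y \<bullet> z) * f z))"
proof -
  have B: "B \<ge> 0" using ub[OF e] norm_ge_zero order_trans by blast
  have "integrable (usm \<Otimes>\<^sub>M usm) (\<lambda>(y, z). (\<lambda>(z, y). u y * (h (y \<bullet> z) * f z)) (z, y))"
  proof (rule integrable_kernel(2)[where k="\<lambda>t. B * norm (h t)" and g="\<lambda>z. norm (f z)" and e=e])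
    show "norm (case (z, y) of (z, y) \<Rightarrow> u y * (h (y \<bullet> z) * f z)) \<le> B * norm (h (y \<bullet> z)) * norm (f z)"
      if "norm y = 1" "norm z = 1" for y z
      using ub[OF that(1)] B by (simp add: norm_mult mult_right_mono mult.assoc)
  qed (use e h f in auto)
  then show ?thesis by simp
qed

lemma zconv_poly_zconv:
  fixes f :: "'a::euclidean_space \<Rightarrow> complex"
  assumes d: "DIM('a) \<ge> 3" and e: "norm (e :: 'a) = 1"
    and h: "h \<in> borel_measurable borel" "integrable usm (\<lambda>y. h (e \<bullet> y))"
    and f: "integrable usm f" "f \<in> borel_measurable borel" and x: "norm x = 1"
  shows "harm_proj l (zconv h f) x = zmult e h l * harm_proj l f x"
proof -
  let ?G = "sgeg TYPE('a) l"
  let ?c = "(real l + gegenbauer_index TYPE('a)) / gegenbauer_index TYPE('a)"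
  note [measurable] = h(1) f(2)
  obtain B where B: "B \<ge> 0" "\<And>t. t \<in> {-1..1} \<Longrightarrow> \<bar>poly ?G t\<bar> \<le> B" using poly_bounded_interval by blast
  have "integrable (usm \<Otimes>\<^sub>M usm) (\<lambda>(y, z). cpoly ?G (x \<bullet> y) * (h (y \<bullet> z) * f z))"
    using B(2)[OF inner_unit[OF x]] by (intro integrable_zconv_kernel[OF e h f]) auto
  from usm2.Fubini_integral[OF this]
  have "(\<integral>y. cpoly ?G (x \<bullet> y) * zconv h f y \<partial>usm) = (\<integral>z. (\<integral>y. cpoly ?G (x \<bullet> y) * h (y \<bullet> z) \<partial>usm) * f z \<partial>usm)"
    by (simp add: zconv_def mult.assoc flip: integral_mult_right_zero integral_mult_left_zero)
  also have "\<dots> = (\<integral>z. zmult e h l * (cpoly ?G (x \<bullet> z) * f z) \<partial>usm)"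
  proof (rule integral_cong_AE)
    show "AE z in usm. (\<integral>y. cpoly ?G (x \<bullet> y) * h (y \<bullet> z) \<partial>usm) * f z = zmult e h l * (cpoly ?G (x \<bullet> z) * f z)"
      using AE_usm
    proof eventually_elim
      case (elim z)
      have hz: "integrable usm (\<lambda>y. h (z \<bullet> y))"
        using h(2) integral_usm_zonal_cong[of e z] integrable_usm_rot[OF reflection_orthogonal, of "\<lambda>x. h (e \<bullet> x)" "e - z"]
          reflection_inner[of "e - z" e] reflection_swaps(1)[of e z] e elim by simp
      have "zmult z h l = zmult e h l"
        using integral_usm_zonal_cong[of z e "\<lambda>t. poly ?G t *\<^sub>R h t"] e elim by (simp add: zmult_def)
      then show ?case
        using funk_hecke[OF d elim x h(1) hz, of l]
        by (simp add: scaleR_conv_of_real inner_commute mult_ac)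
    qed
  qed measurable
  finally have "(\<integral>y. cpoly ?G (x \<bullet> y) * zconv h f y \<partial>usm) = zmult e h l * (\<integral>y. cpoly ?G (x \<bullet> y) * f y \<partial>usm)"
    by simp
  then have "zconv (cpoly ?G) (zconv h f) x = zmult e h l * zconv (cpoly ?G) f x"
    by (simp only: zconv_def[of "cpoly ?G"])
  then show ?thesis
    unfolding harm_proj_def zpoly_def by (simp only: zconv_smult mult.left_commute)
qed

lemma zmult_zpoly:
  fixes e :: "'a::euclidean_space"
  assumes d: "DIM('a) \<ge> 3" and e: "norm e = 1"
  shows "zmult e (cpoly (zpoly TYPE('a) m)) l = (if l = m then 1 else 0)"
proof -
  define lam where "lam = gegenbauer_index TYPE('a)"
  have lam: "lam \<ge> 1 / 2" using gegenbauer_index_ge[OF d] by (simp add: lam_def)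
  let ?G = "geg_poly lam"
  have G1: "poly (?G l) 1 \<ge> 1" by (rule geg_poly_at_1_ge_1[OF lam])
  have "(\<integral>y. poly (?G l) (e \<bullet> y) *\<^sub>R cpoly (zpoly TYPE('a) m) (e \<bullet> y) \<partial>usm)
      = complex_of_real (zmean e (?G l * zpoly TYPE('a) m))"
    by (simp add: zmean_def scaleR_conv_of_real flip: integral_complex_of_real)
  also have "?G l * zpoly TYPE('a) m = smult ((real m + lam) / lam) (?G l * ?G m)"
    by (simp add: zpoly_def lam_def[symmetric])
  finally have *: "zmult e (cpoly (zpoly TYPE('a) m)) l
      = complex_of_real ((real m + lam) / lam * (wmean lam (?G l * ?G m) / wmean lam 1) / poly (?G l) 1)"
    using zmean_eq_wmean[OF e d, of "?G l * ?G m"]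
    by (simp add: zmult_def lam_def[symmetric] zmean_smult scaleR_conv_of_real field_simps)
  show ?thesis
  proof (cases "l = m")
    case True
    have "(real m + lam) / lam * (wmean lam (?G m * ?G m) / wmean lam 1) / poly (?G m) 1
       = ((real m + lam) * wmean lam (?G m * ?G m)) / (lam * wmean lam 1 * poly (?G m) 1)"
      by simp
    also have "\<dots> = (lam * poly (?G m) 1 * wmean lam 1) / (lam * wmean lam 1 * poly (?G m) 1)"
      by (simp only: wmean_geg_poly_square[OF lam])
    also have "\<dots> = 1" using lam G1 wmean_pos[OF lam] True by simp
    finally show ?thesis unfolding * by (simp only: True if_True of_real_1 refl)
  qed (simp add: * wmean_geg_poly_orthogonal'[OF lam])
qed

lemma integrable_poly_mult:
  fixes f :: "'a::euclidean_space \<Rightarrow> complex"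
  assumes f: "integrable usm f"
  shows "integrable usm (\<lambda>y. cpoly p (x \<bullet> y) * f y)"
  using integrable_usm_continuous_scaleR[OF _ f, of "\<lambda>y. poly p (x \<bullet> y)"]
  by (simp add: scaleR_conv_of_real continuous_intros)

lemma harm_harm:
  fixes f :: "'a::euclidean_space \<Rightarrow> complex"
  assumes d: "DIM('a) \<ge> 3" and f: "integrable usm f" "f \<in> borel_measurable borel" and x: "norm x = 1"
  shows "harm_proj l (harm_proj m f) x = (if l = m then harm_proj l f x else 0)"
proof -
  have "integrable usm (\<lambda>y. cpoly (zpoly TYPE('a) m) (x \<bullet> y))"
    by (intro integrable_usm_continuous continuous_intros)
  moreover have "cpoly (zpoly TYPE('a) m) \<in> borel_measurable borel" by measurable
  ultimately show ?thesis
    using zconv_poly_zconv[OF d x _ _ f x, of "cpoly (zpoly TYPE('a) m)" l] zmult_zpoly[OF d x, of m l]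
    by (simp add: harm_proj_def[of m])
qed

lemma integrable_fst_times_snd:
  fixes f g :: "'a::euclidean_space \<Rightarrow> real"
  assumes f: "integrable usm f" and g: "integrable usm g"
  shows "integrable (usm \<Otimes>\<^sub>M usm) (\<lambda>(x, y). f x * g y)"
proof (rule usm2.Fubini_integrable)
  note [measurable] = borel_measurable_integrable[OF f] borel_measurable_integrable[OF g]
  show "(\<lambda>(x, y). f x * g y) \<in> borel_measurable (usm \<Otimes>\<^sub>M usm)" by measurable
qed (use f g in \<open>auto simp: abs_mult\<close>)

lemma AE_usm_pair:
  "AE z in usm \<Otimes>\<^sub>M usm. norm (fst z :: 'a::euclidean_space) = 1 \<and> norm (snd z :: 'b::euclidean_space) = 1"
proof (rule usm2.AE_pair_measure)
  show "AE x in usm. AE y in usm. norm (fst (x, y) :: 'a) = 1 \<and> norm (snd (x, y) :: 'b) = 1"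
    using AE_usm by eventually_elim (use AE_usm in simp)
qed measurable

lemma zconv_poly_adjoint:
  fixes f g :: "'a::euclidean_space \<Rightarrow> complex"
  assumes f: "integrable usm f" "f \<in> borel_measurable borel"
    and g: "integrable usm g" "g \<in> borel_measurable borel"
  shows "(\<integral>x. f x \<bullet> zconv (cpoly p) g x \<partial>usm) = (\<integral>x. zconv (cpoly p) f x \<bullet> g x \<partial>usm)"
proof -
  note [measurable] = f(2) g(2)
  obtain B where B: "B \<ge> 0" "\<And>t. t \<in> {-1..1} \<Longrightarrow> \<bar>poly p t\<bar> \<le> B" using poly_bounded_interval by blast
  have i: "integrable (usm \<Otimes>\<^sub>M usm) (\<lambda>(x, y). f x \<bullet> (cpoly p (x \<bullet> y) * g y))"
  proof (rule Bochner_Integration.integrable_bound)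
    show "integrable (usm \<Otimes>\<^sub>M usm) (\<lambda>z. B * (case z of (x, y) \<Rightarrow> norm (f x) * norm (g y)))"
      using integrable_fst_times_snd[of "\<lambda>x. norm (f x)" "\<lambda>x. norm (g x)"] f(1) g(1) by simp
    show "AE z in usm \<Otimes>\<^sub>M usm. norm (case z of (x, y) \<Rightarrow> f x \<bullet> (cpoly p (x \<bullet> y) * g y))
        \<le> norm (B * (case z of (x, y) \<Rightarrow> norm (f x) * norm (g y)))"
      using AE_usm_pair
    proof eventually_elim
      case (elim z)
      obtain x y where z: "z = (x, y)" by (cases z)
      have "\<bar>f x \<bullet> (cpoly p (x \<bullet> y) * g y)\<bar> \<le> norm (f x) * (\<bar>poly p (x \<bullet> y)\<bar> * norm (g y))"
        using Cauchy_Schwarz_ineq2[of "f x" "cpoly p (x \<bullet> y) * g y"] by (simp add: norm_mult)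
      also have "\<dots> \<le> norm (f x) * (B * norm (g y))"
        using B(2)[OF inner_unit] elim z by (intro mult_left_mono mult_right_mono) auto
      finally show ?case using B(1) by (simp add: z mult_ac)
    qed
  qed measurable
  have "(\<integral>x. f x \<bullet> zconv (cpoly p) g x \<partial>usm) = (\<integral>x. (\<integral>y. f x \<bullet> (cpoly p (x \<bullet> y) * g y) \<partial>usm) \<partial>usm)"
    using integral_inner_right[OF integrable_poly_mult[OF g(1)]] by (simp add: zconv_def)
  also have "\<dots> = (\<integral>y. (\<integral>x. f x \<bullet> (cpoly p (x \<bullet> y) * g y) \<partial>usm) \<partial>usm)"
    using usm2.Fubini_integral[OF i] by simp
  also have "\<dots> = (\<integral>y. (\<integral>x. (cpoly p (y \<bullet> x) * f x) \<bullet> g y \<partial>usm) \<partial>usm)"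
    by (simp add: inner_complex_def inner_commute algebra_simps)
  also have "\<dots> = (\<integral>y. zconv (cpoly p) f y \<bullet> g y \<partial>usm)"
    using integral_inner_left[OF integrable_poly_mult[OF f(1)]] by (simp add: zconv_def)
  finally show ?thesis .
qed

lemma integrable_inner_sq:
  assumes f: "sq_integrable f" and g: "sq_integrable g"
  shows "integrable usm (\<lambda>x. f x \<bullet> g x)"
proof (rule Bochner_Integration.integrable_bound)
  note [measurable] = sq_integrable_measurable[OF f] sq_integrable_measurable[OF g]
  show "integrable usm (\<lambda>x. (norm (f x))\<^sup>2 + (norm (g x))\<^sup>2)"
    using f g by (simp add: sq_integrable_def)
  have "\<bar>a \<bullet> b\<bar> \<le> (norm a)\<^sup>2 + (norm b)\<^sup>2" for a b :: complex
  proof -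
    have "2 * (norm a * norm b) \<le> (norm a)\<^sup>2 + (norm b)\<^sup>2" by (rule order_trans[OF _ sum_squares_bound]) simp
    moreover have "0 \<le> norm a * norm b" by simp
    ultimately show ?thesis using Cauchy_Schwarz_ineq2[of a b] by linarith
  qed
  then show "AE x in usm. norm (f x \<bullet> g x) \<le> norm ((norm (f x))\<^sup>2 + (norm (g x))\<^sup>2)" by simp
  show "(\<lambda>x. f x \<bullet> g x) \<in> borel_measurable usm" by measurable
qed

lemma sq_integrable_harm: "sq_integrable f \<Longrightarrow> sq_integrable (harm_proj l f)"
  unfolding harm_proj_def
  by (intro sq_integrable_zconv_poly sq_integrable_integrable sq_integrable_measurable)

lemma integral_inner_harm:
  fixes f :: "'a::euclidean_space \<Rightarrow> complex"
  assumes d: "DIM('a) \<ge> 3" and f: "sq_integrable f"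
  shows "(\<integral>x. harm_proj l f x \<bullet> harm_proj m f x \<partial>usm) = (if l = m then harm_energy l f else 0)"
    and "(\<integral>x. f x \<bullet> harm_proj l f x \<partial>usm) = harm_energy l f"
proof -
  note i = sq_integrable_integrable[OF f] sq_integrable_measurable[OF f]
  note [measurable] = i(2)
  have *: "(\<integral>x. harm_proj l f x \<bullet> harm_proj m f x \<partial>usm) = (\<integral>x. f x \<bullet> (if l = m then harm_proj l f x else 0) \<partial>usm)" for l m
  proof -
    have "(\<integral>x. harm_proj l f x \<bullet> harm_proj m f x \<partial>usm) = (\<integral>x. f x \<bullet> harm_proj l (harm_proj m f) x \<partial>usm)"
      unfolding harm_proj_def[of l]
      by (rule zconv_poly_adjoint[symmetric])
        (use i sq_integrable_harm[OF f] in \<open>auto simp: sq_integrable_integrable sq_integrable_measurable\<close>)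
    also have "\<dots> = (\<integral>x. f x \<bullet> (if l = m then harm_proj l f x else 0) \<partial>usm)"
    proof (rule integral_cong_AE)
      show "AE x in usm. f x \<bullet> harm_proj l (harm_proj m f) x = f x \<bullet> (if l = m then harm_proj l f x else 0)"
        using AE_usm by eventually_elim (simp add: harm_harm[OF d i])
    qed measurable
    finally show ?thesis .
  qed
  have e: "harm_energy l f = (\<integral>x. harm_proj l f x \<bullet> harm_proj l f x \<partial>usm)" for l
    by (simp add: harm_energy_def power2_norm_eq_inner)
  show "(\<integral>x. f x \<bullet> harm_proj l f x \<partial>usm) = harm_energy l f"
    using *[of l l] by (simp add: e)
  then show "(\<integral>x. harm_proj l f x \<bullet> harm_proj m f x \<partial>usm) = (if l = m then harm_energy l f else 0)"
    by (cases "l = m") (simp_all add: *)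
qed

definition harm_defect :: "nat \<Rightarrow> ('a::euclidean_space \<Rightarrow> complex) \<Rightarrow> real" where
  "harm_defect L f = (\<integral>x. (norm (f x - (\<Sum>l\<le>L. harm_proj l f x)))\<^sup>2 \<partial>usm)"

lemma harm_energy_nonneg [simp]: "harm_energy l f \<ge> 0"
  and harm_defect_nonneg [simp]: "harm_defect l f \<ge> 0"
  by (simp_all add: harm_energy_def harm_defect_def)

lemma harm_defect_eq:
  fixes f :: "'a::euclidean_space \<Rightarrow> complex"
  assumes d: "DIM('a) \<ge> 3" and f: "sq_integrable f"
  shows "harm_defect L f = (\<integral>x. (norm (f x))\<^sup>2 \<partial>usm) - (\<Sum>l\<le>L. harm_energy l f)"
proof -
  have i: "integrable usm (\<lambda>x. f x \<bullet> harm_proj l f x)" "integrable usm (\<lambda>x. harm_proj l f x \<bullet> harm_proj m f x)" for l m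
    using f sq_integrable_harm[OF f] by (auto intro!: integrable_inner_sq)
  have i2: "integrable usm (\<lambda>x. f x \<bullet> f x)" using f by (intro integrable_inner_sq)
  have "harm_defect L f = (\<integral>x. f x \<bullet> f x - 2 * (\<Sum>l\<le>L. f x \<bullet> harm_proj l f x)
      + (\<Sum>l\<le>L. \<Sum>m\<le>L. harm_proj l f x \<bullet> harm_proj m f x) \<partial>usm)"
    unfolding harm_defect_def power2_norm_eq_inner
    by (intro arg_cong[where f="integral\<^sup>L usm"] ext)
      (simp add: inner_diff_left inner_diff_right inner_sum_left inner_sum_right inner_commute)
  also have "\<dots> = (\<integral>x. f x \<bullet> f x \<partial>usm) - 2 * (\<Sum>l\<le>L. \<integral>x. f x \<bullet> harm_proj l f x \<partial>usm)
      + (\<Sum>l\<le>L. \<Sum>m\<le>L. \<integral>x. harm_proj l f x \<bullet> harm_proj m f x \<partial>usm)"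
    using i i2 by (simp add: Bochner_Integration.integral_sum)
  also have "\<dots> = (\<integral>x. f x \<bullet> f x \<partial>usm) - (\<Sum>l\<le>L. harm_energy l f)"
    by (simp add: integral_inner_harm[OF d f])
  finally show ?thesis by (simp add: power2_norm_eq_inner)
qed

lemma harm_add:
  fixes f g :: "'a::euclidean_space \<Rightarrow> complex"
  assumes "integrable usm f" "integrable usm g"
  shows "harm_proj l (\<lambda>x. f x + g x) x = harm_proj l f x + harm_proj l g x"
  using integrable_poly_mult[OF assms(1)] integrable_poly_mult[OF assms(2)]
  by (simp add: harm_proj_def zconv_def distrib_left)

lemma harm_scale: "harm_proj l (\<lambda>x. c * f x) x = c * harm_proj l f x"
  by (simp add: harm_proj_def zconv_def mult.left_commute)

lemma sq_integrable_sum: "(\<And>i. i \<in> A \<Longrightarrow> sq_integrable (f i)) \<Longrightarrow> sq_integrable (\<lambda>x. \<Sum>i\<in>A. f i x)"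
proof (induction A rule: infinite_finite_induct)
  case (insert i A)
  then show ?case using sq_integrable_add[of "f i" "\<lambda>x. \<Sum>i\<in>A. f i x"] by simp
qed (auto intro!: sq_integrable_bounded[where B=0])

lemma harm_defect_add:
  fixes f g :: "'a::euclidean_space \<Rightarrow> complex"
  assumes f: "sq_integrable f" and g: "sq_integrable g"
  shows "harm_defect L (\<lambda>x. f x + g x) \<le> 2 * harm_defect L f + 2 * harm_defect L g"
proof -
  have s: "sq_integrable (\<lambda>x. f x - (\<Sum>l\<le>L. harm_proj l f x))" if "sq_integrable f" for f :: "'a \<Rightarrow> complex"
    using that by (intro sq_integrable_diff sq_integrable_sum sq_integrable_harm)
  have "harm_defect L (\<lambda>x. f x + g x) =
      (\<integral>x. (norm ((f x - (\<Sum>l\<le>L. harm_proj l f x)) + (g x - (\<Sum>l\<le>L. harm_proj l g x))))\<^sup>2 \<partial>usm)"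
    using f g by (simp add: harm_defect_def harm_add sq_integrable_integrable sum.distrib algebra_simps)
  also have "\<dots> \<le> (\<integral>x. 2 * (norm (f x - (\<Sum>l\<le>L. harm_proj l f x)))\<^sup>2 + 2 * (norm (g x - (\<Sum>l\<le>L. harm_proj l g x)))\<^sup>2 \<partial>usm)"
    using sq_integrable_norm_sq[OF s[OF f]] sq_integrable_norm_sq[OF s[OF g]]
      sq_integrable_norm_sq[OF sq_integrable_add[OF s[OF f] s[OF g]]]
    by (intro integral_mono norm_add_sq_le) auto
  also have "\<dots> = 2 * harm_defect L f + 2 * harm_defect L g"
    using sq_integrable_norm_sq[OF s[OF f]] sq_integrable_norm_sq[OF s[OF g]] by (simp add: harm_defect_def)
  finally show ?thesis .
qed

lemma harm_defect_scale: "harm_defect L (\<lambda>x. c * f x) = (norm c)\<^sup>2 * harm_defect L f"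
  by (simp add: harm_defect_def harm_scale norm_mult power_mult_distrib flip: sum_distrib_left right_diff_distrib)

section \<open>Parseval's identity\<close>

lemma geg_poly_bound:
  assumes d: "DIM('a::euclidean_space) \<ge> 3" and t: "t \<in> {-1..1}"
  shows "\<bar>poly (sgeg TYPE('a) l) t\<bar> \<le> poly (sgeg TYPE('a) l) 1"
proof -
  obtain e :: 'a where "e \<in> Basis" using nonempty_Basis by blast
  then have e: "norm e = 1" by simp
  have "DIM('a) \<ge> 2" using d by simp
  then obtain u :: 'a where u: "norm u = 1" "e \<bullet> u = 0" by (rule obtain_orthogonal_unit)
  define x where "x = t *\<^sub>R e + sqrt (1 - t\<^sup>2) *\<^sub>R u"
  have x: "norm x = 1" and xe: "x \<bullet> e = t"
    using unit_vector_with_inner[OF e u t] by (simp_all add: x_def inner_commute)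
  define c where "c = (real l + gegenbauer_index TYPE('a)) / gegenbauer_index TYPE('a)"
  let ?G = "sgeg TYPE('a) l"
  have c: "c > 0" using gegenbauer_index_ge[OF d] by (simp add: c_def)
  have conv: "c * (\<integral>y. poly ?G (x \<bullet> y) * poly ?G (z \<bullet> y) \<partial>usm) = poly ?G (x \<bullet> z)"
    if x: "norm x = 1" and z: "norm z = 1" for x z :: 'a
  proof -
    have "integrable usm (\<lambda>y. cpoly (zpoly TYPE('a) l) (z \<bullet> y))"
      by (intro integrable_usm_continuous continuous_intros)
    moreover have "cpoly (zpoly TYPE('a) l) \<in> borel_measurable borel" by measurable
    ultimately have "(\<integral>y. poly ?G (x \<bullet> y) *\<^sub>R cpoly (zpoly TYPE('a) l) (z \<bullet> y) \<partial>usm) = cpoly ?G (x \<bullet> z)"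
      using funk_hecke[OF d z x, of "cpoly (zpoly TYPE('a) l)" l]
      by (simp add: zmult_zpoly[OF d z] scaleR_conv_of_real)
    moreover have "(\<integral>y. poly ?G (x \<bullet> y) *\<^sub>R cpoly (zpoly TYPE('a) l) (z \<bullet> y) \<partial>usm)
       = complex_of_real (c * (\<integral>y. poly ?G (x \<bullet> y) * poly ?G (z \<bullet> y) \<partial>usm))"
      by (simp add: zpoly_def c_def[symmetric] scaleR_conv_of_real mult_ac
          flip: integral_complex_of_real of_real_mult integral_mult_right_zero)
    ultimately show ?thesis by (simp only: of_real_eq_iff)
  qed
  have i: "integrable usm (\<lambda>y. poly ?G (z \<bullet> y) * poly ?G (w \<bullet> y))" for z w :: 'a
    by (intro integrable_usm_continuous continuous_intros)
  have "\<bar>poly ?G t\<bar> = c * \<bar>\<integral>y. poly ?G (x \<bullet> y) * poly ?G (e \<bullet> y) \<partial>usm\<bar>"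
    using conv[OF x e] c by (metis abs_mult abs_of_pos xe)
  also have "\<dots> \<le> c * (\<integral>y. (poly ?G (x \<bullet> y) * poly ?G (x \<bullet> y) + poly ?G (e \<bullet> y) * poly ?G (e \<bullet> y)) / 2 \<partial>usm)"
  proof (intro mult_left_mono order_trans[OF integral_abs_bound] integral_mono)
    fix y
    have "2 * \<bar>poly ?G (x \<bullet> y)\<bar> * \<bar>poly ?G (e \<bullet> y)\<bar> \<le> \<bar>poly ?G (x \<bullet> y)\<bar>\<^sup>2 + \<bar>poly ?G (e \<bullet> y)\<bar>\<^sup>2"
      by (rule sum_squares_bound)
    then show "\<bar>poly ?G (x \<bullet> y) * poly ?G (e \<bullet> y)\<bar> \<le> (poly ?G (x \<bullet> y) * poly ?G (x \<bullet> y) + poly ?G (e \<bullet> y) * poly ?G (e \<bullet> y)) / 2"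
      by (simp add: abs_mult power2_eq_square)
  qed (use i c in auto)
  also have "\<dots> = (c * (\<integral>y. poly ?G (x \<bullet> y) * poly ?G (x \<bullet> y) \<partial>usm) + c * (\<integral>y. poly ?G (e \<bullet> y) * poly ?G (e \<bullet> y) \<partial>usm)) / 2"
    using i by (simp add: algebra_simps add_divide_distrib)
  also have "\<dots> = poly ?G 1"
    using conv[OF x x] conv[OF e e] x e by (simp add: norm_eq_1)
  finally show ?thesis .
qed

lemma cap_measure_pos:
  fixes e :: "'a::euclidean_space"
  assumes d: "DIM('a) \<ge> 3" and e: "norm e = 1" and s: "-1 \<le> s" "s < 1"
  shows "measure usm {y. s < e \<bullet> y} > 0"
proof (rule ccontr)
  define lam where "lam = gegenbauer_index TYPE('a)"
  have lam: "lam \<ge> 1 / 2" using gegenbauer_index_ge[OF d] by (simp add: lam_def)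
  let ?w = "\<lambda>t. indicator {-1..1} t * gegenbauer_weight lam t / wmean lam 1"
  assume "\<not> measure usm {y. s < e \<bullet> y} > 0"
  then have "measure usm {y. s < e \<bullet> y} = 0" using measure_nonneg[of usm "{y. s < e \<bullet> y}"] by linarith
  then have "emeasure usm {y. s < e \<bullet> y} = 0" by (simp add: usm.emeasure_eq_measure)
  moreover have "emeasure usm {y. s < e \<bullet> y} = emeasure (distr usm borel (\<lambda>x. e \<bullet> x)) {s<..}"
    by (subst emeasure_distr) (auto simp: vimage_def)
  ultimately have "(\<integral>\<^sup>+t. ennreal (?w t) * indicator {s<..} t \<partial>lborel) = 0"
    by (simp add: distr_usm_inner[OF e d] lam_def[symmetric] emeasure_density)
  then have "AE t in lborel. ennreal (?w t) * indicator {s<..} t = 0"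
    by (subst (asm) nn_integral_0_iff_AE) auto
  then have "AE t in lborel. t \<notin> {s<..<1}"
  proof eventually_elim
    case (elim t)
    show ?case
    proof
      assume t: "t \<in> {s<..<1}"
      then have "t\<^sup>2 < 1" using s by (auto simp: abs_square_less_1)
      then have "0 < gegenbauer_weight lam t / wmean lam 1"
        using wmean_pos[OF lam] by (auto simp: gegenbauer_weight_def intro!: divide_pos_pos)
      then show False using elim t s by (auto simp: indicator_def ennreal_eq_0_iff)
    qed
  qed
  moreover have "{t \<in> space lborel. \<not> t \<notin> {s<..<1::real}} = {s<..<1}" by auto
  ultimately have "emeasure lborel {s<..<1} = 0"
    by (subst (asm) AE_iff_measurable[where N="{s<..<1}"]) auto
  then show False using s by simp
qed

definition peak :: "nat \<Rightarrow> real poly" where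
  "peak N = [:1 / 2, 1 / 2:] ^ N"

lemma poly_peak: "poly (peak N) t = ((1 + t) / 2) ^ N"
  by (simp add: peak_def poly_power add_divide_distrib)

lemma zmean_peak_lower:
  fixes e :: "'a::euclidean_space"
  assumes e: "norm e = 1" and s: "-1 \<le> s"
  shows "((1 + s) / 2) ^ N * measure usm {y. s < e \<bullet> y} \<le> zmean e (peak N)"
proof -
  have "((1 + s) / 2) ^ N * measure usm {y. s < e \<bullet> y} = (\<integral>y. ((1 + s) / 2) ^ N * indicator {y. s < e \<bullet> y} y \<partial>usm)"
    by simp
  also have "\<dots> \<le> zmean e (peak N)"
    unfolding zmean_def
  proof (rule integral_mono_AE)
    show "AE y in usm. ((1 + s) / 2) ^ N * indicator {y. s < e \<bullet> y} y \<le> poly (peak N) (e \<bullet> y)"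
      using AE_usm
    proof eventually_elim
      case (elim y)
      then show ?case using s inner_unit[OF e elim]
        by (auto simp: poly_peak indicator_def intro!: power_mono)
    qed
  qed (auto simp: integrable_zpoly less_top[symmetric] intro!: integrable_mult_right integrable_real_indicator)
  finally show ?thesis .
qed

lemma zmean_peak_pos:
  fixes e :: "'a::euclidean_space"
  assumes d: "DIM('a) \<ge> 3" and e: "norm e = 1"
  shows "zmean e (peak N) > 0"
proof -
  have "0 < ((1 + 0) / 2) ^ N * measure usm {y. 0 < e \<bullet> y}"
    using cap_measure_pos[OF d e, of 0] by simp
  also have "\<dots> \<le> zmean e (peak N)" by (rule zmean_peak_lower[OF e]) simp
  finally show ?thesis .
qed

lemma peak_limit:
  fixes x :: "'a::euclidean_space"
  assumes d: "DIM('a) \<ge> 3" and x: "norm x = 1" and U: "open U" "x \<in> U"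
  shows "(\<lambda>N. (\<integral>y. indicator U y * poly (peak N) (x \<bullet> y) \<partial>usm) / zmean x (peak N)) \<longlonglongrightarrow> 1"
proof -
  let ?I = "\<lambda>N. \<integral>y. indicator U y * poly (peak N) (x \<bullet> y) \<partial>usm"
  have [measurable]: "U \<in> sets borel" using U by simp
  obtain r where r: "r > 0" "ball x r \<subseteq> U" using U openE by blast
  define \<eta> where "\<eta> = min (r\<^sup>2 / 2) 1"
  have \<eta>: "0 < \<eta>" "\<eta> \<le> 1" "\<eta> \<le> r\<^sup>2 / 2" using r by (auto simp: \<eta>_def)
  have near: "y \<in> U" if "norm y = 1" "x \<bullet> y > 1 - \<eta>" for y
  proof -
    have "(norm (x - y))\<^sup>2 = 2 - 2 * (x \<bullet> y)"
      unfolding power2_norm_eq_inner using x that by (simp add: inner_diff_left inner_diff_right norm_eq_1 inner_commute)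
    then have "(norm (x - y))\<^sup>2 < r\<^sup>2" using that \<eta> by linarith
    then have "norm (x - y) < r" using r(1) by (simp add: power2_less_imp_less)
    then show ?thesis using r(2) by (auto simp: dist_norm)
  qed
  define p where "p = measure usm {y. 1 - \<eta> / 2 < x \<bullet> y}"
  have p: "p > 0" unfolding p_def using \<eta> by (intro cap_measure_pos[OF d x]) auto
  define a b where "a = 1 - \<eta> / 2" and "b = 1 - \<eta> / 4"
  have ab: "0 < a" "a < b" using \<eta> by (auto simp: a_def b_def)
  have cN: "b ^ N * p \<le> zmean x (peak N)" "zmean x (peak N) > 0" for N
    using zmean_peak_lower[OF x, of "1 - \<eta> / 2" N] \<eta> zmean_peak_pos[OF d x]
    by (simp_all add: b_def p_def diff_divide_distrib)
  have i: "integrable usm (\<lambda>y. indicator U y * poly (peak N) (x \<bullet> y))" for N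
    using integrable_usm_bounded_scaleR[OF _ _ integrable_zpoly[of "peak N" x], of "indicator U" 1]
    by (simp add: indicator_def)
  have "norm (?I N / zmean x (peak N) - 1) \<le> (a / b) ^ N / p" for N
  proof -
    have eq: "zmean x (peak N) - ?I N = (\<integral>y. poly (peak N) (x \<bullet> y) - indicator U y * poly (peak N) (x \<bullet> y) \<partial>usm)"
      using i integrable_zpoly[of "peak N" x] by (simp add: zmean_def)
    have bnd: "AE y in usm. 0 \<le> poly (peak N) (x \<bullet> y) - indicator U y * poly (peak N) (x \<bullet> y) \<and>
        poly (peak N) (x \<bullet> y) - indicator U y * poly (peak N) (x \<bullet> y) \<le> a ^ N"
      using AE_usm
    proof eventually_elim
      case (elim y)
      have xy: "-1 \<le> x \<bullet> y" "x \<bullet> y \<le> 1" using inner_unit[OF x elim] by auto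
      show ?case
      proof (cases "y \<in> U")
        case True
        then show ?thesis using ab by simp
      next
        case False
        then have "x \<bullet> y \<le> 1 - \<eta>" using near[OF elim] by linarith
        then have "((1 + x \<bullet> y) / 2) ^ N \<le> a ^ N" using xy by (intro power_mono) (auto simp: a_def)
        then show ?thesis using False xy by (simp add: poly_peak)
      qed
    qed
    have nn: "0 \<le> zmean x (peak N) - ?I N"
      unfolding eq using bnd by (intro integral_nonneg_AE) (auto elim: eventually_mono)
    have "zmean x (peak N) - ?I N \<le> (\<integral>y. a ^ N \<partial>(usm :: 'a measure))"
      unfolding eq
    proof (rule integral_mono_AE)
      show "integrable usm (\<lambda>y. poly (peak N) (x \<bullet> y) - indicator U y * poly (peak N) (x \<bullet> y))"
        using i integrable_zpoly[of "peak N" x] by auto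
    qed (use bnd in \<open>auto elim: eventually_mono\<close>)
    moreover have "measure (usm :: 'a measure) UNIV = 1" using usm.prob_space by simp
    ultimately have "zmean x (peak N) - ?I N \<le> a ^ N" by simp
    then have "\<bar>?I N - zmean x (peak N)\<bar> \<le> a ^ N" using nn by linarith
    then have "\<bar>?I N - zmean x (peak N)\<bar> / zmean x (peak N) \<le> a ^ N / (b ^ N * p)"
      using cN[of N] p ab by (intro frac_le) auto
    moreover have "?I N / zmean x (peak N) - 1 = (?I N - zmean x (peak N)) / zmean x (peak N)"
      using cN(2)[of N] by (simp add: diff_divide_distrib)
    ultimately show ?thesis using cN(2)[of N] by (simp add: abs_divide power_divide)
  qed
  moreover have "(\<lambda>N. (a / b) ^ N / p) \<longlonglongrightarrow> 0"
    using ab by (intro tendsto_divide_zero LIMSEQ_realpow_zero) auto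
  ultimately have "(\<lambda>N. ?I N / zmean x (peak N) - 1) \<longlonglongrightarrow> 0"
    by (rule Lim_null_comparison[OF always_eventually, OF allI])
  then show ?thesis by (rule LIM_zero_cancel)
qed

lemma zconv_poly_sum:
  assumes f: "integrable usm f"
  shows "zconv (cpoly (\<Sum>l\<in>A. p l)) f x = (\<Sum>l\<in>A. zconv (cpoly (p l)) f x)"
  using integrable_poly_mult[OF f]
  by (simp add: zconv_def poly_sum sum_distrib_right Bochner_Integration.integral_sum)

lemma quadratic_form_le:
  fixes f :: "'a::euclidean_space \<Rightarrow> complex"
  assumes d: "DIM('a) \<ge> 3" and e: "norm (e :: 'a) = 1" and f: "sq_integrable f"
    and p: "degree p \<le> N" and pos: "\<And>t. t \<in> {-1..1} \<Longrightarrow> poly p t \<ge> 0" and p1: "zmean e p \<le> 1"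
  shows "(\<integral>x. f x \<bullet> zconv (cpoly p) f x \<partial>usm) \<le> (\<Sum>l\<le>N. harm_energy l f)"
proof -
  define lam where "lam = gegenbauer_index TYPE('a)"
  have lam: "lam \<ge> 1 / 2" using gegenbauer_index_ge[OF d] by (simp add: lam_def)
  let ?G = "geg_poly lam"
  note fi = sq_integrable_integrable[OF f]
  define a where "a l = wmean lam (p * ?G l) / wmean lam (?G l * ?G l)" for l
  define \<kappa> where "\<kappa> l = a l * (lam / (real l + lam))" for l
  have "p = (\<Sum>l\<le>N. smult (a l) (?G l))"
    unfolding a_def by (rule geg_poly_expansion[OF lam p])
  also have "\<dots> = (\<Sum>l\<le>N. smult (\<kappa> l) (zpoly TYPE('a) l))"
    using lam by (simp add: zpoly_def lam_def[symmetric] \<kappa>_def)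
  finally have pe: "p = (\<Sum>l\<le>N. smult (\<kappa> l) (zpoly TYPE('a) l))" .
  have \<kappa>1: "\<kappa> l \<le> 1" for l
  proof -
    have G1: "poly (?G l) 1 \<ge> 1" by (rule geg_poly_at_1_ge_1[OF lam])
    have W: "wmean lam 1 > 0" by (rule wmean_pos[OF lam])
    have "zmean e (p * ?G l) \<le> zmean e (smult (poly (?G l) 1) p)"
      unfolding zmean_def
    proof (rule integral_mono_AE)
      show "AE y in usm. poly (p * ?G l) (e \<bullet> y) \<le> poly (smult (poly (?G l) 1) p) (e \<bullet> y)"
        using AE_usm
      proof eventually_elim
        case (elim y)
        have "poly p (e \<bullet> y) * poly (?G l) (e \<bullet> y) \<le> poly p (e \<bullet> y) * poly (?G l) 1"
          using pos[OF inner_unit[OF e elim]] geg_poly_bound[OF d inner_unit[OF e elim], of l]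
          by (intro mult_left_mono) (auto simp: lam_def)
        then show ?case by (simp add: mult.commute)
      qed
    qed (rule integrable_zpoly)+
    also have "\<dots> \<le> poly (?G l) 1"
      using p1 G1 by (simp add: zmean_smult mult_left_le)
    finally have "wmean lam (p * ?G l) / wmean lam 1 \<le> poly (?G l) 1"
      using zmean_eq_wmean[OF e d] by (simp add: lam_def)
    then have "lam * wmean lam (p * ?G l) \<le> lam * (poly (?G l) 1 * wmean lam 1)"
      using W lam by (simp add: pos_divide_le_eq)
    also have "\<dots> = (real l + lam) * wmean lam (?G l * ?G l)"
      using wmean_geg_poly_square[OF lam, of l] by simp
    finally have "lam * wmean lam (p * ?G l) \<le> (real l + lam) * wmean lam (?G l * ?G l)" .
    moreover have "(real l + lam) * wmean lam (?G l * ?G l) > 0"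
      using wmean_geg_poly_square_pos[OF lam, of l] lam by simp
    ultimately show ?thesis by (simp add: \<kappa>_def a_def mult.commute)
  qed
  have "(\<integral>x. f x \<bullet> zconv (cpoly p) f x \<partial>usm) = (\<integral>x. (\<Sum>l\<le>N. \<kappa> l * (f x \<bullet> harm_proj l f x)) \<partial>usm)"
  proof (rule Bochner_Integration.integral_cong[OF refl])
    fix x
    have "a \<bullet> (complex_of_real c * b) = c * (a \<bullet> b)" for a b c
      by (simp add: inner_complex_def algebra_simps)
    then show "f x \<bullet> zconv (cpoly p) f x = (\<Sum>l\<le>N. \<kappa> l * (f x \<bullet> harm_proj l f x))"
      unfolding harm_proj_def by (subst pe) (simp only: zconv_poly_sum[OF fi] zconv_smult inner_sum_right)
  qed
  also have "\<dots> = (\<Sum>l\<le>N. \<kappa> l * harm_energy l f)"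
    using integrable_inner_sq[OF f sq_integrable_harm[OF f]]
    by (subst Bochner_Integration.integral_sum) (auto simp: integral_inner_harm(2)[OF d f])
  also have "\<dots> \<le> (\<Sum>l\<le>N. harm_energy l f)"
    using mult_right_mono[OF \<kappa>1 harm_energy_nonneg] by (intro sum_mono) simp
  finally show ?thesis .
qed


text \<open>
  For \<open>f = 1\<^sub>U\<close> the quadratic form of the peak kernels converges to \<open>\<sigma>(U)\<close>, because
  the kernel averages tend to \<open>1\<close> at every point of \<open>U\<close>; the boundary of \<open>U\<close> plays no role.
\<close>

lemma harm_defect_open:
  fixes U :: "'a::euclidean_space set"
  assumes d: "DIM('a) \<ge> 3" and U: "open U"
  shows "(\<lambda>L. harm_defect L (\<lambda>x. of_bool (x \<in> U))) \<longlonglongrightarrow> 0"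
proof -
  have [measurable]: "U \<in> sets borel" using U by simp
  let ?f = "\<lambda>x. of_bool (x \<in> U) :: complex"
  obtain e :: 'a where "e \<in> Basis" using nonempty_Basis by blast
  then have e: "norm e = 1" by simp
  have f: "sq_integrable ?f" by (rule sq_integrable_bounded[where B=1]) auto
  have cpos: "zmean e (peak N) > 0" for N by (rule zmean_peak_pos[OF d e])
  define K where "K N = smult (1 / zmean e (peak N)) (peak N)" for N
  have Kpos: "poly (K N) t \<ge> 0" if "t \<in> {-1..1}" for N t
    using cpos[of N] that by (simp add: K_def poly_peak)
  have K1: "zmean x (K N) = 1" if "norm x = 1" for x :: 'a and N
    using integral_usm_zonal_cong[of x e "poly (K N)"] that e cpos[of N]
    by (simp add: zmean_def[symmetric] K_def zmean_smult)
  have Kdeg: "degree (K N) \<le> N" for N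
    unfolding K_def peak_def by (rule order_trans[OF degree_smult_le]) (simp add: degree_power_le[THEN order_trans])
  define I where "I N x = (\<integral>y. indicator U y * poly (K N) (x \<bullet> y) \<partial>usm)" for N and x :: 'a
  have [measurable]: "I N \<in> borel_measurable borel" for N
    unfolding I_def by measurable
  have ii: "integrable usm (\<lambda>y. indicator U y * poly (K N) (x \<bullet> y))" for N x
    using integrable_usm_bounded_scaleR[OF _ _ integrable_zpoly[of "K N" x], of "indicator U" 1]
    by (simp add: indicator_def)
  have I01: "0 \<le> I N x \<and> I N x \<le> 1" if x: "norm x = 1" for N x
  proof
    have ae: "AE y in usm. 0 \<le> poly (K N) (x \<bullet> y)"
      using AE_usm by eventually_elim (rule Kpos[OF inner_unit[OF x]])
    then show "0 \<le> I N x" unfolding I_def by (intro integral_nonneg_AE) (auto elim!: eventually_mono)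
    have "I N x \<le> zmean x (K N)"
      unfolding I_def zmean_def using ae
      by (intro integral_mono_AE ii integrable_zpoly) (auto elim!: eventually_mono simp: indicator_def)
    then show "I N x \<le> 1" using K1[OF x] by simp
  qed
  have quad: "(\<integral>x. indicator U x * I N x \<partial>usm) \<le> (\<Sum>l\<le>N. harm_energy l ?f)" for N
  proof -
    have "zconv (cpoly (K N)) ?f x = complex_of_real (I N x)" for x
    proof -
      have "zconv (cpoly (K N)) ?f x = (\<integral>y. complex_of_real (indicator U y * poly (K N) (x \<bullet> y)) \<partial>usm)"
        unfolding zconv_def by (rule Bochner_Integration.integral_cong) (auto simp: indicator_def)
      then show ?thesis unfolding I_def by (simp only: integral_complex_of_real)
    qed
    then have "(\<integral>x. ?f x \<bullet> zconv (cpoly (K N)) ?f x \<partial>usm) = (\<integral>x. indicator U x * I N x \<partial>usm)"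
      by (intro Bochner_Integration.integral_cong) (auto simp: indicator_def inner_complex_def)
    then show ?thesis
      using quadratic_form_le[OF d e f Kdeg Kpos, of N] K1[OF e] by simp
  qed
  have lim: "(\<lambda>N. \<integral>x. indicator U x * I N x \<partial>usm) \<longlonglongrightarrow> (\<integral>x. indicator U x \<partial>usm)"
  proof (rule integral_dominated_convergence[where w="\<lambda>_. 1"])
    show "AE x in usm. (\<lambda>N. indicator U x * I N x) \<longlonglongrightarrow> (indicator U x :: real)"
      using AE_usm
    proof eventually_elim
      case (elim x)
      show ?case
      proof (cases "x \<in> U")
        case True
        have "I N x = (\<integral>y. indicator U y * poly (peak N) (x \<bullet> y) \<partial>usm) / zmean x (peak N)" for N
        proof -
          have "zmean x (peak N) = zmean e (peak N)"
            using integral_usm_zonal_cong[of x e "poly (peak N)"] elim e by (simp add: zmean_def)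
          then show ?thesis by (simp add: I_def K_def)
        qed
        then show ?thesis using peak_limit[OF d elim U True] True by simp
      qed simp
    qed
    show "AE x in usm. norm (indicator U x * I N x) \<le> 1" for N
      using AE_usm by eventually_elim (use I01 in \<open>auto simp: indicator_def\<close>)
  qed auto
  let ?D = "\<lambda>N. (\<integral>x. indicator U x \<partial>usm) - (\<integral>x. indicator U x * I N x \<partial>usm)"
  have "norm (harm_defect N ?f) \<le> ?D N" for N
  proof -
    have "(\<integral>x. (norm (?f x))\<^sup>2 \<partial>usm) = (\<integral>x. indicator U x \<partial>usm)"
      by (intro Bochner_Integration.integral_cong) (auto simp: indicator_def)
    then have "harm_defect N ?f \<le> ?D N"
      using quad[of N] by (simp add: harm_defect_eq[OF d f])
    then show ?thesis by simp
  qed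
  moreover have "(\<lambda>N. ?D N) \<longlonglongrightarrow> 0"
    using tendsto_diff[OF tendsto_const[of "integral\<^sup>L usm (indicator U :: 'a \<Rightarrow> real)"] lim] by (simp only: diff_self)
  ultimately show ?thesis
    by (rule Lim_null_comparison[OF always_eventually, OF allI])
qed

lemma harm_defect_le:
  fixes f :: "'a::euclidean_space \<Rightarrow> complex"
  assumes d: "DIM('a) \<ge> 3" and f: "sq_integrable f"
  shows "harm_defect L f \<le> (\<integral>x. (norm (f x))\<^sup>2 \<partial>usm)"
  by (simp add: harm_defect_eq[OF d f] sum_nonneg)

lemma harm_defect_approx:
  fixes f :: "'a::euclidean_space \<Rightarrow> complex"
  assumes d: "DIM('a) \<ge> 3" and f: "sq_integrable f"
    and approx: "\<And>\<epsilon>. \<epsilon> > 0 \<Longrightarrow> \<exists>g. sq_integrable g \<and> (\<lambda>L. harm_defect L g) \<longlonglongrightarrow> 0 \<and> (\<integral>x. (norm (f x - g x))\<^sup>2 \<partial>usm) \<le> \<epsilon>"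
  shows "(\<lambda>L. harm_defect L f) \<longlonglongrightarrow> 0"
proof (rule LIMSEQ_I)
  fix r :: real assume r: "r > 0"
  then obtain g where g: "sq_integrable g" "(\<lambda>L. harm_defect L g) \<longlonglongrightarrow> 0" "(\<integral>x. (norm (f x - g x))\<^sup>2 \<partial>usm) \<le> r / 8"
    using approx[of "r / 8"] by auto
  obtain L0 where L0: "\<And>L. L \<ge> L0 \<Longrightarrow> harm_defect L g < r / 8"
    using LIMSEQ_D[OF g(2), of "r / 8"] r by auto
  have "harm_defect L f < r" if "L \<ge> L0" for L
  proof -
    have s: "sq_integrable (\<lambda>x. f x - g x)" by (rule sq_integrable_diff[OF f g(1)])
    have "harm_defect L f \<le> 2 * harm_defect L (\<lambda>x. f x - g x) + 2 * harm_defect L g"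
      using harm_defect_add[OF s g(1), of L] by simp
    then show ?thesis using L0[OF that] harm_defect_le[OF d s, of L] g(3) r by linarith
  qed
  then show "\<exists>no. \<forall>L\<ge>no. norm (harm_defect L f - 0) < r" by auto
qed

lemma harm_defect_sum:
  fixes f :: "'i \<Rightarrow> 'a::euclidean_space \<Rightarrow> complex"
  assumes "finite A" "\<And>i. i \<in> A \<Longrightarrow> sq_integrable (f i)" "\<And>i. i \<in> A \<Longrightarrow> (\<lambda>L. harm_defect L (f i)) \<longlonglongrightarrow> 0"
  shows "(\<lambda>L. harm_defect L (\<lambda>x. \<Sum>i\<in>A. f i x)) \<longlonglongrightarrow> 0"
  using assms
proof (induction A rule: finite_induct)
  case empty
  have "harm_defect L (\<lambda>x::'a. 0) = 0" for L
    using harm_defect_scale[of L 0 "\<lambda>x. 0"] by simp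
  then show ?case by simp
next
  case (insert i A)
  have "norm (harm_defect L (\<lambda>x. f i x + (\<Sum>i\<in>A. f i x))) \<le> 2 * harm_defect L (f i) + 2 * harm_defect L (\<lambda>x. \<Sum>i\<in>A. f i x)" for L
    using harm_defect_add[of "f i" "\<lambda>x. \<Sum>i\<in>A. f i x" L] insert.prems by (auto intro!: sq_integrable_sum)
  moreover have "(\<lambda>L. 2 * harm_defect L (f i) + 2 * harm_defect L (\<lambda>x. \<Sum>i\<in>A. f i x)) \<longlonglongrightarrow> 0"
    using insert by (auto intro!: tendsto_eq_intros)
  ultimately have "(\<lambda>L. harm_defect L (\<lambda>x. f i x + (\<Sum>i\<in>A. f i x))) \<longlonglongrightarrow> 0"
    by (rule Lim_null_comparison[OF always_eventually, OF allI])
  then show ?case using insert by simp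
qed

lemma harm_defect_set:
  fixes B :: "'a::euclidean_space set"
  assumes d: "DIM('a) \<ge> 3" and B [measurable]: "B \<in> sets borel"
  shows "(\<lambda>L. harm_defect L (\<lambda>x. of_bool (x \<in> B))) \<longlonglongrightarrow> 0"
proof (rule harm_defect_approx[OF d])
  show "sq_integrable (\<lambda>x. of_bool (x \<in> B) :: complex)"
    by (rule sq_integrable_bounded[where B=1]) auto
  fix \<epsilon> :: real assume \<epsilon>: "\<epsilon> > 0"
  have "emeasure usm B < emeasure usm B + ennreal \<epsilon>"
    using \<epsilon> by (simp add: usm.emeasure_eq_measure ennreal_less_iff flip: ennreal_plus)
  then have "(INF U\<in>{U. B \<subseteq> U \<and> open U}. emeasure usm U) < emeasure usm B + ennreal \<epsilon>"
    using outer_regular[of usm B] by simp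
  then obtain U where U: "B \<subseteq> U" "open U" "emeasure usm U < emeasure usm B + ennreal \<epsilon>"
    by (auto simp: INF_less_iff)
  have [measurable]: "U \<in> sets borel" using U by simp
  have mU: "measure usm U < measure usm B + \<epsilon>"
    using U(3) \<epsilon> by (simp add: usm.emeasure_eq_measure ennreal_less_iff flip: ennreal_plus)
  have "(\<integral>x. (norm (of_bool (x \<in> B) - of_bool (x \<in> U) :: complex))\<^sup>2 \<partial>usm) = (\<integral>x. indicator (U - B) x \<partial>usm)"
    using U(1) by (intro Bochner_Integration.integral_cong) (auto simp: indicator_def)
  also have "\<dots> = measure usm U - measure usm B"
    using U(1) by (simp add: usm.finite_measure_Diff)
  finally have "(\<integral>x. (norm (of_bool (x \<in> B) - of_bool (x \<in> U) :: complex))\<^sup>2 \<partial>usm) \<le> \<epsilon>"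
    using mU by simp
  moreover have "sq_integrable (\<lambda>x. of_bool (x \<in> U) :: complex)"
    by (rule sq_integrable_bounded[where B=1]) auto
  ultimately show "\<exists>g. sq_integrable g \<and> (\<lambda>L. harm_defect L g) \<longlonglongrightarrow> 0 \<and>
      (\<integral>x. (norm (of_bool (x \<in> B) - g x))\<^sup>2 \<partial>usm) \<le> \<epsilon>"
    using harm_defect_open[OF d U(2)] by blast
qed

theorem harm_defect_tendsto_0:
  fixes f :: "'a::euclidean_space \<Rightarrow> complex"
  assumes d: "DIM('a) \<ge> 3" and f: "sq_integrable f"
  shows "(\<lambda>L. harm_defect L f) \<longlonglongrightarrow> 0"
proof (rule harm_defect_approx[OF d f])
  fix \<epsilon> :: real assume \<epsilon>: "\<epsilon> > 0"
  have fm [measurable]: "f \<in> borel_measurable borel" by (rule sq_integrable_measurable[OF f])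
  from borel_measurable_implies_sequence_metric[OF fm, of 0]
  obtain s where s: "\<And>i. simple_function borel (s i)" "\<And>x. (\<lambda>i. s i x) \<longlonglongrightarrow> f x"
    "\<And>i x. norm (s i x) \<le> 2 * norm (f x)"
    by (auto simp: dist_norm)
  have sm [measurable]: "s i \<in> borel_measurable borel" for i by (rule borel_measurable_simple_function[OF s(1)])
  have "(\<lambda>i. \<integral>x. (norm (f x - s i x))\<^sup>2 \<partial>usm) \<longlonglongrightarrow> integral\<^sup>L usm (\<lambda>x::'a. 0)"
  proof (rule integral_dominated_convergence[where w="\<lambda>x. 9 * (norm (f x))\<^sup>2"])
    show "integrable usm (\<lambda>x. 9 * (norm (f x))\<^sup>2)" using sq_integrable_norm_sq[OF f] by simp
    show "AE x in usm. (\<lambda>i. (norm (f x - s i x))\<^sup>2) \<longlonglongrightarrow> 0"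
    proof (rule AE_I2)
      fix x
      have "(\<lambda>i. (norm (f x - s i x))\<^sup>2) \<longlonglongrightarrow> (norm (f x - f x))\<^sup>2"
        by (intro tendsto_intros s(2))
      then show "(\<lambda>i. (norm (f x - s i x))\<^sup>2) \<longlonglongrightarrow> 0" by simp
    qed
    show "AE x in usm. norm ((norm (f x - s i x))\<^sup>2) \<le> 9 * (norm (f x))\<^sup>2" for i
    proof (rule AE_I2)
      fix x
      have "norm (f x - s i x) \<le> 3 * norm (f x)"
        using s(3)[of i x] norm_triangle_ineq4[of "f x" "s i x"] by linarith
      then have "(norm (f x - s i x))\<^sup>2 \<le> (3 * norm (f x))\<^sup>2" by (intro power_mono) auto
      then show "norm ((norm (f x - s i x))\<^sup>2) \<le> 9 * (norm (f x))\<^sup>2" by (simp add: power_mult_distrib)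
    qed
  qed auto
  then have "(\<lambda>i. \<integral>x. (norm (f x - s i x))\<^sup>2 \<partial>usm) \<longlonglongrightarrow> 0" by simp
  then have "eventually (\<lambda>i. (\<integral>x. (norm (f x - s i x))\<^sup>2 \<partial>usm) < \<epsilon>) sequentially"
    using \<epsilon> by (rule order_tendstoD(2))
  then obtain i where i: "(\<integral>x. (norm (f x - s i x))\<^sup>2 \<partial>usm) \<le> \<epsilon>"
    by (auto simp: eventually_sequentially intro: less_imp_le)
  have fin: "finite (range (s i))" using simple_functionD(1)[OF s(1)] by simp
  have vm [measurable]: "s i -` {c} \<in> sets borel" for c
    using measurable_sets[OF sm, of "{c}" i] by simp
  have rep: "s i = (\<lambda>x. \<Sum>c\<in>range (s i). c * of_bool (x \<in> s i -` {c}))"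
  proof
    fix x
    have "(\<Sum>c\<in>range (s i). c * of_bool (x \<in> s i -` {c})) = (\<Sum>c\<in>{s i x}. c * of_bool (x \<in> s i -` {c}))"
      using fin by (intro sum.mono_neutral_right) auto
    then show "s i x = (\<Sum>c\<in>range (s i). c * of_bool (x \<in> s i -` {c}))" by simp
  qed
  have sq: "sq_integrable (\<lambda>x. c * of_bool (x \<in> s i -` {c}))" for c
    by (intro sq_integrable_scale sq_integrable_bounded[where B=1]) auto
  have dc: "(\<lambda>L. harm_defect L (\<lambda>x. c * of_bool (x \<in> s i -` {c}))) \<longlonglongrightarrow> 0" for c
    unfolding harm_defect_scale using tendsto_mult_left[OF harm_defect_set[OF d vm], of "(norm c)\<^sup>2" c] by simp
  have "sq_integrable (s i)"
    using sq_integrable_sum[of "range (s i)" "\<lambda>c x. c * of_bool (x \<in> s i -` {c})", OF sq] by (fold rep)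
  moreover have "(\<lambda>L. harm_defect L (s i)) \<longlonglongrightarrow> 0"
    using harm_defect_sum[of "range (s i)" "\<lambda>c x. c * of_bool (x \<in> s i -` {c})", OF fin sq dc] by (fold rep)
  ultimately show "\<exists>g. sq_integrable g \<and> (\<lambda>L. harm_defect L g) \<longlonglongrightarrow> 0 \<and> (\<integral>x. (norm (f x - g x))\<^sup>2 \<partial>usm) \<le> \<epsilon>"
    using i by blast
qed

theorem parseval_sphere:
  fixes f :: "'a::euclidean_space \<Rightarrow> complex"
  assumes d: "DIM('a) \<ge> 3" and f: "sq_integrable f"
  shows "(\<lambda>l. harm_energy l f) sums (\<integral>x. (norm (f x))\<^sup>2 \<partial>usm)"
proof -
  have "(\<lambda>L. (\<integral>x. (norm (f x))\<^sup>2 \<partial>usm) - harm_defect L f) \<longlonglongrightarrow> (\<integral>x. (norm (f x))\<^sup>2 \<partial>usm) - 0"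
    by (intro tendsto_intros harm_defect_tendsto_0[OF d f])
  then have "(\<lambda>L. \<Sum>l\<le>L. harm_energy l f) \<longlonglongrightarrow> (\<integral>x. (norm (f x))\<^sup>2 \<partial>usm)"
    by (simp add: harm_defect_eq[OF d f])
  then show ?thesis by (simp add: sums_def_le)
qed

section \<open>Multipliers\<close>

lemma zconv_norm_sq_le:
  fixes f :: "'a::euclidean_space \<Rightarrow> complex"
  assumes [measurable]: "h \<in> borel_measurable borel" "f \<in> borel_measurable borel"
  shows "ennreal ((norm (zconv h f x))\<^sup>2) \<le>
    (\<integral>\<^sup>+y. ennreal (norm (h (x \<bullet> y))) \<partial>usm) * (\<integral>\<^sup>+y. ennreal (norm (h (x \<bullet> y))) * ennreal ((norm (f y))\<^sup>2) \<partial>usm)"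
proof -
  let ?A = "\<lambda>y. ennreal (sqrt (norm (h (x \<bullet> y))))"
  let ?B = "\<lambda>y. ennreal (sqrt (norm (h (x \<bullet> y))) * norm (f y))"
  have "ennreal (norm (zconv h f x)) \<le> (\<integral>\<^sup>+y. ennreal (norm (h (x \<bullet> y) * f y)) \<partial>usm)"
  proof (cases "integrable usm (\<lambda>y. h (x \<bullet> y) * f y)")
    case True
    then show ?thesis unfolding zconv_def by (rule integral_norm_bound_ennreal)
  qed (simp add: zconv_def not_integrable_integral_eq)
  also have "\<dots> = (\<integral>\<^sup>+y. ?A y * ?B y \<partial>usm)"
    by (intro nn_integral_cong) (simp add: norm_mult flip: ennreal_mult mult.assoc)
  finally have "ennreal (norm (zconv h f x)) ^ 2 \<le> (\<integral>\<^sup>+y. ?A y * ?B y \<partial>usm)\<^sup>2"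
    by (intro power_mono) auto
  also have "\<dots> \<le> (\<integral>\<^sup>+y. ?A y ^ 2 \<partial>usm) * (\<integral>\<^sup>+y. ?B y ^ 2 \<partial>usm)"
    by (rule Cauchy_Schwarz_nn_integral) measurable
  also have "(\<integral>\<^sup>+y. ?A y ^ 2 \<partial>usm) = (\<integral>\<^sup>+y. ennreal (norm (h (x \<bullet> y))) \<partial>usm)"
    by (simp add: ennreal_power)
  also have "(\<integral>\<^sup>+y. ?B y ^ 2 \<partial>usm) = (\<integral>\<^sup>+y. ennreal (norm (h (x \<bullet> y))) * ennreal ((norm (f y))\<^sup>2) \<partial>usm)"
    by (simp add: ennreal_power power_mult_distrib flip: ennreal_mult)
  finally show ?thesis by (simp add: ennreal_power)
qed

lemma nn_integral_usm_zonal_cong: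
  fixes x y :: "'a::euclidean_space"
  assumes n: "norm x = norm y" and [measurable]: "F \<in> borel_measurable borel"
  shows "(\<integral>\<^sup>+z. F (x \<bullet> z) \<partial>usm) = (\<integral>\<^sup>+z. F (y \<bullet> z) \<partial>usm)"
proof -
  have "(\<integral>\<^sup>+z. F (x \<bullet> z) \<partial>usm) = (\<integral>\<^sup>+z. F (x \<bullet> reflection (x - y) z) \<partial>usm)"
    by (rule nn_integral_usm_rot[OF reflection_orthogonal, symmetric]) measurable
  also have "\<dots> = (\<integral>\<^sup>+z. F (y \<bullet> z) \<partial>usm)"
    by (simp only: reflection_inner[symmetric] reflection_swaps[OF n])
  finally show ?thesis .
qed

lemma sq_integrable_zconv:
  fixes f :: "'a::euclidean_space \<Rightarrow> complex"
  assumes e: "norm (e :: 'a) = 1" and h: "h \<in> borel_measurable borel" "integrable usm (\<lambda>y. h (e \<bullet> y))"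
    and f: "sq_integrable f"
  shows "sq_integrable (zconv h f)"
  unfolding sq_integrable_def
proof
  note [measurable] = h(1) sq_integrable_measurable[OF f]
  show "zconv h f \<in> borel_measurable borel" by measurable
  define H where "H = (\<integral>\<^sup>+y. ennreal (norm (h (e \<bullet> y))) \<partial>usm)"
  have H: "(\<integral>\<^sup>+y. ennreal (norm (h (x \<bullet> y))) \<partial>usm) = H" if "norm x = 1" for x :: 'a
    unfolding H_def using e that by (intro nn_integral_usm_zonal_cong) auto
  have Hfin: "H < \<infinity>" using h(2) unfolding H_def integrable_iff_bounded by simp
  have "(\<integral>\<^sup>+x. ennreal (norm ((norm (zconv h f x))\<^sup>2)) \<partial>usm)
      \<le> (\<integral>\<^sup>+x. H * (\<integral>\<^sup>+y. ennreal (norm (h (x \<bullet> y))) * ennreal ((norm (f y))\<^sup>2) \<partial>usm) \<partial>usm)"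
  proof (rule nn_integral_mono_AE)
    show "AE x in usm. ennreal (norm ((norm (zconv h f x))\<^sup>2))
        \<le> H * (\<integral>\<^sup>+y. ennreal (norm (h (x \<bullet> y))) * ennreal ((norm (f y))\<^sup>2) \<partial>usm)"
      using AE_usm
    proof eventually_elim
      case (elim x)
      then show ?case using zconv_norm_sq_le[of h f x] H[OF elim] by simp
    qed
  qed
  also have "\<dots> = H * (\<integral>\<^sup>+x. (\<integral>\<^sup>+y. ennreal (norm (h (x \<bullet> y))) * ennreal ((norm (f y))\<^sup>2) \<partial>usm) \<partial>usm)"
    by (rule nn_integral_cmult) measurable
  also have "(\<integral>\<^sup>+x. (\<integral>\<^sup>+y. ennreal (norm (h (x \<bullet> y))) * ennreal ((norm (f y))\<^sup>2) \<partial>usm) \<partial>usm)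
      = (\<integral>\<^sup>+y. (\<integral>\<^sup>+x. ennreal (norm (h (x \<bullet> y))) * ennreal ((norm (f y))\<^sup>2) \<partial>usm) \<partial>usm)"
    by (rule usm2.Fubini'[symmetric]) measurable
  also have "\<dots> = (\<integral>\<^sup>+y. H * ennreal ((norm (f y))\<^sup>2) \<partial>usm)"
  proof (rule nn_integral_cong_AE)
    show "AE y in usm. (\<integral>\<^sup>+x. ennreal (norm (h (x \<bullet> y))) * ennreal ((norm (f y))\<^sup>2) \<partial>usm) = H * ennreal ((norm (f y))\<^sup>2)"
      using AE_usm
    proof eventually_elim
      case (elim y)
      then show ?case using H[OF elim] by (simp add: nn_integral_multc inner_commute[of _ y])
    qed
  qed
  also have "\<dots> = H * (\<integral>\<^sup>+y. ennreal ((norm (f y))\<^sup>2) \<partial>usm)"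
    by (rule nn_integral_cmult) measurable
  also have "H * (H * (\<integral>\<^sup>+y. ennreal ((norm (f y))\<^sup>2) \<partial>usm)) < \<infinity>"
    using sq_integrable_norm_sq[OF f] Hfin by (auto simp: integrable_iff_bounded ennreal_mult_less_top)
  finally show "integrable usm (\<lambda>x. (norm (zconv h f x))\<^sup>2)"
    by (intro integrableI_bounded) auto
qed

theorem zconv_energy_sums:
  fixes f :: "'a::euclidean_space \<Rightarrow> complex"
  assumes d: "DIM('a) \<ge> 3" and e: "norm (e :: 'a) = 1"
    and h: "h \<in> borel_measurable borel" "integrable usm (\<lambda>y. h (e \<bullet> y))" and f: "sq_integrable f"
  shows "(\<lambda>l. (norm (zmult e h l))\<^sup>2 * harm_energy l f) sums (\<integral>x. (norm (zconv h f x))\<^sup>2 \<partial>usm)"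
proof -
  note fi = sq_integrable_integrable[OF f] sq_integrable_measurable[OF f]
  note [measurable] = h(1) fi(2)
  have "harm_energy l (zconv h f) = (norm (zmult e h l))\<^sup>2 * harm_energy l f" for l
  proof -
    have "harm_energy l (zconv h f) = (\<integral>x. (norm (zmult e h l))\<^sup>2 * (norm (harm_proj l f x))\<^sup>2 \<partial>usm)"
      unfolding harm_energy_def
    proof (rule integral_cong_AE)
      show "AE x in usm. (norm (harm_proj l (zconv h f) x))\<^sup>2 = (norm (zmult e h l))\<^sup>2 * (norm (harm_proj l f x))\<^sup>2"
        using AE_usm
        by eventually_elim (simp add: zconv_poly_zconv[OF d e h fi] norm_mult power_mult_distrib)
    qed measurable
    then show ?thesis by (simp add: harm_energy_def)
  qed
  then show ?thesis
    using parseval_sphere[OF d sq_integrable_zconv[OF e h f]] by simp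
qed

lemma
  fixes e :: "'a::euclidean_space" and F :: "real \<Rightarrow> 'b::{banach, second_countable_topology}"
  assumes e: "norm e = 1" and d: "DIM('a) \<ge> 3" and [measurable]: "F \<in> borel_measurable borel"
  defines "lam \<equiv> gegenbauer_index TYPE('a)"
  shows integral_zonal: "(\<integral>y. F (e \<bullet> y) \<partial>usm) =
      (LBINT t:{-1..1}. gegenbauer_weight lam t *\<^sub>R F t) /\<^sub>R wmean lam 1"
    and integrable_zonal: "integrable usm (\<lambda>y. F (e \<bullet> y)) \<longleftrightarrow>
      set_integrable lborel {-1..1} (\<lambda>t. gegenbauer_weight lam t *\<^sub>R F t)"
proof -
  have lam: "lam \<ge> 1 / 2" using gegenbauer_index_ge[OF d] by (simp add: lam_def)
  have W: "wmean lam 1 > 0" by (rule wmean_pos[OF lam])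
  let ?w = "\<lambda>t. indicator {-1..1} t * gegenbauer_weight lam t / wmean lam 1"
  have m: "(\<lambda>x. e \<bullet> x) \<in> measurable usm borel" by measurable
  have eq: "?w t *\<^sub>R F t = (indicator {-1..1} t *\<^sub>R (gegenbauer_weight lam t *\<^sub>R F t)) /\<^sub>R wmean lam 1" for t
    by (simp add: field_simps)
  have "(\<integral>y. F (e \<bullet> y) \<partial>usm) = (\<integral>t. F t \<partial>distr usm borel (\<lambda>x. e \<bullet> x))"
    by (subst integral_distr[OF m]) auto
  also have "\<dots> = (\<integral>t. ?w t *\<^sub>R F t \<partial>lborel)"
    unfolding distr_usm_inner[OF e d] lam_def[symmetric] using W by (subst integral_density) auto
  also have "\<dots> = (LBINT t:{-1..1}. gegenbauer_weight lam t *\<^sub>R F t) /\<^sub>R wmean lam 1"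
    unfolding eq set_lebesgue_integral_def by (rule integral_scaleR_right)
  finally show "(\<integral>y. F (e \<bullet> y) \<partial>usm) = (LBINT t:{-1..1}. gegenbauer_weight lam t *\<^sub>R F t) /\<^sub>R wmean lam 1" .
  have "integrable usm (\<lambda>y. F (e \<bullet> y)) \<longleftrightarrow> integrable (distr usm borel (\<lambda>x. e \<bullet> x)) F"
    by (subst integrable_distr_eq[OF m]) auto
  also have "\<dots> \<longleftrightarrow> integrable lborel (\<lambda>t. ?w t *\<^sub>R F t)"
    unfolding distr_usm_inner[OF e d] lam_def[symmetric] using W by (subst integrable_density) auto
  also have "\<dots> \<longleftrightarrow> set_integrable lborel {-1..1} (\<lambda>t. gegenbauer_weight lam t *\<^sub>R F t)"
    unfolding eq set_integrable_def using W by (intro integrable_scaleR_iff) simp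
  finally show "integrable usm (\<lambda>y. F (e \<bullet> y)) \<longleftrightarrow>
      set_integrable lborel {-1..1} (\<lambda>t. gegenbauer_weight lam t *\<^sub>R F t)" .
qed

definition clip :: "(real \<Rightarrow> complex) \<Rightarrow> real \<Rightarrow> complex" where
  "clip h t = (if t \<in> {-1..1} then h t else 0)"

lemma clip_inner: "norm x = 1 \<Longrightarrow> norm y = 1 \<Longrightarrow> clip h (x \<bullet> y) = h (x \<bullet> (y::'a::euclidean_space))"
  using inner_unit[of x y] by (simp add: clip_def)

lemma clip_measurable:
  fixes e :: "'a::euclidean_space"
  assumes d: "DIM('a) \<ge> 2" and e: "norm e = 1" and m: "zonal e h \<in> borel_measurable sphere_measure"
  shows "clip h \<in> borel_measurable borel"
proof -
  obtain u :: 'a where u: "norm u = 1" "e \<bullet> u = 0" using obtain_orthogonal_unit[OF d] by blast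
  define X where "X t = t *\<^sub>R e + sqrt (1 - t\<^sup>2) *\<^sub>R u" for t
  define F where "F x = indicator (sphere 0 1) x *\<^sub>R zonal e h x" for x
  have [measurable]: "F \<in> borel_measurable borel"
    unfolding F_def by (rule borel_measurable_sphere_ext[OF m])
  have [measurable]: "X \<in> borel_measurable borel"
    unfolding X_def by (intro borel_measurable_continuous_onI continuous_intros)
  have "clip h t = indicator {-1..1} t *\<^sub>R F (X t)" for t
    using unit_vector_with_inner[OF e u, of t]
    by (auto simp: clip_def F_def X_def[symmetric] zonal_def indicator_def)
  moreover have "(\<lambda>t. indicator {-1..1} t *\<^sub>R F (X t)) \<in> borel_measurable borel" by measurable
  ultimately show ?thesis by (simp cong: measurable_cong)
qed

lemma gegenbauer_coeff_clip: "gegenbauer_coeff lam (clip h) l = gegenbauer_coeff lam h l"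
  unfolding gegenbauer_coeff_def set_lebesgue_integral_def
  by (intro arg_cong2[where f="(/)"] refl Bochner_Integration.integral_cong) (auto simp: clip_def indicator_def)

lemma gegenbauer_coeff_zmult:
  fixes e :: "'a::euclidean_space"
  assumes e: "norm e = 1" and d: "DIM('a) \<ge> 3" and [measurable]: "h \<in> borel_measurable borel"
  defines "lam \<equiv> gegenbauer_index TYPE('a)"
  shows "gegenbauer_coeff lam h l = complex_of_real ((real l + lam) / lam) * zmult e h l"
proof -
  have lam: "lam \<ge> 1 / 2" using gegenbauer_index_ge[OF d] by (simp add: lam_def)
  let ?G = "geg_poly lam l"
  have W: "wmean lam 1 > 0" and G1: "poly ?G 1 \<ge> 1" and GG: "wmean lam (?G * ?G) > 0"
    by (rule wmean_pos[OF lam] geg_poly_at_1_ge_1[OF lam] wmean_geg_poly_square_pos[OF lam])+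
  define N where "N = (LBINT t:{-1..1}. h t * complex_of_real (gegenbauer lam l t * gegenbauer_weight lam t))"
  have "(LBINT t:{-1..1}. gegenbauer_weight lam t *\<^sub>R (poly ?G t *\<^sub>R h t)) = N"
    unfolding N_def by (simp add: poly_geg_poly scaleR_conv_of_real mult_ac)
  then have z: "zmult e h l = N /\<^sub>R wmean lam 1 /\<^sub>R poly ?G 1"
    using integral_zonal[OF e d, of "\<lambda>t. poly ?G t *\<^sub>R h t"] by (simp add: zmult_def lam_def[symmetric])
  have "(LBINT t:{-1..1}. (gegenbauer lam l t)\<^sup>2 * gegenbauer_weight lam t) = wmean lam (?G * ?G)"
    by (simp add: wmean_def poly_geg_poly power2_eq_square)
  then have "gegenbauer_coeff lam h l = N / complex_of_real (wmean lam (?G * ?G))"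
    by (simp add: gegenbauer_coeff_def N_def)
  also have "wmean lam (?G * ?G) = lam / (real l + lam) * (poly ?G 1 * wmean lam 1)"
    using wmean_geg_poly_square[OF lam, of l] lam by (simp add: eq_divide_eq mult_ac)
  also have "N / complex_of_real \<dots> = complex_of_real ((real l + lam) / lam) * zmult e h l"
    by (simp add: z scaleR_conv_of_real divide_inverse mult_ac)
  finally show ?thesis .
qed

lemma zmult_bound:
  fixes e :: "'a::euclidean_space" and h :: "real \<Rightarrow> complex"
  assumes e: "norm e = 1" and d: "DIM('a) \<ge> 3" and h: "integrable usm (\<lambda>y. h (e \<bullet> y))"
  shows "norm (zmult e h l) \<le> (\<integral>y. \<bar>poly (sgeg TYPE('a) l) (e \<bullet> y) / poly (sgeg TYPE('a) l) 1\<bar> * norm (h (e \<bullet> y)) \<partial>usm)"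
proof -
  let ?G = "sgeg TYPE('a) l"
  have G1: "poly ?G 1 \<ge> 1" by (rule geg_poly_at_1_ge_1[OF gegenbauer_index_ge[OF d]])
  have "zmult e h l = (\<integral>y. (poly ?G (e \<bullet> y) / poly ?G 1) *\<^sub>R h (e \<bullet> y) \<partial>usm)"
    by (simp add: zmult_def divide_inverse_commute flip: scaleR_scaleR integral_scaleR_right)
  then have "norm (zmult e h l) \<le> (\<integral>y. norm ((poly ?G (e \<bullet> y) / poly ?G 1) *\<^sub>R h (e \<bullet> y)) \<partial>usm)"
    by (simp only: integral_norm_bound)
  then show ?thesis by simp
qed

theorem zmult_tendsto_0:
  fixes e :: "'a::euclidean_space" and h :: "real \<Rightarrow> complex"
  assumes e: "norm e = 1" and d: "DIM('a) \<ge> 3" and hm [measurable]: "h \<in> borel_measurable borel"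
    and h: "integrable usm (\<lambda>y. h (e \<bullet> y))"
  shows "zmult e h \<longlonglongrightarrow> 0"
proof (rule LIMSEQ_I)
  fix r :: real assume r: "r > 0"
  define lam where "lam = gegenbauer_index TYPE('a)"
  have lam: "lam \<ge> 1 / 2" using gegenbauer_index_ge[OF d] by (simp add: lam_def)
  define tr where "tr M t = (if norm (h t) \<le> real M then h t else 0)" for M :: nat and t
  have [measurable]: "tr M \<in> borel_measurable borel" for M unfolding tr_def by measurable
  define rem where "rem M t = h t - tr M t" for M t
  have [measurable]: "rem M \<in> borel_measurable borel" for M unfolding rem_def by measurable
  have tri: "integrable usm (\<lambda>y. tr M (e \<bullet> y))" for M
    by (rule integrable_usm_bounded[where B="real M"]) (auto simp: tr_def)
  have remi: "integrable usm (\<lambda>y. rem M (e \<bullet> y))" for M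
    using h tri by (simp add: rem_def)
  have "(\<lambda>M. \<integral>y. norm (rem M (e \<bullet> y)) \<partial>usm) \<longlonglongrightarrow> integral\<^sup>L usm (\<lambda>y::'a. 0)"
  proof (rule integral_dominated_convergence[where w="\<lambda>y. norm (h (e \<bullet> y))"])
    show "AE y in usm. (\<lambda>M. norm (rem M (e \<bullet> y))) \<longlonglongrightarrow> 0"
    proof (rule AE_I2)
      fix y
      obtain M0 where "norm (h (e \<bullet> y)) \<le> real M0" using real_arch_simple by blast
      then have "norm (rem M (e \<bullet> y)) = 0" if "M \<ge> M0" for M
        using that by (auto simp: rem_def tr_def)
      then show "(\<lambda>M. norm (rem M (e \<bullet> y))) \<longlonglongrightarrow> 0"
        by (intro tendsto_eventually) (auto intro: eventually_sequentiallyI)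
    qed
  qed (use h in \<open>auto simp: rem_def tr_def\<close>)
  then have "(\<lambda>M. \<integral>y. norm (rem M (e \<bullet> y)) \<partial>usm) \<longlonglongrightarrow> 0" by simp
  moreover have "r / 2 > 0" using r by simp
  ultimately have "eventually (\<lambda>M. (\<integral>y. norm (rem M (e \<bullet> y)) \<partial>usm) < r / 2) sequentially"
    by (rule order_tendstoD(2))
  then obtain M where M: "(\<integral>y. norm (rem M (e \<bullet> y)) \<partial>usm) < r / 2"
    by (auto simp: eventually_sequentially)
  define \<eta> where "\<eta> = r / (4 * (real M + 1))"
  have \<eta>: "\<eta> > 0" using r by (simp add: \<eta>_def)
  have young: "v \<le> \<eta> + v\<^sup>2 / \<eta>" if "v \<ge> 0" for v
  proof (cases "v \<le> \<eta>")
    case True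
    then show ?thesis using \<eta> by (simp add: add_increasing2)
  next
    case False
    then have "v * \<eta> \<le> v\<^sup>2" using that by (simp add: power2_eq_square mult_left_mono)
    then have "v \<le> v\<^sup>2 / \<eta>" using \<eta> by (simp add: le_divide_eq)
    then show ?thesis using \<eta> by linarith
  qed
  have "norm (zmult e h l) \<le> real M * (\<eta> + lam / (real l + lam) / \<eta>) + (\<integral>y. norm (rem M (e \<bullet> y)) \<partial>usm)" for l
  proof -
    let ?G = "geg_poly lam l"
    let ?u = "\<lambda>y. \<bar>poly ?G (e \<bullet> y) / poly ?G 1\<bar>"
    have G1: "poly ?G 1 \<ge> 1" by (rule geg_poly_at_1_ge_1[OF lam])
    have u1: "?u y \<le> 1" if "norm y = 1" for y
      using geg_poly_bound[OF d inner_unit[OF e that], of l] G1 by (simp add: lam_def abs_divide)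
    have ui: "integrable usm (\<lambda>y. (?u y)\<^sup>2)"
      by (intro integrable_usm_continuous continuous_intros) (use G1 in auto)
    have uh: "integrable usm (\<lambda>y. ?u y * norm (k (e \<bullet> y)))" if "integrable usm (\<lambda>y. k (e \<bullet> y))" for k :: "real \<Rightarrow> complex"
      using integrable_usm_bounded_scaleR[OF _ _ integrable_norm[OF that], of ?u 1] u1 by simp
    have iu: "(\<integral>y. (?u y)\<^sup>2 \<partial>usm) \<le> lam / (real l + lam)"
    proof -
      have W: "wmean lam 1 > 0" by (rule wmean_pos[OF lam])
      have "(\<integral>y. (?u y)\<^sup>2 \<partial>usm) = zmean e (?G * ?G) / (poly ?G 1)\<^sup>2"
        by (simp add: zmean_def power_divide power2_eq_square)
      also have "\<dots> = wmean lam (?G * ?G) / wmean lam 1 / (poly ?G 1)\<^sup>2"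
        using zmean_eq_wmean[OF e d] by (simp add: lam_def)
      also have "wmean lam (?G * ?G) = lam / (real l + lam) * (poly ?G 1 * wmean lam 1)"
        using wmean_geg_poly_square[OF lam, of l] lam by (simp add: eq_divide_eq mult_ac)
      also have "lam / (real l + lam) * (poly ?G 1 * wmean lam 1) / wmean lam 1 / (poly ?G 1)\<^sup>2 = lam / (real l + lam) / poly ?G 1"
        using W G1 by (simp add: power2_eq_square)
      also have "\<dots> \<le> lam / (real l + lam)"
        using G1 lam by (simp add: divide_le_eq mult_le_cancel_left1)
      finally show ?thesis .
    qed
    have "norm (zmult e h l) \<le> (\<integral>y. ?u y * norm (h (e \<bullet> y)) \<partial>usm)"
      using zmult_bound[OF e d h, of l] by (simp add: lam_def)
    also have "\<dots> \<le> (\<integral>y. real M * (\<eta> + (?u y)\<^sup>2 / \<eta>) + norm (rem M (e \<bullet> y)) \<partial>usm)"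
    proof (rule integral_mono_AE)
      show "AE y in usm. ?u y * norm (h (e \<bullet> y)) \<le> real M * (\<eta> + (?u y)\<^sup>2 / \<eta>) + norm (rem M (e \<bullet> y))"
        using AE_usm
      proof eventually_elim
        case (elim y)
        have "?u y \<le> \<eta> + (?u y)\<^sup>2 / \<eta>" by (rule young) simp
        moreover have "norm (tr M (e \<bullet> y)) \<le> real M" by (simp add: tr_def)
        ultimately have "?u y * norm (tr M (e \<bullet> y)) \<le> (\<eta> + (?u y)\<^sup>2 / \<eta>) * real M"
          using \<eta> by (intro mult_mono) auto
        moreover have "?u y * norm (rem M (e \<bullet> y)) \<le> 1 * norm (rem M (e \<bullet> y))"
          using u1[OF elim] by (intro mult_right_mono) auto
        moreover have "?u y * norm (h (e \<bullet> y)) \<le> ?u y * norm (tr M (e \<bullet> y)) + ?u y * norm (rem M (e \<bullet> y))"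
          unfolding distrib_left[symmetric]
          using norm_triangle_ineq[of "tr M (e \<bullet> y)" "rem M (e \<bullet> y)"] by (intro mult_left_mono) (auto simp: rem_def)
        ultimately show ?case by (simp add: mult.commute)
      qed
    qed (use uh[OF h] ui remi in auto)
    also have "\<dots> = real M * (\<eta> + (\<integral>y. (?u y)\<^sup>2 \<partial>usm) / \<eta>) + (\<integral>y. norm (rem M (e \<bullet> y)) \<partial>usm)"
      using ui remi usm.prob_space[where 'a='a] by simp
    also have "\<dots> \<le> real M * (\<eta> + lam / (real l + lam) / \<eta>) + (\<integral>y. norm (rem M (e \<bullet> y)) \<partial>usm)"
      using iu \<eta> by (intro add_mono mult_left_mono divide_right_mono) auto
    finally show ?thesis .
  qed
  note bound = this
  have "(\<lambda>l. real M * (\<eta> + lam / (real l + lam) / \<eta>)) \<longlonglongrightarrow> real M * (\<eta> + 0 / \<eta>)"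
  proof (intro tendsto_intros)
    show "(\<lambda>l. lam / (real l + lam)) \<longlonglongrightarrow> 0"
      by real_asymp
  qed (use \<eta> in auto)
  moreover have "real M * (\<eta> + 0 / \<eta>) < r / 2"
    using r by (simp add: \<eta>_def field_simps add_pos_nonneg)
  ultimately have "eventually (\<lambda>l. real M * (\<eta> + lam / (real l + lam) / \<eta>) < r / 2) sequentially"
    by (rule order_tendstoD(2))
  then obtain L where "\<And>l. l \<ge> L \<Longrightarrow> real M * (\<eta> + lam / (real l + lam) / \<eta>) < r / 2"
    by (auto simp: eventually_sequentially)
  note small = this
  have "norm (zmult e h l - 0) < r" if "l \<ge> L" for l
    using bound[of l] M small[OF that] unfolding diff_zero by linarith
  then show "\<exists>no. \<forall>l\<ge>no. norm (zmult e h l - 0) < r" by blast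
qed

section \<open>Riemann sums in the scale\<close>

lemma nn_integral_inverse_interval:
  fixes p q :: real
  assumes "0 < p" "p \<le> q"
  shows "(\<integral>\<^sup>+t. ennreal (1 / t) * indicator {p<..q} t \<partial>lborel) = ennreal (ln (q / p))"
proof -
  have "(\<integral>\<^sup>+t. ennreal (1 / t) * indicator {p<..q} t \<partial>lborel) = (\<integral>\<^sup>+t. ennreal (1 / t) * indicator {p..q} t \<partial>lborel)"
  proof (rule nn_integral_cong_AE)
    show "AE t in lborel. ennreal (1 / t) * indicator {p<..q} t = ennreal (1 / t) * indicator {p..q} t"
      using AE_lborel_singleton[of p] by eventually_elim (auto simp: indicator_def)
  qed
  also have "\<dots> = ennreal (ln q - ln p)"
    using assms by (intro nn_integral_FTC_Icc) (auto intro!: derivative_eq_intros simp: divide_inverse)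
  finally show ?thesis using assms by (simp add: ln_div)
qed

locale abs_cont_profile =
  fixes \<phi> :: "real \<Rightarrow> real"
  assumes nonneg: "\<And>t. \<phi> t \<ge> 0"
    and diff: "\<And>t. t > 0 \<Longrightarrow> \<phi> differentiable (at t)"
    and deriv_int: "set_integrable lborel {0<..} (deriv \<phi>)"
begin

definition var_on :: "real set \<Rightarrow> ennreal" where
  "var_on A = (\<integral>\<^sup>+t. ennreal \<bar>indicator {0<..} t * deriv \<phi> t\<bar> * indicator A t \<partial>lborel)"

definition mass_on :: "real set \<Rightarrow> ennreal" where
  "mass_on A = (\<integral>\<^sup>+t. ennreal (indicator {0<..} t * \<phi> t / t) * indicator A t \<partial>lborel)"

lemma profile_measurable [measurable]: "(\<lambda>t. indicator {0<..} t * \<phi> t) \<in> borel_measurable borel"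
proof -
  have "continuous_on {0<..} \<phi>"
    using diff by (intro continuous_at_imp_continuous_on ballI differentiable_imp_continuous_within) auto
  then have "(\<lambda>t. indicator {0<..} t *\<^sub>R \<phi> t) \<in> borel_measurable borel"
    by (intro borel_measurable_continuous_on_indicator) auto
  then show ?thesis by simp
qed

lemma deriv_measurable [measurable]: "(\<lambda>t. indicator {0<..} t * deriv \<phi> t) \<in> borel_measurable borel"
  using borel_measurable_integrable[OF deriv_int[unfolded set_integrable_def]] by simp

lemma increment_le_var:
  assumes p: "0 < p" and t: "t \<in> {p<..q}"
  shows "ennreal \<bar>\<phi> q - \<phi> t\<bar> \<le> var_on {p<..q}"
proof -
  have t0: "0 < t" "t \<le> q" using p t by auto
  have "(deriv \<phi> has_integral (\<phi> q - \<phi> t)) {t..q}"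
  proof (rule fundamental_theorem_of_calculus[OF t0(2)])
    fix x assume "x \<in> {t..q}"
    then have "(\<phi> has_field_derivative deriv \<phi> x) (at x)"
      using t0 diff by (simp add: DERIV_deriv_iff_real_differentiable)
    then show "(\<phi> has_vector_derivative deriv \<phi> x) (at x within {t..q})"
      by (simp add: has_real_derivative_iff_has_vector_derivative has_vector_derivative_at_within)
  qed
  moreover have i: "set_integrable lborel {t..q} (deriv \<phi>)"
    using t0 by (intro set_integrable_subset[OF deriv_int]) auto
  ultimately have "\<phi> q - \<phi> t = (\<integral>x. indicator {t..q} x * deriv \<phi> x \<partial>lborel)"
    using set_borel_integral_eq_integral(2)[OF i] by (simp add: integral_unique set_lebesgue_integral_def)
  then have "ennreal \<bar>\<phi> q - \<phi> t\<bar> \<le> (\<integral>\<^sup>+x. ennreal (norm (indicator {t..q} x * deriv \<phi> x)) \<partial>lborel)"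
    using integral_norm_bound_ennreal[OF i[unfolded set_integrable_def]] by simp
  also have "\<dots> \<le> var_on {p<..q}"
    unfolding var_on_def using t p by (intro nn_integral_mono) (auto simp: indicator_def)
  finally show ?thesis .
qed

lemma interval_estimate:
  assumes p: "0 < p" and q: "p \<le> q" "ln (q / p) \<le> \<kappa>"
  shows "ennreal (ln (q / p)) * ennreal (\<phi> q) \<le> mass_on {p<..q} + ennreal \<kappa> * var_on {p<..q}"
    and "mass_on {p<..q} \<le> ennreal (ln (q / p)) * ennreal (\<phi> q) + ennreal \<kappa> * var_on {p<..q}"
proof -
  let ?J = "indicator {p<..q} :: real \<Rightarrow> ennreal"
  let ?V = "var_on {p<..q}"
  have c: "(\<integral>\<^sup>+t. c * (ennreal (1 / t) * ?J t) \<partial>lborel) = ennreal (ln (q / p)) * c" for c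
    using nn_integral_inverse_interval[OF p q(1)] by (subst nn_integral_cmult) (auto simp: mult.commute)
  have up: "ennreal (\<phi> q) * (ennreal (1 / t) * ?J t) \<le> ennreal (indicator {0<..} t * \<phi> t / t) * ?J t + ?V * (ennreal (1 / t) * ?J t)"
    and dn: "ennreal (indicator {0<..} t * \<phi> t / t) * ?J t \<le> ennreal (\<phi> q) * (ennreal (1 / t) * ?J t) + ?V * (ennreal (1 / t) * ?J t)" for t
  proof -
    have "ennreal (\<phi> q) * ennreal (1 / t) \<le> ennreal (\<phi> t / t) + ?V * ennreal (1 / t)
      \<and> ennreal (\<phi> t / t) \<le> ennreal (\<phi> q) * ennreal (1 / t) + ?V * ennreal (1 / t)" if t: "t \<in> {p<..q}"
    proof -
      have t0: "t > 0" using t p by simp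
      have e: "ennreal (\<phi> t / t) = ennreal (\<phi> t) * ennreal (1 / t)"
        using t0 nonneg by (simp flip: ennreal_mult)
      have v: "ennreal \<bar>\<phi> q - \<phi> t\<bar> \<le> ?V" by (rule increment_le_var[OF p t])
      have "ennreal (\<phi> q) \<le> ennreal (\<phi> t) + ennreal \<bar>\<phi> q - \<phi> t\<bar>"
        using nonneg by (simp flip: ennreal_plus)
      also have "\<dots> \<le> ennreal (\<phi> t) + ?V" by (intro add_left_mono v)
      finally have 1: "ennreal (\<phi> q) \<le> ennreal (\<phi> t) + ?V" .
      have "ennreal (\<phi> t) \<le> ennreal (\<phi> q) + ennreal \<bar>\<phi> q - \<phi> t\<bar>"
        using nonneg by (simp flip: ennreal_plus)
      also have "\<dots> \<le> ennreal (\<phi> q) + ?V" by (intro add_left_mono v)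
      finally have 2: "ennreal (\<phi> t) \<le> ennreal (\<phi> q) + ?V" .
      show ?thesis unfolding e distrib_right[symmetric] using 1 2 by (auto intro!: mult_right_mono)
    qed
    then show "ennreal (\<phi> q) * (ennreal (1 / t) * ?J t) \<le> ennreal (indicator {0<..} t * \<phi> t / t) * ?J t + ?V * (ennreal (1 / t) * ?J t)"
      and "ennreal (indicator {0<..} t * \<phi> t / t) * ?J t \<le> ennreal (\<phi> q) * (ennreal (1 / t) * ?J t) + ?V * (ennreal (1 / t) * ?J t)"
      using p by (auto simp: indicator_def)
  qed
  have \<kappa>: "ennreal (ln (q / p)) * ?V \<le> ennreal \<kappa> * ?V"
    by (intro mult_right_mono ennreal_leI q) auto
  have "ennreal (ln (q / p)) * ennreal (\<phi> q) = (\<integral>\<^sup>+t. ennreal (\<phi> q) * (ennreal (1 / t) * ?J t) \<partial>lborel)"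
    by (rule c[symmetric])
  also have "\<dots> \<le> (\<integral>\<^sup>+t. ennreal (indicator {0<..} t * \<phi> t / t) * ?J t + ?V * (ennreal (1 / t) * ?J t) \<partial>lborel)"
    by (intro nn_integral_mono up)
  also have "\<dots> = mass_on {p<..q} + ennreal (ln (q / p)) * ?V"
    by (subst nn_integral_add) (auto simp: c mass_on_def)
  also have "\<dots> \<le> mass_on {p<..q} + ennreal \<kappa> * ?V" by (intro add_left_mono \<kappa>)
  finally show "ennreal (ln (q / p)) * ennreal (\<phi> q) \<le> mass_on {p<..q} + ennreal \<kappa> * ?V" .
  have "mass_on {p<..q} \<le> (\<integral>\<^sup>+t. ennreal (\<phi> q) * (ennreal (1 / t) * ?J t) + ?V * (ennreal (1 / t) * ?J t) \<partial>lborel)"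
    unfolding mass_on_def by (intro nn_integral_mono dn)
  also have "\<dots> = ennreal (ln (q / p)) * ennreal (\<phi> q) + ennreal (ln (q / p)) * ?V"
    by (subst nn_integral_add) (auto simp: c)
  also have "\<dots> \<le> ennreal (ln (q / p)) * ennreal (\<phi> q) + ennreal \<kappa> * ?V" by (intro add_left_mono \<kappa>)
  finally show "mass_on {p<..q} \<le> ennreal (ln (q / p)) * ennreal (\<phi> q) + ennreal \<kappa> * ?V" .
qed

lemma suminf_on_partition:
  fixes c :: "nat \<Rightarrow> real" and f :: "real \<Rightarrow> ennreal"
  assumes [measurable]: "f \<in> borel_measurable borel"
    and c: "\<And>j. c (Suc j) \<le> c j" "\<And>j. c j > 0" "c \<longlonglongrightarrow> 0"
  shows "(\<Sum>j. \<integral>\<^sup>+t. f t * indicator {c (Suc j)<..c j} t \<partial>lborel) = (\<integral>\<^sup>+t. f t * indicator {0<..c 0} t \<partial>lborel)"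
proof -
  have dec: "decseq c" using c(1) by (simp add: decseq_Suc_iff)
  have disj: "disjoint_family (\<lambda>j. {c (Suc j)<..c j})"
  proof -
    have "{c (Suc i)<..c i} \<inter> {c (Suc j)<..c j} = {}" if "i < j" for i j
    proof -
      have "c j \<le> c (Suc i)" using dec that by (auto simp: decseq_def)
      then show ?thesis by auto
    qed
    then show ?thesis unfolding disjoint_family_on_def by (metis Int_commute nat_neq_iff)
  qed
  have un: "(\<Union>j. {c (Suc j)<..c j}) = {0<..c 0}"
  proof safe
    fix j t assume "t \<in> {c (Suc j)<..c j}"
    moreover have "c j \<le> c 0" using dec by (auto simp: decseq_def)
    ultimately show "t \<in> {0<..c 0}" using c(2)[of "Suc j"] by auto
  next
    fix t assume t: "t \<in> {0<..c 0}"
    then have "eventually (\<lambda>j. c j < t) sequentially" using c(3) by (intro order_tendstoD(2)) auto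
    then have ex: "\<exists>j. c j < t" by (auto simp: eventually_sequentially)
    define k where "k = (LEAST j. c j < t)"
    have k: "c k < t" unfolding k_def using ex by (rule LeastI_ex)
    then have "k \<noteq> 0" using t by (intro notI) auto
    then obtain j where j: "k = Suc j" using not0_implies_Suc by blast
    then have "\<not> c j < t" unfolding k_def using not_less_Least[of j "\<lambda>j. c j < t"] by (simp add: k_def)
    then show "t \<in> (\<Union>j. {c (Suc j)<..c j})" using k j by auto
  qed
  have "(\<Sum>j. \<integral>\<^sup>+t. f t * indicator {c (Suc j)<..c j} t \<partial>lborel) = (\<Sum>j. emeasure (density lborel f) {c (Suc j)<..c j})"
    by (simp add: emeasure_density)
  also have "\<dots> = emeasure (density lborel f) {0<..c 0}"
    unfolding un[symmetric] by (rule suminf_emeasure) (use disj in auto)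
  finally show ?thesis by (simp add: emeasure_density)
qed

definition riemann_sum :: "(nat \<Rightarrow> real) \<Rightarrow> real \<Rightarrow> ennreal" where
  "riemann_sum b s = (\<Sum>j. ennreal (ln (b j / b (Suc j))) * ennreal (\<phi> (b j * s)))"

lemma riemann_sum_estimate:
  assumes b: "\<And>j. b j > 0" "b \<longlonglongrightarrow> 0" "\<And>j. 1 < b j / b (Suc j)" "\<And>j. b j / b (Suc j) < 1 + \<kappa>"
    and s: "s > 0"
  shows "riemann_sum b s \<le> mass_on {0<..b 0 * s} + ennreal \<kappa> * var_on {0<..}"
    and "mass_on {0<..b 0 * s} \<le> riemann_sum b s + ennreal \<kappa> * var_on {0<..}"
proof -
  define c where "c j = b j * s" for j
  have c: "c (Suc j) \<le> c j" "c j > 0" "c j / c (Suc j) = b j / b (Suc j)" for j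
    using b(1,3)[of j] b(1)[of "Suc j"] s by (simp_all add: c_def)
  have c0: "c \<longlonglongrightarrow> 0"
    unfolding c_def[abs_def] using tendsto_mult_right[OF b(2), of s] by simp
  have ln: "ln (c j / c (Suc j)) \<le> \<kappa>" for j
  proof -
    have "ln (c j / c (Suc j)) \<le> c j / c (Suc j) - 1" using c(2) by (intro ln_le_minus_one) auto
    then show ?thesis using b(4)[of j] c(3) by simp
  qed
  let ?J = "\<lambda>j. {c (Suc j)<..c j}"
  have m: "(\<Sum>j. mass_on (?J j)) = mass_on {0<..c 0}"
    unfolding mass_on_def by (rule suminf_on_partition[OF _ c(1,2) c0]) measurable
  have "(\<Sum>j. var_on (?J j)) = var_on {0<..c 0}"
    unfolding var_on_def by (rule suminf_on_partition[OF _ c(1,2) c0]) measurable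
  also have "\<dots> \<le> var_on {0<..}"
    unfolding var_on_def by (intro nn_integral_mono) (auto simp: indicator_def)
  finally have v: "(\<Sum>j. ennreal \<kappa> * var_on (?J j)) \<le> ennreal \<kappa> * var_on {0<..}"
    by (simp add: mult_left_mono)
  let ?S = "\<lambda>j. ennreal (ln (b j / b (Suc j))) * ennreal (\<phi> (b j * s))"
  have est1: "?S j \<le> mass_on (?J j) + ennreal \<kappa> * var_on (?J j)"
    and est2: "mass_on (?J j) \<le> ?S j + ennreal \<kappa> * var_on (?J j)" for j
    using interval_estimate[OF c(2) c(1) ln, of j] unfolding c(3) by (simp_all only: c_def[symmetric])
  have "(\<Sum>j. ?S j) \<le> (\<Sum>j. mass_on (?J j) + ennreal \<kappa> * var_on (?J j))"
    by (intro suminf_le est1) auto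
  also have "\<dots> = mass_on {0<..c 0} + (\<Sum>j. ennreal \<kappa> * var_on (?J j))"
    by (subst suminf_add[symmetric]) (auto simp: m)
  also have "\<dots> \<le> mass_on {0<..c 0} + ennreal \<kappa> * var_on {0<..}" by (intro add_left_mono v)
  finally show "riemann_sum b s \<le> mass_on {0<..b 0 * s} + ennreal \<kappa> * var_on {0<..}" by (simp add: c_def riemann_sum_def)
  have "mass_on {0<..c 0} = (\<Sum>j. mass_on (?J j))" by (rule m[symmetric])
  also have "\<dots> \<le> (\<Sum>j. ?S j + ennreal \<kappa> * var_on (?J j))"
    by (intro suminf_le est2) auto
  also have "\<dots> = (\<Sum>j. ?S j) + (\<Sum>j. ennreal \<kappa> * var_on (?J j))"
    by (subst suminf_add[symmetric]) auto
  also have "\<dots> \<le> (\<Sum>j. ?S j) + ennreal \<kappa> * var_on {0<..}" by (intro add_left_mono v)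
  finally show "mass_on {0<..b 0 * s} \<le> riemann_sum b s + ennreal \<kappa> * var_on {0<..}" by (simp add: c_def riemann_sum_def)
qed

lemma var_finite: "var_on {0<..} < \<infinity>"
proof -
  have "var_on {0<..} = (\<integral>\<^sup>+t. ennreal (norm (indicator {0<..} t *\<^sub>R deriv \<phi> t)) \<partial>lborel)"
    unfolding var_on_def by (intro nn_integral_cong) (auto simp: indicator_def)
  also have "\<dots> < \<infinity>" using deriv_int unfolding set_integrable_def integrable_iff_bounded by simp
  finally show ?thesis .
qed

lemma mass_scale:
  assumes s: "s > 0" and r: "r \<ge> 0"
  shows "mass_on {r * s<..} = (\<integral>\<^sup>+a. ennreal (indicator {r<..} a * \<phi> (a * s) / a) \<partial>lborel)"
proof -
  have "mass_on {r * s<..} = ennreal s * (\<integral>\<^sup>+a. ennreal (indicator {0<..} (s * a) * \<phi> (s * a) / (s * a)) * indicator {r * s<..} (s * a) \<partial>lborel)"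
    unfolding mass_on_def using s by (subst nn_integral_real_affine[of _ s 0]) auto
  also have "\<dots> = (\<integral>\<^sup>+a. ennreal s * (ennreal (indicator {0<..} (s * a) * \<phi> (s * a) / (s * a)) * indicator {r * s<..} (s * a)) \<partial>lborel)"
    by (rule nn_integral_cmult[symmetric]) measurable
  also have "\<dots> = (\<integral>\<^sup>+a. ennreal (indicator {r<..} a * \<phi> (a * s) / a) \<partial>lborel)"
  proof (rule nn_integral_cong)
    fix a
    show "ennreal s * (ennreal (indicator {0<..} (s * a) * \<phi> (s * a) / (s * a)) * indicator {r * s<..} (s * a)) = ennreal (indicator {r<..} a * \<phi> (a * s) / a)"
    proof (cases "a > r")
      case True
      then have "a > 0" using r by simp
      then show ?thesis using True s nonneg by (simp add: mult.commute indicator_def flip: ennreal_mult)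
    next
      case False
      then have "\<not> r * s < s * a" using s by (simp add: mult.commute)
      then show ?thesis using False by (simp add: indicator_def)
    qed
  qed
  finally show ?thesis .
qed

lemma mass_mono: "A \<subseteq> B \<Longrightarrow> mass_on A \<le> mass_on B"
  unfolding mass_on_def by (intro nn_integral_mono) (auto simp: indicator_def)

lemma mass_Un:
  assumes "A \<inter> B = {}" and [measurable]: "A \<in> sets borel" "B \<in> sets borel"
  shows "mass_on (A \<union> B) = mass_on A + mass_on B"
proof -
  let ?f = "\<lambda>t. ennreal (indicator {0<..} t * \<phi> t / t)"
  have "mass_on (A \<union> B) = (\<integral>\<^sup>+t. ?f t * indicator A t + ?f t * indicator B t \<partial>lborel)"
    unfolding mass_on_def using assms(1) by (intro nn_integral_cong) (auto simp: indicator_def)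
  also have "\<dots> = mass_on A + mass_on B"
    unfolding mass_on_def by (rule nn_integral_add) measurable
  finally show ?thesis .
qed

lemma mass_tail_tendsto_0:
  assumes "mass_on {0<..} < \<infinity>"
  shows "(\<lambda>n. mass_on {real n<..}) \<longlonglongrightarrow> 0"
proof -
  define M where "M = density lborel (\<lambda>t. ennreal (indicator {0<..} t * \<phi> t / t))"
  have m: "mass_on A = emeasure M A" if "A \<in> sets borel" for A
    using that unfolding mass_on_def M_def by (simp add: emeasure_density)
  have "(\<lambda>n. emeasure M {real n<..}) \<longlonglongrightarrow> emeasure M (\<Inter>n. {real n<..})"
  proof (rule Lim_emeasure_decseq)
    show "emeasure M {real n<..} \<noteq> \<infinity>" for n
    proof -
      have "mass_on {real n<..} \<le> mass_on {0<..}" by (intro mass_mono) auto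
      then show ?thesis using assms by (simp add: m top.not_eq_extremum)
    qed
  qed (auto simp: M_def decseq_def)
  also have "(\<Inter>n. {real n<..}) = {}"
  proof (rule equals0I)
    fix t assume t: "t \<in> (\<Inter>n. {real n<..})"
    obtain n where "t \<le> real n" using real_arch_simple by blast
    moreover have "t \<in> {real n<..}" using t by blast
    ultimately show False by simp
  qed
  finally show ?thesis by (simp add: m)
qed

lemma mass_head_tendsto:
  "(\<lambda>n. mass_on {1 / (real n + 1)<..}) \<longlonglongrightarrow> mass_on {0<..}"
proof -
  define M where "M = density lborel (\<lambda>t. ennreal (indicator {0<..} t * \<phi> t / t))"
  have m: "mass_on A = emeasure M A" if "A \<in> sets borel" for A
    using that unfolding mass_on_def M_def by (simp add: emeasure_density)
  have "(\<lambda>n. emeasure M {1 / (real n + 1)<..}) \<longlonglongrightarrow> emeasure M (\<Union>n. {1 / (real n + 1)<..})"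
    by (rule Lim_emeasure_incseq) (auto simp: M_def incseq_def frac_le intro!: le_less_trans[OF frac_le])
  also have "(\<Union>n. {1 / (real n + 1)<..}) = {0<..}"
  proof (intro set_eqI iffI)
    fix t :: real assume "t \<in> (\<Union>n. {1 / (real n + 1)<..})"
    then obtain n where n: "1 / (real n + 1) < t" by auto
    have "0 < t" by (rule less_trans[OF _ n]) simp
    then show "t \<in> {0<..}" by simp
  next
    fix t :: real assume "t \<in> {0<..}"
    then obtain n where "1 / real (Suc n) < t" using nat_approx_posE by (auto simp: greaterThan_iff)
    then show "t \<in> (\<Union>n. {1 / (real n + 1)<..})" by (auto simp: add.commute)
  qed
  finally show ?thesis by (simp add: m)
qed

end

section \<open>Multipliers of autocorrelations\<close>

lemma clip_integrable:
  fixes e :: "'a::euclidean_space"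
  assumes d: "DIM('a) \<ge> 2" and e: "norm e = 1" and i: "integrable sphere_measure (zonal e \<psi>)"
  shows "clip \<psi> \<in> borel_measurable borel" and "integrable usm (\<lambda>y. clip \<psi> (e \<bullet> y))"
proof -
  show m [measurable]: "clip \<psi> \<in> borel_measurable borel"
    by (rule clip_measurable[OF d e borel_measurable_integrable[OF i]])
  have "integrable sphere_measure (zonal e \<psi>) \<longleftrightarrow> integrable sphere_measure (\<lambda>y. clip \<psi> (e \<bullet> y))"
    using e by (intro Bochner_Integration.integrable_cong) (auto simp: zonal_def clip_inner)
  then show "integrable usm (\<lambda>y. clip \<psi> (e \<bullet> y))"
    using i by (subst integrable_sphere[symmetric]) auto
qed

lemma cnj_measurable [measurable]: "cnj \<in> borel_measurable borel"
  by (intro borel_measurable_continuous_onI continuous_intros)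

lemma zconv_zonal_cong:
  fixes e x y :: "'a::euclidean_space"
  assumes n: "norm x = norm y" and xy: "e \<bullet> x = e \<bullet> y"
    and [measurable]: "h \<in> borel_measurable borel" "k \<in> borel_measurable borel"
  shows "zconv h (\<lambda>z. k (e \<bullet> z)) x = zconv h (\<lambda>z. k (e \<bullet> z)) y"
proof -
  let ?T = "reflection (x - y)"
  have "?T e = e" using xy by (intro reflection_fixes) (simp add: inner_diff_right)
  then have T: "x \<bullet> ?T z = y \<bullet> z" "e \<bullet> ?T z = e \<bullet> z" for z
    using reflection_swaps(1)[OF n] reflection_inner[of "x - y" x z] reflection_inner[of "x - y" e z] by simp_all
  have "zconv h (\<lambda>z. k (e \<bullet> z)) x = (\<integral>z. h (x \<bullet> ?T z) * k (e \<bullet> ?T z) \<partial>usm)"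
    unfolding zconv_def by (rule integral_usm_rot[OF reflection_orthogonal, symmetric]) measurable
  then show ?thesis by (simp add: T zconv_def)
qed

lemma profile_conv:
  fixes e y :: "'a::euclidean_space"
  assumes d: "DIM('a) \<ge> 2" and e: "norm e = 1" and i: "integrable sphere_measure (zonal e \<psi>)" and y: "norm y = 1"
  shows "profile e (sphere_conv (zonal e (\<lambda>t. cnj (\<psi> t))) \<psi>) (e \<bullet> y) = zconv (clip \<psi>) (\<lambda>z. cnj (clip \<psi> (e \<bullet> z))) y"
proof -
  define h where "h = clip \<psi>"
  have [measurable]: "h \<in> borel_measurable borel" unfolding h_def by (rule clip_integrable(1)[OF d e i])
  define x where "x = (SOME x. x \<in> sphere 0 1 \<and> e \<bullet> x = e \<bullet> y)"
  have "x \<in> sphere 0 1 \<and> e \<bullet> x = e \<bullet> y"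
    unfolding x_def by (rule someI[of _ y]) (use y in auto)
  then have x: "norm x = 1" "e \<bullet> x = e \<bullet> y" by auto
  have S: "sphere_area TYPE('a) > 0" by (rule sphere_area_pos)
  have "(\<integral>z. zonal e (\<lambda>t. cnj (\<psi> t)) z * \<psi> (x \<bullet> z) \<partial>sphere_measure) =
      (\<integral>z. cnj (h (e \<bullet> z)) * h (x \<bullet> z) \<partial>sphere_measure)"
    using e x by (intro Bochner_Integration.integral_cong) (auto simp: zonal_def h_def clip_inner)
  also have "\<dots> = sphere_area TYPE('a) *\<^sub>R (\<integral>z. cnj (h (e \<bullet> z)) * h (x \<bullet> z) \<partial>usm)"
    by (rule integral_sphere) measurable
  finally have "sphere_conv (zonal e (\<lambda>t. cnj (\<psi> t))) \<psi> x = zconv (h) (\<lambda>z. cnj (h (e \<bullet> z))) x"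
    using S by (simp add: sphere_conv_def zconv_def scaleR_conv_of_real mult.commute)
  also have "\<dots> = zconv (h) (\<lambda>z. cnj (h (e \<bullet> z))) y"
    by (rule zconv_zonal_cong) (use x y in auto)
  finally show ?thesis by (simp add: profile_def x_def h_def)
qed

lemma zmult_cnj: "zmult e (\<lambda>t. cnj (h t)) l = cnj (zmult e h l)"
proof -
  have "(\<integral>y. poly (sgeg TYPE('a) l) (e \<bullet> y) *\<^sub>R cnj (h (e \<bullet> y)) \<partial>usm)
      = cnj (\<integral>y. poly (sgeg TYPE('a) l) (e \<bullet> y) *\<^sub>R h (e \<bullet> y) \<partial>usm)" for e :: "'a::euclidean_space"
    by (subst Bochner_Integration.integral_cnj[symmetric]) simp
  then show ?thesis by (simp add: zmult_def)
qed

lemma autocorrelation_multiplier: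
  fixes e :: "'a::euclidean_space"
  assumes d: "DIM('a) \<ge> 3" and e: "norm e = 1" and i: "integrable sphere_measure (zonal e \<psi>)"
  defines "lam \<equiv> gegenbauer_index TYPE('a)"
  defines "K \<equiv> profile e (sphere_conv (zonal e (\<lambda>t. cnj (\<psi> t))) \<psi>)"
  shows "(LBINT t:{-1..1}. gegenbauer_weight lam t *\<^sub>R (poly (geg_poly lam l) t *\<^sub>R K t)) =
     complex_of_real (wmean lam 1 * poly (geg_poly lam l) 1 * (norm (zmult e (clip \<psi>) l))\<^sup>2)"
proof -
  have lam: "lam \<ge> 1 / 2" using gegenbauer_index_ge[OF d] by (simp add: lam_def)
  have d2: "DIM('a) \<ge> 2" using d by simp
  define h where "h = clip \<psi>"
  let ?G = "geg_poly lam l" and ?f = "\<lambda>z. cnj (h (e \<bullet> z))"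
  note h = clip_integrable[OF d2 e i, folded h_def]
  note hm [measurable] = h(1)
  have fi: "integrable usm ?f" "?f \<in> borel_measurable borel" using h by auto
  have W: "wmean lam 1 > 0" and G1: "poly ?G 1 \<ge> 1"
    by (rule wmean_pos[OF lam] geg_poly_at_1_ge_1[OF lam])+
  have Ky: "K (e \<bullet> y) = zconv h ?f y" if "norm y = 1" for y
    unfolding K_def h_def by (rule profile_conv[OF d2 e i that])
  have "zonal e K \<in> borel_measurable sphere_measure \<longleftrightarrow> zconv h ?f \<in> borel_measurable sphere_measure"
    by (rule measurable_cong) (simp add: zonal_def Ky)
  moreover have "zconv h ?f \<in> borel_measurable sphere_measure"
    by (rule measurable_sphere_measureI) measurable
  ultimately have "clip K \<in> borel_measurable borel"
    by (intro clip_measurable[OF d2 e]) simp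
  moreover define CK where "CK = clip K"
  ultimately have [measurable]: "CK \<in> borel_measurable borel" by simp
  have conv: "zconv (cpoly ?G) F e = (\<integral>y. poly ?G (e \<bullet> y) *\<^sub>R F y \<partial>usm)" for F :: "'a \<Rightarrow> complex"
    by (simp add: zconv_def scaleR_conv_of_real)
  have "zconv (cpoly ?G) (zconv h ?f) e = zmult e h l * zconv (cpoly ?G) ?f e"
  proof -
    define c where "c = (real l + lam) / lam"
    have "c \<noteq> 0" using lam by (simp add: c_def)
    moreover have "complex_of_real c * zconv (cpoly ?G) (zconv h ?f) e = complex_of_real c * (zmult e h l * zconv (cpoly ?G) ?f e)"
      using zconv_poly_zconv[OF d e h fi e, of l]
      unfolding harm_proj_def zpoly_def lam_def[symmetric] c_def[symmetric] zconv_smult by (simp only: mult.left_commute)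
    ultimately show ?thesis by simp
  qed
  also have "zconv (cpoly ?G) ?f e = poly ?G 1 *\<^sub>R cnj (zmult e h l)"
    unfolding conv using G1 by (subst zmult_cnj[symmetric]) (simp add: zmult_def lam_def)
  finally have *: "(\<integral>y. poly ?G (e \<bullet> y) *\<^sub>R zconv h ?f y \<partial>usm) = complex_of_real (poly ?G 1 * (norm (zmult e h l))\<^sup>2)"
    unfolding conv of_real_mult complex_norm_square by (simp add: scaleR_conv_of_real mult_ac)
  have "(LBINT t:{-1..1}. gegenbauer_weight lam t *\<^sub>R (poly ?G t *\<^sub>R K t)) =
      (LBINT t:{-1..1}. gegenbauer_weight lam t *\<^sub>R (poly ?G t *\<^sub>R CK t))"
    by (rule set_lebesgue_integral_cong) (auto simp: clip_def CK_def)
  also have "\<dots> = wmean lam 1 *\<^sub>R (\<integral>y. poly ?G (e \<bullet> y) *\<^sub>R CK (e \<bullet> y) \<partial>usm)"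
    using integral_zonal[OF e d, of "\<lambda>t. poly ?G t *\<^sub>R CK t"] W by (simp add: lam_def)
  also have "(\<integral>y. poly ?G (e \<bullet> y) *\<^sub>R CK (e \<bullet> y) \<partial>usm) = (\<integral>y. poly ?G (e \<bullet> y) *\<^sub>R zconv h ?f y \<partial>usm)"
  proof (rule integral_cong_AE)
    show "AE y in usm. poly ?G (e \<bullet> y) *\<^sub>R CK (e \<bullet> y) = poly ?G (e \<bullet> y) *\<^sub>R zconv h ?f y"
      using AE_usm by eventually_elim (simp add: CK_def clip_inner[OF e] Ky)
  qed measurable
  also note *
  finally show ?thesis unfolding h_def by (simp add: scaleR_conv_of_real mult.assoc)
qed

text \<open>
  The scale integral over \<open>a > 1\<close> of the autocorrelations is an integrable zonal function by the
  joint integrability condition, and these integrals are its multipliers.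
\<close>

lemma wavelet_tail_multiplier_tendsto_0:
  fixes e :: "'a::euclidean_space"
  assumes d: "DIM('a) \<ge> 3" and e: "norm e = 1" and i: "\<And>a. a > 0 \<Longrightarrow> integrable sphere_measure (zonal e (g a))"
  defines "lam \<equiv> gegenbauer_index TYPE('a)"
  defines "K \<equiv> \<lambda>a. profile e (sphere_conv (zonal e (\<lambda>t. cnj (g a t))) (g a))"
  assumes K: "set_integrable (lborel \<Otimes>\<^sub>M lborel) ({1<..} \<times> {-1..1})
                   (\<lambda>(a, t). K a t / of_real a * of_real (gegenbauer_weight lam t))"
  shows "(\<lambda>l. \<integral>a. indicator {1<..} a * ((norm (zmult e (clip (g a)) l))\<^sup>2 / a) \<partial>lborel) \<longlonglongrightarrow> 0"
proof -
  have lam: "lam \<ge> 1 / 2" using gegenbauer_index_ge[OF d] by (simp add: lam_def)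
  have W: "wmean lam 1 > 0" by (rule wmean_pos[OF lam])
  let ?T = "\<lambda>l. \<integral>a. indicator {1<..} a * ((norm (zmult e (clip (g a)) l))\<^sup>2 / a) \<partial>lborel"
  let ?w = "gegenbauer_weight lam"
  define P where "P z = indicator ({1<..} \<times> {-1..1}) z *\<^sub>R (case z of (a, t) \<Rightarrow> K a t / of_real a * of_real (?w t))" for z
  have P: "integrable (lborel \<Otimes>\<^sub>M lborel) P"
    using K unfolding set_integrable_def P_def .
  define J where "J t = (\<integral>a. P (a, t) \<partial>lborel)" for t
  have J: "integrable lborel J"
    unfolding J_def by (rule lborel_pair.integrable_snd) (use P in simp)
  then have [measurable]: "J \<in> borel_measurable borel" by (simp add: borel_measurable_integrable)
  define \<Xi> where "\<Xi> t = J t /\<^sub>R ?w t" for t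
  have \<Xi>m [measurable]: "\<Xi> \<in> borel_measurable borel" unfolding \<Xi>_def by measurable
  have wJ: "?w t *\<^sub>R \<Xi> t = J t" for t
    by (cases "?w t = 0") (auto simp: \<Xi>_def J_def P_def)
  have J0: "indicator {-1..1} t *\<^sub>R J t = J t" for t
    by (auto simp: J_def P_def indicator_def)
  have \<Xi>i: "integrable usm (\<lambda>y. \<Xi> (e \<bullet> y))"
    using J by (subst integrable_zonal[OF e d \<Xi>m]) (simp add: set_integrable_def wJ lam_def[symmetric] J0)
  have "zmult e \<Xi> l = complex_of_real (?T l)" for l
  proof -
    let ?G = "geg_poly lam l"
    have G1: "poly ?G 1 \<ge> 1" by (rule geg_poly_at_1_ge_1[OF lam])
    obtain B where B: "B \<ge> 0" "\<And>t. t \<in> {-1..1} \<Longrightarrow> \<bar>poly ?G t\<bar> \<le> B" using poly_bounded_interval by blast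
    have GP: "integrable (lborel \<Otimes>\<^sub>M lborel) (\<lambda>(a, t). poly ?G t *\<^sub>R P (a, t))"
    proof (rule Bochner_Integration.integrable_bound)
      show "integrable (lborel \<Otimes>\<^sub>M lborel) (\<lambda>z. B *\<^sub>R P z)" using P by simp
      have [measurable]: "P \<in> borel_measurable (lborel \<Otimes>\<^sub>M lborel)" by (rule borel_measurable_integrable[OF P])
      show "(\<lambda>(a, t). poly ?G t *\<^sub>R P (a, t)) \<in> borel_measurable (lborel \<Otimes>\<^sub>M lborel)" by measurable
      show "AE z in lborel \<Otimes>\<^sub>M lborel. norm (case z of (a, t) \<Rightarrow> poly ?G t *\<^sub>R P (a, t)) \<le> norm (B *\<^sub>R P z)"
      proof (rule AE_I2)
        fix z :: "real \<times> real"
        obtain a t where z: "z = (a, t)" by (cases z)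
        show "norm (case z of (a, t) \<Rightarrow> poly ?G t *\<^sub>R P (a, t)) \<le> norm (B *\<^sub>R P z)"
        proof (cases "t \<in> {-1..1}")
          case True
          then show ?thesis using B by (auto simp: z intro!: mult_right_mono)
        qed (auto simp: z P_def)
      qed
    qed
    have inner: "(\<integral>t. poly ?G t *\<^sub>R P (a, t) \<partial>lborel)
       = complex_of_real (wmean lam 1 * poly ?G 1 * (indicator {1<..} a * ((norm (zmult e (clip (g a)) l))\<^sup>2 / a)))" for a
    proof (cases "a > 1")
      case True
      then have ia: "integrable sphere_measure (zonal e (g a))" by (intro i) simp
      have "(\<integral>t. poly ?G t *\<^sub>R P (a, t) \<partial>lborel)
        = (\<integral>t. (1 / a) *\<^sub>R (indicator {-1..1} t *\<^sub>R (?w t *\<^sub>R (poly ?G t *\<^sub>R K a t))) \<partial>lborel)"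
        using True by (intro Bochner_Integration.integral_cong) (auto simp: P_def indicator_def scaleR_conv_of_real)
      also have "\<dots> = (1 / a) *\<^sub>R (LBINT t:{-1..1}. ?w t *\<^sub>R (poly ?G t *\<^sub>R K a t))"
        unfolding set_lebesgue_integral_def by (rule integral_scaleR_right)
      also have "(LBINT t:{-1..1}. ?w t *\<^sub>R (poly ?G t *\<^sub>R K a t)) =
          complex_of_real (wmean lam 1 * poly ?G 1 * (norm (zmult e (clip (g a)) l))\<^sup>2)"
        using autocorrelation_multiplier[OF d e ia, of l] by (simp add: K_def lam_def)
      finally show ?thesis using True by (simp add: scaleR_conv_of_real)
    qed (simp add: P_def)
    have "(\<integral>t. (\<integral>a. poly ?G t *\<^sub>R P (a, t) \<partial>lborel) \<partial>lborel) = (\<integral>a. (\<integral>t. poly ?G t *\<^sub>R P (a, t) \<partial>lborel) \<partial>lborel)"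
      by (rule lborel_pair.Fubini_integral[OF GP])
    then have F: "(\<integral>t. poly ?G t *\<^sub>R J t \<partial>lborel) =
        complex_of_real (wmean lam 1 * poly ?G 1 * ?T l)"
      unfolding inner J_def by (simp only: integral_complex_of_real integral_mult_right_zero integral_scaleR_right)
    have "indicator {-1..1} t *\<^sub>R (?w t *\<^sub>R (poly ?G t *\<^sub>R \<Xi> t)) = poly ?G t *\<^sub>R J t" for t
    proof -
      have "indicator {-1..1} t *\<^sub>R (?w t *\<^sub>R (poly ?G t *\<^sub>R \<Xi> t)) = poly ?G t *\<^sub>R (indicator {-1..1} t *\<^sub>R (?w t *\<^sub>R \<Xi> t))"
        by (simp only: scaleR_scaleR mult_ac)
      then show ?thesis by (simp only: wJ J0)
    qed
    then have "(LBINT t:{-1..1}. ?w t *\<^sub>R (poly ?G t *\<^sub>R \<Xi> t)) = (\<integral>t. poly ?G t *\<^sub>R J t \<partial>lborel)"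
      by (simp only: set_lebesgue_integral_def)
    then have "zmult e \<Xi> l = (\<integral>t. poly ?G t *\<^sub>R J t \<partial>lborel) /\<^sub>R wmean lam 1 /\<^sub>R poly ?G 1"
      using integral_zonal[OF e d, of "\<lambda>t. poly ?G t *\<^sub>R \<Xi> t"] by (simp add: zmult_def lam_def[symmetric])
    moreover have "complex_of_real (wmean lam 1 * poly ?G 1 * I) /\<^sub>R wmean lam 1 /\<^sub>R poly ?G 1 = complex_of_real I" for I
      using W G1 by (simp only: scaleR_conv_of_real of_real_mult[symmetric]) (simp add: field_simps)
    ultimately show ?thesis unfolding F by simp
  qed
  then have "zmult e \<Xi> = (\<lambda>l. complex_of_real (?T l))"
    by (rule ext)
  with zmult_tendsto_0[OF e d \<Xi>m \<Xi>i]
  have "(\<lambda>l. complex_of_real (?T l)) \<longlonglongrightarrow> of_real 0"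
    by (simp only: of_real_0)
  then show ?thesis by (simp only: tendsto_of_real_iff)
qed

section \<open>The frame estimate\<close>

lemma suminf_swap_ennreal:
  fixes f :: "nat \<Rightarrow> nat \<Rightarrow> ennreal"
  shows "(\<Sum>i. \<Sum>j. f i j) = (\<Sum>j. \<Sum>i. f i j)"
proof -
  have "(\<Sum>i. \<Sum>j. f i j) = (\<integral>\<^sup>+i. (\<Sum>j. f i j) \<partial>count_space UNIV)"
    by (rule nn_integral_count_space_nat[symmetric])
  also have "\<dots> = (\<Sum>j. \<integral>\<^sup>+i. f i j \<partial>count_space UNIV)"
    by (rule nn_integral_suminf) simp
  finally show ?thesis by (simp add: nn_integral_count_space_nat)
qed

lemma not_integrable_const_over_scale:
  fixes c :: real
  assumes "set_integrable lborel {0<..} (\<lambda>a. c / a)" "c > 0"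
  shows False
proof -
  define I where "I = (\<integral>\<^sup>+a. ennreal (c / a) * indicator {0<..} a \<partial>lborel)"
  have "I = (\<integral>\<^sup>+a. ennreal (norm (indicator {0<..} a *\<^sub>R (c / a))) \<partial>lborel)"
    unfolding I_def using assms(2) by (intro nn_integral_cong) (auto simp: indicator_def)
  then have fin: "I < \<infinity>"
    using assms(1) unfolding set_integrable_def integrable_iff_bounded by simp
  have "ennreal (real n) \<le> I" for n
  proof -
    have "ennreal (real n) = ennreal c * ennreal (ln (exp (real n / c) / 1))"
      using assms(2) by (simp flip: ennreal_mult)
    also have "\<dots> = ennreal c * (\<integral>\<^sup>+a. ennreal (1 / a) * indicator {1<..exp (real n / c)} a \<partial>lborel)"
      using assms(2) by (subst nn_integral_inverse_interval) auto
    also have "\<dots> = (\<integral>\<^sup>+a. ennreal c * (ennreal (1 / a) * indicator {1<..exp (real n / c)} a) \<partial>lborel)"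
      by (rule nn_integral_cmult[symmetric]) measurable
    also have "\<dots> \<le> I"
      unfolding I_def using assms(2)
      by (intro nn_integral_mono) (auto simp: indicator_def simp flip: ennreal_mult)
    finally show ?thesis .
  qed
  note lower = this
  obtain r where r: "I = ennreal r" "r \<ge> 0" using fin by (cases I) auto
  obtain n where "r < real n" using reals_Archimedean2 by blast
  then show False using lower[of n] r by simp
qed

context abs_cont_profile
begin

text \<open>
  \<open>mass_on {\<tau> l<..}\<close> vanishes as \<open>l\<close> grows but exceeds \<open>1 / 2\<close> whenever \<open>\<tau> l\<close> is small.
\<close>

lemma scale_bounded_below:
  fixes \<tau> :: "nat \<Rightarrow> real"
  assumes \<tau>: "\<And>l. 0 \<le> \<tau> l"
    and int: "\<And>l. set_integrable lborel {0<..} (\<lambda>a. \<phi> (a * \<tau> l) / a)"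
    and one: "\<And>l. (LBINT a:{0<..}. \<phi> (a * \<tau> l) / a) = 1"
    and lim: "(\<lambda>l. \<integral>a. indicator {1<..} a * (\<phi> (a * \<tau> l) / a) \<partial>lborel) \<longlonglongrightarrow> 0"
  shows "mass_on {0<..} = 1" and "\<exists>c>0. \<forall>l. c \<le> \<tau> l"
proof -
  let ?T = "\<lambda>l. \<integral>a. indicator {1<..} a * (\<phi> (a * \<tau> l) / a) \<partial>lborel"
  have pos: "\<tau> l > 0" for l
  proof (rule ccontr)
    assume "\<not> \<tau> l > 0"
    then have t0: "\<tau> l = 0" using \<tau>[of l] by simp
    show False
    proof (cases "\<phi> 0 = 0")
      case True
      then show False using one[of l] by (simp add: t0)
    next
      case False
      then have "\<phi> 0 > 0" using nonneg[of 0] by simp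
      then show False using int[of l] not_integrable_const_over_scale[of "\<phi> 0"] by (simp add: t0)
    qed
  qed
  have "mass_on {0 * \<tau> 0<..} = (\<integral>\<^sup>+a. ennreal (indicator {0<..} a * \<phi> (a * \<tau> 0) / a) \<partial>lborel)"
    by (rule mass_scale[OF pos]) simp
  also have "\<dots> = ennreal (\<integral>a. indicator {0<..} a *\<^sub>R (\<phi> (a * \<tau> 0) / a) \<partial>lborel)"
    using int[of 0] nonneg
    by (subst nn_integral_eq_integral[symmetric]) (auto simp: set_integrable_def indicator_def)
  finally show mass1: "mass_on {0<..} = 1"
    using one[of 0] by (simp add: set_lebesgue_integral_def)
  have tail: "mass_on {\<tau> l<..} = ennreal (?T l)" for l
  proof -
    have i: "integrable lborel (\<lambda>a. indicator {1<..} a * (\<phi> (a * \<tau> l) / a))"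
      using set_integrable_subset[OF int[of l], of "{1<..}"] by (auto simp: set_integrable_def)
    have "mass_on {1 * \<tau> l<..} = (\<integral>\<^sup>+a. ennreal (indicator {1<..} a * \<phi> (a * \<tau> l) / a) \<partial>lborel)"
      by (rule mass_scale[OF pos]) simp
    also have "\<dots> = (\<integral>\<^sup>+a. ennreal (indicator {1<..} a * (\<phi> (a * \<tau> l) / a)) \<partial>lborel)" by simp
    also have "\<dots> = ennreal (?T l)"
      using nonneg by (intro nn_integral_eq_integral[OF i]) (auto simp: indicator_def)
    finally show ?thesis by simp
  qed
  have "eventually (\<lambda>n. ennreal (1 / 2) < mass_on {1 / (real n + 1)<..}) sequentially"
    using mass_head_tendsto unfolding mass1
    by (rule order_tendstoD(1)) (subst ennreal_1[symmetric], rule ennreal_lessI, simp_all)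
  then obtain n where n: "ennreal (1 / 2) < mass_on {1 / (real n + 1)<..}"
    by (auto simp: eventually_sequentially)
  define s1 where "s1 = 1 / (real n + 1)"
  have s1: "s1 > 0" by (simp add: s1_def)
  have "eventually (\<lambda>l. ?T l < 1 / 2) sequentially"
    by (rule order_tendstoD(2)[OF lim]) simp
  then obtain L where L: "\<And>l. l \<ge> L \<Longrightarrow> ?T l < 1 / 2"
    by (auto simp: eventually_sequentially)
  have big: "s1 \<le> \<tau> l" if "l \<ge> L" for l
  proof (rule ccontr)
    assume "\<not> s1 \<le> \<tau> l"
    then have "mass_on {s1<..} \<le> mass_on {\<tau> l<..}" by (intro mass_mono) auto
    also have "\<dots> \<le> ennreal (1 / 2)" unfolding tail using L[OF that] by (intro ennreal_leI) simp
    finally show False using n by (simp add: s1_def)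
  qed
  define c where "c = Min (insert s1 (\<tau> ` {..<L}))"
  have "c > 0" unfolding c_def using s1 pos by (subst Min_gr_iff) auto
  moreover have "c \<le> \<tau> l" for l
  proof (cases "l < L")
    case True
    then show ?thesis unfolding c_def by (intro Min_le) auto
  next
    case False
    then have "c \<le> s1" unfolding c_def by (intro Min_le) auto
    then show ?thesis using big[of l] False by simp
  qed
  ultimately show "\<exists>c>0. \<forall>l. c \<le> \<tau> l" by blast
qed

lemma riemann_sum_uniform:
  assumes mass1: "mass_on {0<..} = 1" and c: "c > 0" and \<epsilon>: "\<epsilon> > 0" and \<delta>: "\<delta> > 0"
  shows "\<exists>\<rho>>0. \<forall>b s. (\<forall>j. b j > 0) \<and> b \<longlonglongrightarrow> 0 \<and> b 0 \<ge> - ln \<rho> \<and>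
           (\<forall>j. 1 < b j / b (Suc j) \<and> b j / b (Suc j) < 1 + \<rho> * \<delta>) \<and> c \<le> s \<longrightarrow>
           ennreal (1 - \<epsilon>) \<le> riemann_sum b s \<and>
           riemann_sum b s \<le> ennreal (1 + \<epsilon>)"
proof -
  define V where "V = enn2real (var_on {0<..})"
  have V: "var_on {0<..} = ennreal V" "V \<ge> 0"
    using var_finite by (simp_all add: V_def less_top)
  have "eventually (\<lambda>n. mass_on {real n<..} < ennreal (\<epsilon> / 2)) sequentially"
    by (rule order_tendstoD(2)[OF mass_tail_tendsto_0]) (use \<epsilon> mass1 in auto)
  then obtain T where T: "mass_on {real T<..} < ennreal (\<epsilon> / 2)"
    by (auto simp: eventually_sequentially)
  define \<rho> where "\<rho> = min (\<epsilon> / (2 * \<delta> * (V + 1))) (exp (- (real T / c)))"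
  have \<rho>: "\<rho> > 0" using \<epsilon> \<delta> V by (simp add: \<rho>_def)
  have \<rho>1: "\<rho> * \<delta> * V \<le> \<epsilon> / 2"
  proof -
    have cancel: "\<epsilon> / (2 * \<delta> * v) * \<delta> * v = \<epsilon> / 2" if "v > 0" for v
      using that \<delta> by (simp add: field_simps)
    have "\<rho> * \<delta> * V \<le> \<epsilon> / (2 * \<delta> * (V + 1)) * \<delta> * (V + 1)"
      using \<epsilon> \<delta> V by (intro mult_mono) (auto simp: \<rho>_def)
    also have "\<dots> = \<epsilon> / 2" using cancel[of "V + 1"] V by simp
    finally show ?thesis .
  qed
  have \<rho>2: "real T / c \<le> - ln \<rho>"
  proof -
    have "ln \<rho> \<le> ln (exp (- (real T / c)))" using \<rho> by (intro ln_mono) (auto simp: \<rho>_def)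
    then show ?thesis by simp
  qed
  have "ennreal (1 - \<epsilon>) \<le> riemann_sum b s \<and>
           riemann_sum b s \<le> ennreal (1 + \<epsilon>)"
    if b: "\<And>j. b j > 0" "b \<longlonglongrightarrow> 0" "b 0 \<ge> - ln \<rho>" "\<And>j. 1 < b j / b (Suc j)" "\<And>j. b j / b (Suc j) < 1 + \<rho> * \<delta>"
      and s: "c \<le> s" for b s
  proof -
    let ?S = "riemann_sum b s"
    have s0: "s > 0" using c s by simp
    note est = riemann_sum_estimate[OF b(1,2,4,5) s0]
    have "ennreal (\<rho> * \<delta>) * var_on {0<..} = ennreal (\<rho> * \<delta> * V)"
      using \<rho> \<delta> V by (simp add: ennreal_mult)
    also have "\<dots> \<le> ennreal (\<epsilon> / 2)" by (intro ennreal_leI \<rho>1)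
    finally have \<kappa>V: "ennreal (\<rho> * \<delta>) * var_on {0<..} \<le> ennreal (\<epsilon> / 2)" .
    have "real T / c * c \<le> b 0 * s"
      using \<rho>2 b(1)[of 0] b(3) c s by (intro mult_mono) auto
    then have T': "real T \<le> b 0 * s" using c by simp
    have split: "mass_on {0<..} = mass_on {0<..b 0 * s} + mass_on {b 0 * s<..}"
    proof -
      have "{0<..} = {0<..b 0 * s} \<union> {b 0 * s<..}"
        using b(1)[of 0] s0 by (auto intro: less_trans[of 0 "b 0 * s"])
      then have "mass_on {0<..} = mass_on ({0<..b 0 * s} \<union> {b 0 * s<..})" by (rule arg_cong)
      also have "\<dots> = mass_on {0<..b 0 * s} + mass_on {b 0 * s<..}" by (rule mass_Un) auto
      finally show ?thesis .
    qed
    have "mass_on {b 0 * s<..} \<le> mass_on {real T<..}" using T' by (intro mass_mono) auto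
    then have tail: "mass_on {b 0 * s<..} \<le> ennreal (\<epsilon> / 2)" using T by simp
    have "?S \<le> mass_on {0<..b 0 * s} + ennreal (\<rho> * \<delta>) * var_on {0<..}" by (rule est(1))
    also have "\<dots> \<le> 1 + ennreal (\<epsilon> / 2)"
    proof (intro add_mono \<kappa>V)
      have "mass_on {0<..b 0 * s} \<le> mass_on {0<..}" by (rule mass_mono) auto
      then show "mass_on {0<..b 0 * s} \<le> 1" using mass1 by simp
    qed
    also have "\<dots> \<le> ennreal (1 + \<epsilon>)"
      using \<epsilon> by (simp add: ennreal_leI flip: ennreal_1 ennreal_plus)
    finally have up: "?S \<le> ennreal (1 + \<epsilon>)" .
    have "1 \<le> mass_on {0<..b 0 * s} + mass_on {b 0 * s<..}" using split mass1 by simp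
    also have "\<dots> \<le> (?S + ennreal (\<rho> * \<delta>) * var_on {0<..}) + ennreal (\<epsilon> / 2)"
      by (intro add_mono est(2) tail)
    also have "\<dots> \<le> (?S + ennreal (\<epsilon> / 2)) + ennreal (\<epsilon> / 2)"
      by (intro add_mono \<kappa>V order_refl)
    also have "\<dots> = ?S + ennreal \<epsilon>"
      using \<epsilon> by (simp add: add.assoc flip: ennreal_plus)
    finally have lo: "1 \<le> ?S + ennreal \<epsilon>" .
    have "?S < \<infinity>" using up by (simp add: le_less_trans[OF _ ennreal_less_top])
    then obtain r where r: "?S = ennreal r" "r \<ge> 0" by (cases ?S) auto
    have "1 \<le> r + \<epsilon>" using lo r \<epsilon> by (simp add: r flip: ennreal_1 ennreal_plus)
    then have "ennreal (1 - \<epsilon>) \<le> ?S" unfolding r by (intro ennreal_leI) simp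
    then show ?thesis using up by blast
  qed
  then show ?thesis using \<rho> by blast
qed

end

lemma sq_integrable_L2_sphere:
  fixes f :: "'a::euclidean_space \<Rightarrow> complex"
  assumes f: "f \<in> L2_sphere"
  defines "F \<equiv> (\<lambda>x. indicator (sphere 0 1) x *\<^sub>R f x)"
  shows "sq_integrable F" and "(sphere_norm f)\<^sup>2 = (\<integral>x. (norm (F x))\<^sup>2 \<partial>usm)"
proof -
  have m: "f \<in> borel_measurable sphere_measure" and i: "integrable sphere_measure (\<lambda>x. (cmod (f x))\<^sup>2)"
    using f by (simp_all add: L2_sphere_def)
  have Fm [measurable]: "F \<in> borel_measurable borel" unfolding F_def by (rule borel_measurable_sphere_ext[OF m])
  have "integrable sphere_measure (\<lambda>x. (norm (F x))\<^sup>2)"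
    using i by (rule Bochner_Integration.integrable_cong[THEN iffD1, rotated -1]) (auto simp: F_def)
  then have "integrable usm (\<lambda>x. (norm (F x))\<^sup>2)" by (subst (asm) integrable_sphere) auto
  then show "sq_integrable F" using Fm by (simp add: sq_integrable_def)
  have S: "sphere_area TYPE('a) > 0" by (rule sphere_area_pos)
  have "(\<integral>y. cnj (f y) * f y \<partial>sphere_measure) = (\<integral>y. complex_of_real ((norm (F y))\<^sup>2) \<partial>sphere_measure)"
    by (intro Bochner_Integration.integral_cong) (auto simp: F_def complex_norm_square mult.commute simp del: of_real_power)
  also have "\<dots> = sphere_area TYPE('a) *\<^sub>R (\<integral>y. complex_of_real ((norm (F y))\<^sup>2) \<partial>usm)"
    by (rule integral_sphere) measurable
  also have "\<dots> = complex_of_real (sphere_area TYPE('a) * (\<integral>y. (norm (F y))\<^sup>2 \<partial>usm))"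
    by (simp only: integral_complex_of_real scaleR_conv_of_real of_real_mult)
  finally have "sphere_inner f f = complex_of_real (\<integral>y. (norm (F y))\<^sup>2 \<partial>usm)"
    using S by (simp add: sphere_inner_def)
  then show "(sphere_norm f)\<^sup>2 = (\<integral>x. (norm (F x))\<^sup>2 \<partial>usm)" by (simp add: sphere_norm_def)
qed

lemma wavelet_transform_energy:
  fixes f :: "'a::euclidean_space \<Rightarrow> complex" and e :: 'a
  assumes d: "DIM('a) \<ge> 3" and e: "norm e = 1" and i: "integrable sphere_measure (zonal e (g a))"
    and f: "f \<in> L2_sphere"
  shows "(\<integral>\<^sup>+x. ennreal ((cmod (wavelet_transform g f a x))\<^sup>2) \<partial>sphere_measure) =
     ennreal (sphere_area TYPE('a)) *
       (\<Sum>l. ennreal ((norm (zmult e (clip (g a)) l))\<^sup>2) * ennreal (harm_energy l (\<lambda>x. indicator (sphere 0 1) x *\<^sub>R f x)))"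
proof -
  define F where "F x = indicator (sphere 0 1) x *\<^sub>R f x" for x
  have F: "sq_integrable F" unfolding F_def[abs_def] by (rule sq_integrable_L2_sphere(1)[OF f])
  note [measurable] = sq_integrable_measurable[OF F]
  have d2: "DIM('a) \<ge> 2" using d by simp
  define h where "h t = cnj (clip (g a) t)" for t
  note c = clip_integrable[OF d2 e i]
  have h [measurable]: "h \<in> borel_measurable borel" unfolding h_def using c(1) by measurable
  have hi: "integrable usm (\<lambda>y. h (e \<bullet> y))" using c(2) by (simp add: h_def)
  have S: "sphere_area TYPE('a) > 0" by (rule sphere_area_pos)
  have W: "wavelet_transform g f a x = zconv h F x" if x: "norm x = 1" for x
  proof -
    have "(\<integral>y. cnj (zonal x (g a) y) * f y \<partial>sphere_measure) = (\<integral>y. h (x \<bullet> y) * F y \<partial>sphere_measure)"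
      using x by (intro Bochner_Integration.integral_cong) (auto simp: F_def h_def zonal_def clip_inner)
    also have "\<dots> = sphere_area TYPE('a) *\<^sub>R zconv h F x"
      unfolding zconv_def by (rule integral_sphere) measurable
    finally show ?thesis
      using S by (simp add: wavelet_transform_def sphere_inner_def scaleR_conv_of_real)
  qed
  have "(\<integral>\<^sup>+x. ennreal ((cmod (wavelet_transform g f a x))\<^sup>2) \<partial>sphere_measure) =
      (\<integral>\<^sup>+x. ennreal ((norm (zconv h F x))\<^sup>2) \<partial>sphere_measure)"
    by (intro nn_integral_cong) (simp add: W)
  also have "\<dots> = ennreal (sphere_area TYPE('a)) * (\<integral>\<^sup>+x. ennreal ((norm (zconv h F x))\<^sup>2) \<partial>usm)"
    by (rule nn_integral_sphere) measurable
  also have "(\<integral>\<^sup>+x. ennreal ((norm (zconv h F x))\<^sup>2) \<partial>usm) = ennreal (\<integral>x. (norm (zconv h F x))\<^sup>2 \<partial>usm)"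
    by (intro nn_integral_eq_integral sq_integrable_norm_sq sq_integrable_zconv[OF e h hi F]) auto
  also have "\<dots> = (\<Sum>l. ennreal ((norm (zmult e h l))\<^sup>2 * harm_energy l F))"
    by (rule suminf_ennreal_eq[symmetric, OF _ zconv_energy_sums[OF d e h hi F]]) simp
  also have "\<dots> = (\<Sum>l. ennreal ((norm (zmult e (clip (g a)) l))\<^sup>2) * ennreal (harm_energy l F))"
    unfolding h_def by (simp add: zmult_cnj ennreal_mult)
  finally show ?thesis by (simp add: F_def[abs_def])
qed

theorem theorem3p2:
  fixes n :: nat and k :: "'m::finite"
    and g :: "real \<Rightarrow> real \<Rightarrow> complex" and \<tau> :: "nat \<Rightarrow> real" and \<gamma> :: "real \<Rightarrow> complex"
    and lam \<epsilon> \<delta> :: real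
  assumes "n \<ge> 2" and "CARD('m) = n + 1" and "lam = (real n - 1) / 2"
    and "spherical_wavelet (axis k 1 :: real ^ 'm) g"
    and "\<And>l. 0 \<le> \<tau> l"
    and "\<And>a l. a > 0 \<Longrightarrow>
           gegenbauer_coeff lam (g a) l = of_real ((real l + lam) / lam) * \<gamma> (a * \<tau> l)"
    and "\<And>t. t > 0 \<Longrightarrow> (\<lambda>s. (cmod (\<gamma> s))\<^sup>2) differentiable (at t)"
    and "set_integrable lborel {0<..} (deriv (\<lambda>s. (cmod (\<gamma> s))\<^sup>2))"
    and "\<epsilon> > 0" and "\<delta> > 0"
  shows "\<exists>\<rho>>0. \<forall>b :: nat \<Rightarrow> real.
           (\<forall>j. b j > 0) \<and> b \<longlonglongrightarrow> 0 \<and> b 0 \<ge> - ln \<rho> \<and>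
           (\<forall>j. 1 < b j / b (Suc j) \<and> b j / b (Suc j) < 1 + \<rho> * \<delta>) \<longrightarrow>
           (\<exists>\<nu> :: nat \<Rightarrow> real. (\<forall>j. \<nu> j > 0) \<and>
              (\<forall>f \<in> (L2_sphere :: (real ^ 'm \<Rightarrow> complex) set).
                 ennreal ((1 - \<epsilon>) * (sphere_norm f)\<^sup>2)
                   \<le> (\<Sum>j. ennreal (\<nu> j) *
                        (\<integral>\<^sup>+x. ennreal ((cmod (wavelet_transform g f (b j) x))\<^sup>2) \<partial>sphere_measure)) \<and>
                 (\<Sum>j. ennreal (\<nu> j) *
                        (\<integral>\<^sup>+x. ennreal ((cmod (wavelet_transform g f (b j) x))\<^sup>2) \<partial>sphere_measure))
                   \<le> ennreal ((1 + \<epsilon>) * (sphere_norm f)\<^sup>2)))"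
proof -
  define e where "e = (axis k 1 :: real ^ 'm)"
  have e: "norm e = 1" by (simp add: e_def)
  have d: "DIM(real ^ 'm) \<ge> 3" and lam_eq: "gegenbauer_index TYPE(real ^ 'm) = lam"
    using assms(1-3) by (simp_all add: gegenbauer_index_def)
  have d2: "DIM(real ^ 'm) \<ge> 2" using d by simp
  have lam: "lam \<ge> 1 / 2" using gegenbauer_index_ge[OF d] by (simp only: lam_eq)
  define \<phi> where "\<phi> s = (cmod (\<gamma> s))\<^sup>2" for s
  interpret abs_cont_profile \<phi>
    by standard (use assms(7,8) in \<open>simp_all add: \<phi>_def[abs_def]\<close>)
  note wav = assms(4)[unfolded spherical_wavelet_def Let_def lam_eq, folded e_def]
  have i: "integrable sphere_measure (zonal e (g a))" if "a > 0" for a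
    using wav that by blast
  have zm: "zmult e (clip (g a)) l = \<gamma> (a * \<tau> l)" if "a > 0" for a l
  proof -
    have "complex_of_real ((real l + lam) / lam) * zmult e (clip (g a)) l
        = complex_of_real ((real l + lam) / lam) * \<gamma> (a * \<tau> l)"
      using gegenbauer_coeff_zmult[OF e d clip_integrable(1)[OF d2 e i[OF that]], of l] assms(6)[OF that, of l]
      by (simp only: lam_eq gegenbauer_coeff_clip)
    moreover have "complex_of_real ((real l + lam) / lam) \<noteq> 0" using lam by (simp only: of_real_eq_0_iff) simp
    ultimately show ?thesis using mult_left_cancel by blast
  qed
  have K: "set_integrable (lborel \<Otimes>\<^sub>M lborel) ({1<..} \<times> {-1..1})
                   (\<lambda>(a, t). profile e (sphere_conv (zonal e (\<lambda>t. cnj (g a t))) (g a)) t / of_real a * of_real (gegenbauer_weight lam t))"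
    using wav by (auto dest: spec[of _ 1])
  have adm: "set_integrable lborel {0<..} (\<lambda>a. \<phi> (a * \<tau> l) / a)" "(LBINT a:{0<..}. \<phi> (a * \<tau> l) / a) = 1" for l
  proof -
    let ?c = "((real l + lam) / lam)\<^sup>2"
    have c: "?c \<noteq> 0" using lam by simp
    have "indicator {0<..} a *\<^sub>R ((cmod (gegenbauer_coeff lam (g a) l))\<^sup>2 / a) = ?c *\<^sub>R (indicator {0<..} a *\<^sub>R (\<phi> (a * \<tau> l) / a))" for a
    proof (cases "a > 0")
      case True
      have "cmod (gegenbauer_coeff lam (g a) l) = \<bar>(real l + lam) / lam\<bar> * cmod (\<gamma> (a * \<tau> l))"
        unfolding assms(6)[OF True] by (simp only: norm_mult norm_of_real)
      then show ?thesis using True by (simp add: power_mult_distrib power_divide \<phi>_def)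
    qed simp
    note eq = this
    have "set_integrable lborel {0<..} (\<lambda>a. (cmod (gegenbauer_coeff lam (g a) l))\<^sup>2 / a)"
      and I: "(LBINT a:{0<..}. (cmod (gegenbauer_coeff lam (g a) l))\<^sup>2 / a) = ?c"
      using wav by blast+
    then show "set_integrable lborel {0<..} (\<lambda>a. \<phi> (a * \<tau> l) / a)"
      unfolding set_integrable_def eq using c by (subst (asm) integrable_scaleR_iff) auto
    from I show "(LBINT a:{0<..}. \<phi> (a * \<tau> l) / a) = 1"
      unfolding set_lebesgue_integral_def eq integral_scaleR_right using c by simp
  qed
  have tail_eq: "indicator {1<..} a * ((norm (zmult e (clip (g a)) l))\<^sup>2 / a) = indicator {1<..} a * (\<phi> (a * \<tau> l) / a)" for a l
    by (cases "a > 1") (simp_all add: zm \<phi>_def)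
  have lim: "(\<lambda>l. \<integral>a. indicator {1<..} a * (\<phi> (a * \<tau> l) / a) \<partial>lborel) \<longlonglongrightarrow> 0"
    using wavelet_tail_multiplier_tendsto_0[OF d e i, unfolded lam_eq, OF _ K] by (simp only: tail_eq)
  note bounds = scale_bounded_below[OF assms(5) adm lim]
  obtain c where c: "c > 0" "\<And>l. c \<le> \<tau> l" using bounds(2) by blast
  obtain \<rho> where \<rho>: "\<rho> > 0" and sums: "\<And>b s. (\<forall>j. b j > 0) \<and> b \<longlonglongrightarrow> 0 \<and> b 0 \<ge> - ln \<rho> \<and>
           (\<forall>j. 1 < b j / b (Suc j) \<and> b j / b (Suc j) < 1 + \<rho> * \<delta>) \<and> c \<le> s \<Longrightarrow>
           ennreal (1 - \<epsilon>) \<le> riemann_sum b s \<and>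
           riemann_sum b s \<le> ennreal (1 + \<epsilon>)"
    using riemann_sum_uniform[OF bounds(1) c(1) assms(9,10)] by blast
  define \<Sigma> where "\<Sigma> = sphere_area TYPE(real ^ 'm)"
  have \<Sigma>: "\<Sigma> > 0" unfolding \<Sigma>_def by (rule sphere_area_pos)
  let ?E = "\<lambda>b f j. \<integral>\<^sup>+(x :: real ^ 'm). ennreal ((cmod (wavelet_transform g f (b j) x))\<^sup>2) \<partial>sphere_measure"
  have main: "\<exists>\<nu> :: nat \<Rightarrow> real. (\<forall>j. \<nu> j > 0) \<and>
              (\<forall>f \<in> (L2_sphere :: (real ^ 'm \<Rightarrow> complex) set).
                 ennreal ((1 - \<epsilon>) * (sphere_norm f)\<^sup>2)
                   \<le> (\<Sum>j. ennreal (\<nu> j) * ?E b f j) \<and>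
                 (\<Sum>j. ennreal (\<nu> j) * ?E b f j)
                   \<le> ennreal ((1 + \<epsilon>) * (sphere_norm f)\<^sup>2))"
    if b: "(\<forall>j. b j > 0) \<and> b \<longlonglongrightarrow> 0 \<and> b 0 \<ge> - ln \<rho> \<and>
           (\<forall>j. 1 < b j / b (Suc j) \<and> b j / b (Suc j) < 1 + \<rho> * \<delta>)" for b :: "nat \<Rightarrow> real"
  proof (intro exI[of _ "\<lambda>j. ln (b j / b (Suc j)) / \<Sigma>"] conjI ballI allI)
    show "ln (b j / b (Suc j)) / \<Sigma> > 0" for j
      using b \<Sigma> by (intro divide_pos_pos ln_gt_zero) auto
    fix f :: "real ^ 'm \<Rightarrow> complex" assume f: "f \<in> L2_sphere"
    define F where "F x = indicator (sphere 0 1) x *\<^sub>R f x" for x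
    note F = sq_integrable_L2_sphere[OF f, folded F_def]
    define s where "s l = riemann_sum b (\<tau> l)" for l
    have s: "ennreal (1 - \<epsilon>) \<le> s l" "s l \<le> ennreal (1 + \<epsilon>)" for l
      using sums[of b "\<tau> l"] b c(2) unfolding s_def by blast+
    have "(\<Sum>j. ennreal (ln (b j / b (Suc j)) / \<Sigma>) *
          ?E b f j)
      = (\<Sum>j. \<Sum>l. ennreal (ln (b j / b (Suc j))) * ennreal (\<phi> (b j * \<tau> l)) * ennreal (harm_energy l F))"
    proof (rule suminf_cong)
      fix j
      have bj: "b j > 0" using b by blast
      have "?E b f j
        = ennreal \<Sigma> * (\<Sum>l. ennreal (\<phi> (b j * \<tau> l)) * ennreal (harm_energy l F))"
        using wavelet_transform_energy[where g=g and a="b j", OF d e i[OF bj] f] by (simp add: zm[OF bj] \<phi>_def \<Sigma>_def F_def[abs_def])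
      moreover have "ennreal (ln (b j / b (Suc j)) / \<Sigma>) * ennreal \<Sigma> = ennreal (ln (b j / b (Suc j)))"
        using \<Sigma> b by (simp flip: ennreal_mult'')
      ultimately show "ennreal (ln (b j / b (Suc j)) / \<Sigma>) *
          ?E b f j
        = (\<Sum>l. ennreal (ln (b j / b (Suc j))) * ennreal (\<phi> (b j * \<tau> l)) * ennreal (harm_energy l F))"
        by (simp add: mult.assoc[symmetric]) (simp add: mult.assoc)
    qed
    also have "\<dots> = (\<Sum>l. s l * ennreal (harm_energy l F))"
      by (subst suminf_swap_ennreal) (simp add: s_def riemann_sum_def)
    finally have eq: "(\<Sum>j. ennreal (ln (b j / b (Suc j)) / \<Sigma>) *
          ?E b f j) = (\<Sum>l. s l * ennreal (harm_energy l F))" .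
    have pars: "(\<Sum>l. ennreal r * ennreal (harm_energy l F)) = ennreal (r * (sphere_norm f)\<^sup>2)" for r
    proof -
      have "(\<Sum>l. ennreal (harm_energy l F)) = ennreal ((sphere_norm f)\<^sup>2)"
        unfolding F(2) by (rule suminf_ennreal_eq[OF _ parseval_sphere[OF d F(1)]]) simp
      then show ?thesis by (simp add: ennreal_mult'')
    qed
    show "ennreal ((1 - \<epsilon>) * (sphere_norm f)\<^sup>2) \<le> (\<Sum>j. ennreal (ln (b j / b (Suc j)) / \<Sigma>) *
          ?E b f j)"
      unfolding eq pars[symmetric] by (intro suminf_le mult_right_mono s) auto
    show "(\<Sum>j. ennreal (ln (b j / b (Suc j)) / \<Sigma>) *
          ?E b f j) \<le> ennreal ((1 + \<epsilon>) * (sphere_norm f)\<^sup>2)"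
      unfolding eq pars[symmetric] by (intro suminf_le mult_right_mono s) auto
  qed
  show ?thesis
    using \<rho> main by blast
qed

end
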